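(* Assume $1<\alpha<\frac4d+1$, $r=\alpha+1$, and $(p,r)$ admissible. Let $R>0$ and for $u\in\mathbb L^{\infty,p}_{2,r}(T)$ define $$I_R(u)(t):=\int_0^tS(t-s)\,\theta_R\big(\|u\|_{\mathbb L^{\infty,p}_{2,r}(s)}\big)\,\mathcal N(u(s))\,ds .$$ Then for every $T>0$, $I_R$ maps $\mathbb L^{\infty,p}_{2,r}(T)$ into itself, and for $u_1,u_2\in\mathbb L^{\infty,p}_{2,r}(T)$, $$\|I_R(u_1)-I_R(u_2)\|_{\mathbb L^{\infty,p}_{2,r}(T)}\le C\,T^{\frac{p-r}{p}}\|u_1-u_2\|_{\mathbb L^{\infty,p}_{2,r}(T)},$$ with a constant $C>0$ independent of $u_1,u_2$.
   Context: $H=L^2(\mathbb R^d;\mathbb C)$, $S(t)=e^{it\Delta}$, $\mathcal N(u)=|u|^{\alpha-1}u$. A pair $(p,r)\in[2,\infty]^2$ is admissible if $\frac2p=\frac d2-\frac dr$ and $(p,r,d)\ne(2,\infty,2)$. For $t>0$, $\mathbb L^{\infty,p}_{2,r}(t)=L^\infty(0,t;H)\cap L^p(0,t;L^r(\mathbb R^d))$ with norm $\|u\|_{\mathbb L^{\infty,p}_{2,r}(t)}=\|u\|_{L^\infty(0,t;H)}+\|u\|_{L^p(0,t;L^r(\mathbb R^d))}$. $\theta\in C_0^\infty(\mathbb R)$ has support in $(-2,2)$, values in $[0,1]$, and $\theta=1$ on $[-1,1]$; $\theta_R(x)=\theta(x/R)$. *)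

theory Defs
  imports "HOL-Analysis.Analysis"
begin

definition dir_deriv :: "'a::euclidean_space \<Rightarrow> ('a \<Rightarrow> complex) \<Rightarrow> 'a \<Rightarrow> complex" where
  "dir_deriv v f x = frechet_derivative f (at x) v"

definition smooth_fun :: "('a::euclidean_space \<Rightarrow> complex) \<Rightarrow> bool" where
  "smooth_fun f \<longleftrightarrow> (\<forall>vs x. (foldr dir_deriv vs f) differentiable (at x))"

definition test_fun :: "('a::euclidean_space \<Rightarrow> complex) \<Rightarrow> bool" where
  "test_fun \<phi> \<longleftrightarrow> smooth_fun \<phi> \<and> bounded {x. \<phi> x \<noteq> 0}"

definition smooth_real :: "(real \<Rightarrow> real) \<Rightarrow> bool" where
  "smooth_real f \<longleftrightarrow> (\<forall>n x. ((deriv ^^ n) f) differentiable (at x))"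

text \<open>Schroedinger kernel of e^{i tau Delta} on R^d, tau \<noteq> 0:
  (4 pi i tau)^{-d/2} e^{i|z|^2/(4 tau)} with the principal branch,
  i.e. (4 pi |tau|)^{-d/2} e^{-i pi d sgn(tau)/4} e^{i|z|^2/(4 tau)}.\<close>
definition schr_kernel :: "real \<Rightarrow> real^'n \<Rightarrow> complex" where
  "schr_kernel \<tau> z =
     complex_of_real ((4 * pi * \<bar>\<tau>\<bar>) powr (- real CARD('n) / 2))
     * cis (- pi * real CARD('n) * sgn \<tau> / 4)
     * cis (norm z ^ 2 / (4 * \<tau>))"

text \<open>S(tau) = e^{i tau Delta} acting on (integrable) test functions.\<close>
definition schr :: "real \<Rightarrow> (real^'n \<Rightarrow> complex) \<Rightarrow> real^'n \<Rightarrow> complex" where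
  "schr \<tau> \<phi> x = (if \<tau> = 0 then \<phi> x
                   else (\<integral> y. schr_kernel \<tau> (x - y) * \<phi> y \<partial>lborel))"

definition nonlin :: "real \<Rightarrow> complex \<Rightarrow> complex" where
  "nonlin \<alpha> z = complex_of_real (cmod z powr (\<alpha> - 1)) * z"

definition Lq_int :: "real \<Rightarrow> (real^'n \<Rightarrow> complex) \<Rightarrow> ennreal" where
  "Lq_int q f = (\<integral>\<^sup>+ x. ennreal (cmod (f x) powr q) \<partial>lborel)"

definition Lq_norm :: "real \<Rightarrow> (real^'n \<Rightarrow> complex) \<Rightarrow> real" where
  "Lq_norm q f = enn2real (Lq_int q f) powr (1 / q)"

text \<open>Membership in L^infty(0,T;L^2) \<inter> L^p(0,T;L^r), for a (jointly measurable)
  representative u(t,x).\<close>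
definition in_LL :: "real \<Rightarrow> real \<Rightarrow> real \<Rightarrow> (real \<Rightarrow> real^'n \<Rightarrow> complex) \<Rightarrow> bool" where
  "in_LL p r T u \<longleftrightarrow>
     (\<lambda>(t, x). u t x) \<in> borel_measurable (lborel \<Otimes>\<^sub>M lborel)
   \<and> (\<exists>C. AE t in lborel. t \<in> {0<..<T} \<longrightarrow> Lq_int 2 (u t) \<le> ennreal C)
   \<and> (AE t in lborel. t \<in> {0<..<T} \<longrightarrow> Lq_int r (u t) < \<infinity>)
   \<and> (\<integral>\<^sup>+ t \<in> {0<..<T}. ennreal (Lq_norm r (u t) powr p) \<partial>lborel) < \<infinity>"

definition Linf2_norm :: "real \<Rightarrow> (real \<Rightarrow> real^'n \<Rightarrow> complex) \<Rightarrow> real" where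
  "Linf2_norm T u = Inf {C. 0 \<le> C \<and> (AE t in lborel. t \<in> {0<..<T} \<longrightarrow> Lq_norm 2 (u t) \<le> C)}"

definition Lpr_norm :: "real \<Rightarrow> real \<Rightarrow> real \<Rightarrow> (real \<Rightarrow> real^'n \<Rightarrow> complex) \<Rightarrow> real" where
  "Lpr_norm p r T u =
     enn2real (\<integral>\<^sup>+ t \<in> {0<..<T}. ennreal (Lq_norm r (u t) powr p) \<partial>lborel) powr (1 / p)"

definition LL_norm :: "real \<Rightarrow> real \<Rightarrow> real \<Rightarrow> (real \<Rightarrow> real^'n \<Rightarrow> complex) \<Rightarrow> real" where
  "LL_norm p r T u = Linf2_norm T u + Lpr_norm p r T u"

text \<open>g = I_R(u) on [0,T]: for every t in [0,T], g(t) \<in> L^2 is the (weak, Bochner-in-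
  the-dual sense) Duhamel integral
    g(t) = int_0^t S(t-s) theta_R(||u||_{L(s)}) N(u(s)) ds,
  i.e. for every test function phi,
    <g(t), phi> = int_0^t < theta_R(||u||_{L(s)}) N(u(s)), S(s-t) phi > ds,
  all integrals being absolutely convergent.  (Test functions are dense in L^2,
  so this determines g(t).)\<close>
definition duhamel_rel ::
  "(real \<Rightarrow> real) \<Rightarrow> real \<Rightarrow> real \<Rightarrow> real \<Rightarrow> real \<Rightarrow> real
     \<Rightarrow> (real \<Rightarrow> real^'n \<Rightarrow> complex) \<Rightarrow> (real \<Rightarrow> real^'n \<Rightarrow> complex) \<Rightarrow> bool" where
  "duhamel_rel \<theta> R \<alpha> p r T u g \<longleftrightarrow>
     (\<forall>t \<in> {0..T}. g t \<in> borel_measurable lborel \<and> Lq_int 2 (g t) < \<infinity> \<and>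
       (\<forall>\<phi>. test_fun \<phi> \<longrightarrow>
          (let F = (\<lambda>s x. complex_of_real (\<theta> (LL_norm p r s u / R)) * nonlin \<alpha> (u s x)
                               * cnj (schr (s - t) \<phi> x))
           in (AE s in lborel. s \<in> {0<..<t} \<longrightarrow> integrable lborel (F s))
            \<and> set_integrable lborel {0<..<t} (\<lambda>s. \<integral> x. F s x \<partial>lborel)
            \<and> (\<integral> x. g t x * cnj (\<phi> x) \<partial>lborel)
                = (LINT s:{0<..<t}|lborel. (\<integral> x. F s x \<partial>lborel)))))"

end

theory Submission
  imports Defs "HOL-Probability.Probability"
begin

text \<open>
  Strichartz without endpoint machinery. Gaussian regularisation of the kernel gives both the \<open>L\<^sup>2\<close>
  contractivity of \<open>S(\<tau>)\<close> and a uniform bound for the kernel of \<open>S(-b) exp(-\<epsilon>|x|\<^sup>2) S(a)\<close>; real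
  interpolation then yields the dispersive estimate and, letting \<open>\<epsilon>\<close> tend to 0, the bilinear bound
  for \<open>\<langle>S(a)f, S(b)g\<rangle>\<close> that the \<open>TT*\<close> argument needs, so neither the Fourier transform nor the
  group law enters. As \<open>p > r\<close>, the source lies in \<open>L\<^sup>m\<close> in time with \<open>m = p/\<alpha>\<close>, which is better than
  the dual exponent of \<open>p\<close>; Young's inequality on \<open>(0,T)\<close> replaces Hardy-Littlewood-Sobolev and
  produces the power \<open>(p-r)/p\<close> of \<open>T\<close>. In the difference estimate only times with
  \<open>\<parallel>u\<^sub>j\<parallel> \<le> 2R\<close> contribute, which makes the constant independent of \<open>u\<^sub>1\<close> and \<open>u\<^sub>2\<close>.
\<close>

section \<open>Gaussian integrals on Euclidean space\<close>

text \<open>The Duhamel integral is characterised only weakly, at every \<open>t\<close> and against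
  test functions. Every bound is therefore proved by duality for an arbitrary \<open>g\<close>
  satisfying the weak identity. That identity is linear in source and solution, so the solution for
  one datum, the difference of two solutions and the difference of two approximations are all
  treated by the same locale \<open>duhamel_data\<close>. The obstacle is existence at every single
  \<open>t\<close>. The dispersive bound of the integrand near \<open>s = t\<close> is integrable
  for almost every \<open>t\<close> only, so absolute convergence has to come from the
  \<open>L^2\<close> estimate. The solution is built from sources that are switched off shortly
  before \<open>t\<close>; for these the kernel is bounded and all interchanges of integrals are
  elementary. The power of \<open>T\<close> is a gap between exponents: since
  \<open>r - 1 = \<alpha>\<close>, the difference of \<open>1 - 1/p\<close> and
  \<open>\<alpha>/p\<close> is \<open>(p - r)/p\<close>, which is positive exactly when
  \<open>m = p/\<alpha>\<close> exceeds the dual exponent of \<open>p\<close>.\<close>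

lemma integral_lborel_prod:
  fixes f :: "'a::euclidean_space \<Rightarrow> real \<Rightarrow> complex"
  assumes f: "\<And>b. b \<in> Basis \<Longrightarrow> integrable lborel (f b)"
  shows "integrable lborel (\<lambda>x::'a. \<Prod>b\<in>Basis. f b (x \<bullet> b))"
    and "(\<integral>x. (\<Prod>b\<in>Basis. f b (x \<bullet> b)) \<partial>(lborel :: ('a) measure)) = (\<Prod>b\<in>Basis. integral\<^sup>L lborel (f b))"
proof -
  interpret product_sigma_finite "\<lambda>_::'a. lborel :: real measure" ..
  have m [measurable]: "\<And>b. b \<in> Basis \<Longrightarrow> f b \<in> borel_measurable borel"
    using borel_measurable_integrable[OF f] by simp
  have T [measurable]: "(\<lambda>g. \<Sum>b\<in>Basis. g b *\<^sub>R b) \<in> (\<Pi>\<^sub>M b\<in>Basis. lborel) \<rightarrow>\<^sub>M (borel :: 'a measure)"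
    by measurable
  have M [measurable]: "(\<lambda>x::'a. \<Prod>b\<in>Basis. f b (x \<bullet> b)) \<in> borel_measurable borel"
    by measurable
  have eq: "(\<Prod>b\<in>Basis. f b ((\<Sum>c\<in>Basis. g c *\<^sub>R c) \<bullet> (b::'a))) = (\<Prod>b\<in>Basis. f b (g b))" for g
    by (intro prod.cong refl arg_cong[of _ _ "f _"])
       (simp add: inner_sum_left inner_Basis if_distrib cong: if_cong)
  show "integrable lborel (\<lambda>x::'a. \<Prod>b\<in>Basis. f b (x \<bullet> b))"
    apply (subst lborel_eq)
    apply (subst integrable_distr_eq[OF T M])
    apply (simp add: eq product_integrable_prod f)
    done
  show "(\<integral>x. (\<Prod>b\<in>Basis. f b (x \<bullet> b)) \<partial>(lborel :: ('a) measure)) = (\<Prod>b\<in>Basis. integral\<^sup>L lborel (f b))"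
    apply (subst lborel_eq)
    apply (subst integral_distr[OF T M])
    apply (simp add: eq product_integral_prod f)
    done
qed

text \<open>A linear substitution turns the weight into the standard normal density, whose
  characteristic function is known. The later Gaussian formulas reduce to this one.\<close>

lemma gaussian_1d:
  fixes \<sigma> \<xi> :: real
  assumes "\<sigma> > 0"
  shows "integrable lborel (\<lambda>y. complex_of_real (exp (- \<sigma> * y^2)) * cis (\<xi> * y))"
    and "(\<integral>y. complex_of_real (exp (- \<sigma> * y^2)) * cis (\<xi> * y) \<partial>lborel)
         = complex_of_real (sqrt (pi / \<sigma>) * exp (- (\<xi>^2) / (4 * \<sigma>)))"
proof -
  \<comment> \<open>Chosen so that \<open>\<sigma> * c^2 = 1/2\<close>, the exponent in the normal
    density.\<close>
  define c where "c = 1 / sqrt (2 * \<sigma>)"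
  have c: "c > 0" using assms by (simp add: c_def)
  have c2: "c^2 = 1 / (2 * \<sigma>)" using assms by (simp add: c_def power_divide)
  let ?g = "\<lambda>x. complex_of_real (exp (- (x^2) / 2)) * cis (\<xi> * c * x)"
  have gm: "?g = (\<lambda>x. sqrt (2 * pi) * (std_normal_density x *\<^sub>R iexp (\<xi> * c * x)))"
    by (auto simp: std_normal_density_def fun_eq_iff scaleR_conv_of_real cis_conv_exp real_sqrt_mult)
  have "char std_normal_distribution (\<xi> * c) = (CLINT x|lborel. std_normal_density x *\<^sub>R iexp (\<xi> * c * x))"
    unfolding char_def by (subst integral_density) auto
  hence I: "integral\<^sup>L lborel ?g = sqrt (2 * pi) * exp (- ((\<xi> * c)^2) / 2)"
    unfolding gm by (subst integral_mult_right_zero) (simp add: char_std_normal_distribution)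
  have "integrable lborel (\<lambda>x. std_normal_density x *\<^sub>R iexp (\<xi> * c * x))"
  proof (rule Bochner_Integration.integrable_bound)
    show "integrable lborel std_normal_density" by simp
  qed (auto simp: norm_mult)
  hence G: "integrable lborel ?g" unfolding gm by (intro integrable_mult_right)
  let ?f = "\<lambda>y. complex_of_real (exp (- \<sigma> * y^2)) * cis (\<xi> * y)"
  have fg: "?f (0 + c * x) = ?g x" for x
    using assms by (simp add: power_mult_distrib c2 mult_ac)
  show "integrable lborel ?f"
    using G lborel_integrable_real_affine_iff[of c ?f 0] c unfolding fg by auto
  have "(\<integral>y. ?f y \<partial>lborel) = \<bar>c\<bar> *\<^sub>R integral\<^sup>L lborel ?g"
    using lborel_integral_real_affine[of c ?f 0] c unfolding fg by simp
  also have "\<dots> = complex_of_real (sqrt (pi / \<sigma>) * exp (- (\<xi>^2) / (4 * \<sigma>)))"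
  proof -
    have "c * sqrt (2 * pi) = sqrt (pi / \<sigma>)"
      using assms by (simp add: c_def real_sqrt_divide real_sqrt_mult)
    moreover have "(\<xi> * c)^2 / 2 = \<xi>^2 / (4 * \<sigma>)"
      using assms by (simp add: power_mult_distrib c2)
    ultimately show ?thesis unfolding I using c
      by (metis abs_of_pos minus_divide_left mult.assoc of_real_mult scaleR_conv_of_real)
  qed
  finally show "(\<integral>y. ?f y \<partial>lborel) = complex_of_real (sqrt (pi / \<sigma>) * exp (- (\<xi>^2) / (4 * \<sigma>)))" .
qed

lemma prod_cis: "(\<Prod>i\<in>A. cis (f i)) = cis (\<Sum>i\<in>A. f i)"
  by (induction A rule: infinite_finite_induct) (auto simp: cis_mult)

lemma gaussian_fourier:
  fixes \<xi> :: "'a::euclidean_space"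
  assumes "\<sigma> > 0"
  shows "integrable lborel (\<lambda>y. complex_of_real (exp (- \<sigma> * norm y^2)) * cis (\<xi> \<bullet> y))"
    and "(\<integral>y. complex_of_real (exp (- \<sigma> * norm y^2)) * cis (\<xi> \<bullet> y) \<partial>lborel)
         = complex_of_real ((pi / \<sigma>) powr (DIM('a) / 2) * exp (- (norm \<xi>^2) / (4 * \<sigma>)))"
proof -
  let ?f = "\<lambda>b t. complex_of_real (exp (- \<sigma> * t^2)) * cis ((\<xi> \<bullet> b) * t)"
  have sq: "(\<Sum>b\<in>Basis. (y \<bullet> b)^2) = norm y^2" for y :: 'a
    by (simp add: power2_norm_eq_inner) (simp add: power2_eq_square euclidean_inner[of y y])
  have eq: "(\<lambda>y::'a. complex_of_real (exp (- \<sigma> * norm y^2)) * cis (\<xi> \<bullet> y)) =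
    (\<lambda>y. \<Prod>b\<in>Basis. ?f b (y \<bullet> b))"
  proof
    fix y :: 'a
    have "(\<Prod>b\<in>Basis. ?f b (y \<bullet> b)) = complex_of_real (\<Prod>b\<in>Basis. exp (- \<sigma> * (y \<bullet> b)^2)) * cis (\<Sum>b\<in>Basis. (\<xi> \<bullet> b) * (y \<bullet> b))"
      by (simp add: prod.distrib prod_cis)
    also have "(\<Prod>b\<in>Basis. exp (- \<sigma> * (y \<bullet> b)^2)) = exp (- \<sigma> * norm y^2)"
      by (simp add: exp_sum[symmetric] sum_negf sum_distrib_left[symmetric] sq)
    finally show "complex_of_real (exp (- \<sigma> * norm y^2)) * cis (\<xi> \<bullet> y) = (\<Prod>b\<in>Basis. ?f b (y \<bullet> b))"
      by (simp add: euclidean_inner[of \<xi> y])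
  qed
  have pw: "sqrt (pi / \<sigma>) ^ DIM('a) = (pi / \<sigma>) powr (DIM('a) / 2)"
    using assms by (simp add: powr_half_sqrt[symmetric] powr_realpow[symmetric] powr_powr)
  have "(\<Prod>b\<in>Basis. complex_of_real (sqrt (pi / \<sigma>) * exp (- ((\<xi> \<bullet> b)^2) / (4 * \<sigma>)))) =
    complex_of_real (sqrt (pi / \<sigma>) ^ DIM('a) * (\<Prod>b\<in>Basis. exp (- ((\<xi> \<bullet> b)^2) / (4 * \<sigma>))))"
    by (simp only: of_real_prod[symmetric] prod.distrib prod_constant)
  also have "(\<Prod>b\<in>Basis. exp (- ((\<xi> \<bullet> b)^2) / (4 * \<sigma>))) = exp (- (norm \<xi>^2) / (4 * \<sigma>))"
    by (simp add: exp_sum[symmetric] sum_negf sum_divide_distrib[symmetric] sq)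
  finally have val: "(\<Prod>b\<in>Basis. complex_of_real (sqrt (pi / \<sigma>) * exp (- ((\<xi> \<bullet> b)^2) / (4 * \<sigma>)))) =
    complex_of_real ((pi / \<sigma>) powr (DIM('a) / 2) * exp (- (norm \<xi>^2) / (4 * \<sigma>)))"
    unfolding pw .
  show "integrable lborel (\<lambda>y. complex_of_real (exp (- \<sigma> * norm y^2)) * cis (\<xi> \<bullet> y))"
    unfolding eq by (intro integral_lborel_prod gaussian_1d assms)
  show "(\<integral>y. complex_of_real (exp (- \<sigma> * norm y^2)) * cis (\<xi> \<bullet> y) \<partial>lborel)
         = complex_of_real ((pi / \<sigma>) powr (DIM('a) / 2) * exp (- (norm \<xi>^2) / (4 * \<sigma>)))"
    unfolding eq using integral_lborel_prod(2)[of ?f] gaussian_1d[OF assms] val by simp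
qed

lemma gaussian_integral:
  assumes "\<sigma> > 0"
  shows "integrable lborel (\<lambda>y::'a::euclidean_space. exp (- \<sigma> * norm y^2))"
    and "(\<integral>y. exp (- \<sigma> * norm y^2) \<partial>(lborel :: ('a) measure)) = (pi / \<sigma>) powr (DIM('a) / 2)"
proof -
  have i: "integrable lborel (\<lambda>y::'a. complex_of_real (exp (- \<sigma> * norm y^2)))"
    using gaussian_fourier(1)[OF assms, of 0] by simp
  show "integrable lborel (\<lambda>y::'a. exp (- \<sigma> * norm y^2))"
    using integrable_norm[OF i] by simp
  have "complex_of_real (\<integral>y. exp (- \<sigma> * norm y^2) \<partial>(lborel :: ('a) measure)) = complex_of_real ((pi / \<sigma>) powr (DIM('a) / 2))"
    using gaussian_fourier(2)[OF assms, of "0::'a"] by (simp flip: integral_complex_of_real)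
  thus "(\<integral>y. exp (- \<sigma> * norm y^2) \<partial>(lborel :: ('a) measure)) = (pi / \<sigma>) powr (DIM('a) / 2)"
    by (simp only: of_real_eq_iff)
qed

section \<open>Translation invariance and Fubini tools\<close>

lemma integral_lborel_translate:
  fixes f :: "'a::euclidean_space \<Rightarrow> 'b::{banach, second_countable_topology}"
  assumes [measurable]: "f \<in> borel_measurable borel"
  shows "(\<integral>x. f (c + x) \<partial>lborel) = integral\<^sup>L lborel f"
proof -
  have "integral\<^sup>L lborel f = integral\<^sup>L (distr lborel borel ((+) c)) f"
    by (simp add: lborel_distr_plus)
  also have "\<dots> = (\<integral>x. f (c + x) \<partial>lborel)"
    by (subst integral_distr) auto
  finally show ?thesis ..
qed

lemma nn_integral_lborel_translate:
  fixes f :: "'a::euclidean_space \<Rightarrow> ennreal"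
  assumes [measurable]: "f \<in> borel_measurable borel"
  shows "(\<integral>\<^sup>+x. f (c + x) \<partial>lborel) = integral\<^sup>N lborel f"
proof -
  have "integral\<^sup>N lborel f = integral\<^sup>N (distr lborel borel ((+) c)) f"
    by (simp add: lborel_distr_plus)
  also have "\<dots> = (\<integral>\<^sup>+x. f (c + x) \<partial>lborel)"
    by (subst nn_integral_distr) auto
  finally show ?thesis ..
qed

lemma borel_measurable_cnj [measurable (raw)]:
  "f \<in> borel_measurable M \<Longrightarrow> (\<lambda>x. cnj (f x)) \<in> borel_measurable M"
  by (rule borel_measurable_continuous_on[OF continuous_on_cnj[OF continuous_on_id]])

lemma measurable_lborel_pair: "measurable (lborel \<Otimes>\<^sub>M lborel) N = measurable (borel \<Otimes>\<^sub>M borel) N"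
  by (intro measurable_cong_sets sets_pair_measure_cong) auto

lemma integrable_pairI:
  fixes f :: "'a::euclidean_space \<Rightarrow> 'b::euclidean_space \<Rightarrow> 'c::{banach, second_countable_topology}"
  assumes m: "case_prod f \<in> borel_measurable (lborel \<Otimes>\<^sub>M lborel)"
    and fin: "(\<integral>\<^sup>+x. \<integral>\<^sup>+y. ennreal (norm (f x y)) \<partial>lborel \<partial>lborel) < \<infinity>"
  shows "integrable (lborel \<Otimes>\<^sub>M lborel) (case_prod f)"
proof (rule integrableI_bounded[OF m])
  have "(\<integral>\<^sup>+z. ennreal (norm (case_prod f z)) \<partial>(lborel \<Otimes>\<^sub>M lborel)) = (\<integral>\<^sup>+x. \<integral>\<^sup>+y. ennreal (norm (case_prod f (x, y))) \<partial>lborel \<partial>lborel)"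
    using m by (subst lborel.nn_integral_fst[symmetric]) auto
  thus "(\<integral>\<^sup>+z. ennreal (norm (case_prod f z)) \<partial>(lborel \<Otimes>\<^sub>M lborel)) < \<infinity>" using fin by simp
qed

lemma nn_integral_gaussian:
  assumes "\<sigma> > 0"
  shows "(\<integral>\<^sup>+y. ennreal (exp (- \<sigma> * norm y^2)) \<partial>(lborel :: ('a::euclidean_space) measure)) = ennreal ((pi / \<sigma>) powr (DIM('a) / 2))"
  using gaussian_integral[OF assms, where 'a='a] by (simp add: nn_integral_eq_integral)

text \<open>The square of the modulus is a double integral of \<open>cnj (g y) * g (y + x)\<close>.
  The quadratic phase of this product is linear in \<open>y\<close>, so the \<open>y\<close>
  integral is the Fourier integral of a real Gaussian and no Gaussian with complex parameter has to
  be evaluated. The linear phase \<open>w\<close> leaves only a factor of modulus one, which is why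
  the bound does not see it.\<close>

lemma oscillatory_gaussian_bound:
  fixes w :: "'a::euclidean_space"
  assumes e: "\<epsilon> > 0"
  shows "cmod (\<integral>x. complex_of_real (exp (- \<epsilon> * norm x^2)) * cis (\<kappa> * norm x^2 + w \<bullet> x) \<partial>lborel)
     \<le> (pi / sqrt (\<epsilon>^2 + \<kappa>^2)) powr (DIM('a) / 2)"
proof -
  define g where "g x = complex_of_real (exp (- \<epsilon> * norm x^2)) * cis (\<kappa> * norm x^2 + w \<bullet> x)" for x :: 'a
  define J where "J = integral\<^sup>L lborel g"
  have gm [measurable]: "g \<in> borel_measurable borel"
    unfolding g_def by (intro borel_measurable_continuous_onI continuous_intros)
  have ng: "cmod (g x) = exp (- \<epsilon> * norm x^2)" for x
    by (simp add: g_def norm_mult)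
  have gi: "integrable lborel g"
    using gaussian_integral(1)[OF e, where 'a='a]
    by (subst integrable_norm_iff[symmetric]) (auto simp: ng)
  let ?h = "\<lambda>y x. cnj (g y) * g (y + x)"
  have hm: "case_prod ?h \<in> borel_measurable (lborel \<Otimes>\<^sub>M lborel)" unfolding measurable_lborel_pair by measurable
  have hfin: "(\<integral>\<^sup>+y. \<integral>\<^sup>+x. ennreal (norm (?h y x)) \<partial>lborel \<partial>lborel) < \<infinity>"
  proof -
    have "(\<integral>\<^sup>+x. ennreal (norm (?h y x)) \<partial>lborel) = ennreal (exp (- \<epsilon> * norm y^2)) * ennreal ((pi / \<epsilon>) powr (DIM('a) / 2))" for y
    proof -
      have "(\<integral>\<^sup>+x. ennreal (norm (?h y x)) \<partial>lborel) = (\<integral>\<^sup>+x. ennreal (exp (- \<epsilon> * norm y^2)) * ennreal (cmod (g (y + x))) \<partial>lborel)"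
        by (simp add: norm_mult ng ennreal_mult)
      also have "\<dots> = ennreal (exp (- \<epsilon> * norm y^2)) * (\<integral>\<^sup>+x. ennreal (cmod (g (y + x))) \<partial>lborel)"
        by (subst nn_integral_cmult) auto
      also have "(\<integral>\<^sup>+x. ennreal (cmod (g (y + x))) \<partial>lborel) = (\<integral>\<^sup>+x. ennreal (cmod (g x)) \<partial>lborel)"
        by (rule nn_integral_lborel_translate) measurable
      finally show ?thesis using nn_integral_gaussian[OF e, where 'a='a] by (simp add: ng)
    qed
    thus ?thesis using nn_integral_gaussian[OF e, where 'a='a]
      by (simp add: nn_integral_multc ennreal_mult_less_top)
  qed
  have hi: "integrable (lborel \<Otimes>\<^sub>M lborel) (case_prod ?h)"
    by (rule integrable_pairI[OF hm hfin])
  have "complex_of_real ((cmod J)^2) = cnj J * J"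
    by (simp only: mult.commute[of "cnj J"] complex_norm_square)
  also have "\<dots> = (\<integral>y. cnj (g y) * J \<partial>lborel)"
    by (simp add: J_def Bochner_Integration.integral_cnj)
  also have "\<dots> = (\<integral>y. (\<integral>x. ?h y x \<partial>lborel) \<partial>lborel)"
    unfolding J_def by (intro Bochner_Integration.integral_cong refl) (simp add: integral_lborel_translate)
  also have "\<dots> = (\<integral>x. (\<integral>y. ?h y x \<partial>lborel) \<partial>lborel)"
    by (rule lborel_pair.Fubini_integral[OF hi, symmetric])
  finally have J2: "(cmod J)^2 = cmod (\<integral>x. (\<integral>y. ?h y x \<partial>lborel) \<partial>lborel)"
    by (metis norm_ge_zero norm_of_real abs_of_nonneg zero_le_power)
  define A where "A = (pi / (2 * \<epsilon>)) powr (DIM('a) / 2)"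
  \<comment> \<open>The sum of \<open>\<epsilon>/2\<close>, left over from completing the square,
    and \<open>\<kappa>^2/(2*\<epsilon>)\<close>, the decay of the transformed Gaussian at frequency
    \<open>2 * \<kappa> * x\<close>.\<close>
  define s where "s = (\<epsilon>^2 + \<kappa>^2) / (2 * \<epsilon>)"
  have s: "s > 0" using e by (simp add: s_def add_pos_nonneg)
  have inner: "cmod (\<integral>y. ?h y x \<partial>lborel) = A * exp (- s * norm x^2)" for x
  proof -
    define G where "G z = complex_of_real (exp (- (2 * \<epsilon>) * norm z^2)) * cis (((2 * \<kappa>) *\<^sub>R x) \<bullet> z)" for z :: 'a
    define k where "k = complex_of_real (exp (- \<epsilon> * norm x^2 / 2)) * cis (w \<bullet> x)"
    \<comment> \<open>Completing the square moves the centre of the Gaussian in \<open>y\<close> to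
      \<open>- x/2\<close>; the translation then disappears under the integral.\<close>
    have "?h y x = k * G ((1/2) *\<^sub>R x + y)" for y
    proof -
      have 1: "norm (y + x)^2 = norm y^2 + 2 * (x \<bullet> y) + norm x^2"
        by (simp add: power2_norm_eq_inner algebra_simps inner_commute)
      have 2: "norm ((1/2) *\<^sub>R x + y)^2 = norm x^2 / 4 + x \<bullet> y + norm y^2"
        by (simp add: power2_norm_eq_inner algebra_simps inner_commute)
      have 3: "((2 * \<kappa>) *\<^sub>R x) \<bullet> ((1/2) *\<^sub>R x + y) = \<kappa> * norm x^2 + 2 * \<kappa> * (x \<bullet> y)"
        by (simp add: power2_norm_eq_inner algebra_simps inner_commute)
      have "?h y x = complex_of_real (exp (- \<epsilon> * norm y^2) * exp (- \<epsilon> * norm (y + x)^2))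
          * (cis (- (\<kappa> * norm y^2 + w \<bullet> y)) * cis (\<kappa> * norm (y + x)^2 + w \<bullet> (y + x)))"
        by (simp add: g_def cis_cnj)
      also have "exp (- \<epsilon> * norm y^2) * exp (- \<epsilon> * norm (y + x)^2)
         = exp (- \<epsilon> * norm x^2 / 2) * exp (- (2 * \<epsilon>) * norm ((1/2) *\<^sub>R x + y)^2)"
        unfolding exp_add[symmetric] 1 2 by (simp add: algebra_simps)
      also have "cis (- (\<kappa> * norm y^2 + w \<bullet> y)) * cis (\<kappa> * norm (y + x)^2 + w \<bullet> (y + x))
         = cis (w \<bullet> x) * cis (((2 * \<kappa>) *\<^sub>R x) \<bullet> ((1/2) *\<^sub>R x + y))"
        unfolding cis_mult 1 3 by (simp add: algebra_simps)
      finally show ?thesis by (simp add: k_def G_def)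
    qed
    hence "(\<integral>y. ?h y x \<partial>lborel) = k * (\<integral>y. G ((1/2) *\<^sub>R x + y) \<partial>lborel)" by simp
    also have "(\<integral>y. G ((1/2) *\<^sub>R x + y) \<partial>lborel) = integral\<^sup>L lborel G"
      by (rule integral_lborel_translate)
         (auto simp: G_def intro!: borel_measurable_continuous_onI continuous_intros)
    also have "\<dots> = complex_of_real (A * exp (- (norm ((2 * \<kappa>) *\<^sub>R x)^2) / (4 * (2 * \<epsilon>))))"
      unfolding G_def A_def using e by (intro gaussian_fourier(2)) simp
    finally have "cmod (\<integral>y. ?h y x \<partial>lborel) = exp (- \<epsilon> * norm x^2 / 2) * (A * exp (- (norm ((2 * \<kappa>) *\<^sub>R x)^2) / (4 * (2 * \<epsilon>))))"
      by (simp add: norm_mult k_def A_def)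
    also have "\<dots> = A * exp (- \<epsilon> * norm x^2 / 2 - norm ((2 * \<kappa>) *\<^sub>R x)^2 / (4 * (2 * \<epsilon>)))"
      by (simp add: exp_add[symmetric])
    also have "- \<epsilon> * norm x^2 / 2 - norm ((2 * \<kappa>) *\<^sub>R x)^2 / (4 * (2 * \<epsilon>)) = - s * norm x^2"
      using e by (simp add: s_def power_mult_distrib divide_simps) (simp add: algebra_simps power2_eq_square)
    finally show ?thesis .
  qed
  have "(cmod J)^2 \<le> (\<integral>x. cmod (\<integral>y. ?h y x \<partial>lborel) \<partial>lborel)"
    unfolding J2 by (rule integral_norm_bound)
  also have "\<dots> = A * (pi / s) powr (DIM('a) / 2)"
    unfolding inner using gaussian_integral(2)[OF s, where 'a='a] by simp
  also have "\<dots> = ((pi / sqrt (\<epsilon>^2 + \<kappa>^2))^2) powr (DIM('a) / 2)"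
  proof -
    have "pi / (2 * \<epsilon>) * (pi / s) = (pi / sqrt (\<epsilon>^2 + \<kappa>^2))^2"
      using e by (simp add: s_def power_divide power2_eq_square add_nonneg_nonneg)
    thus ?thesis unfolding A_def using e s by (subst powr_mult[symmetric]) auto
  qed
  also have "\<dots> = ((pi / sqrt (\<epsilon>^2 + \<kappa>^2)) powr (DIM('a) / 2))^2"
    unfolding power2_eq_square[of "pi / _"] power2_eq_square[of "_ powr _"]
    by (rule powr_mult)
  finally show ?thesis
    unfolding J_def[symmetric] g_def[symmetric]
    using power2_le_imp_le by (metis J_def g_def powr_ge_zero)
qed

section \<open>The free Schroedinger propagator\<close>

lemma cmod_schr_kernel:
  "cmod (schr_kernel \<tau> (z :: real^'n)) = (4 * pi * \<bar>\<tau>\<bar>) powr (- real CARD('n) / 2)"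
  by (simp add: schr_kernel_def norm_mult)

lemma cnj_schr_kernel: "cnj (schr_kernel \<tau> z) = schr_kernel (- \<tau>) z"
  by (simp add: schr_kernel_def cis_cnj sgn_minus)

lemma schr_kernel_minus: "schr_kernel \<tau> (- z) = schr_kernel \<tau> z"
  by (simp add: schr_kernel_def)

lemma borel_measurable_cis [measurable (raw)]:
  "f \<in> borel_measurable M \<Longrightarrow> (\<lambda>x. cis (f x)) \<in> borel_measurable M"
  by (rule borel_measurable_continuous_on[OF continuous_on_cis[OF continuous_on_id]])

lemma borel_measurable_schr_kernel [measurable (raw)]:
  assumes [measurable]: "f \<in> borel_measurable M" "g \<in> borel_measurable M"
  shows "(\<lambda>x. schr_kernel (f x) (g x :: real^'n)) \<in> borel_measurable M"
  unfolding schr_kernel_def by measurable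

lemma integrable_tensor:
  fixes F :: "'a::euclidean_space \<Rightarrow> complex" and G :: "'b::euclidean_space \<Rightarrow> complex"
  assumes F: "integrable lborel F" and G: "integrable lborel G"
    and k: "case_prod k \<in> borel_measurable (lborel \<Otimes>\<^sub>M lborel)" "\<And>x z. cmod (k x z) \<le> A"
  shows "integrable (lborel \<Otimes>\<^sub>M lborel) (\<lambda>(x, z). k x z * (F x * G z))"
proof (rule integrable_pairI)
  have [measurable]: "F \<in> borel_measurable borel" "G \<in> borel_measurable borel"
    using F G by (auto dest: borel_measurable_integrable)
  note k(1)[measurable]
  show "(\<lambda>(x, z). k x z * (F x * G z)) \<in> borel_measurable (lborel \<Otimes>\<^sub>M lborel)"
    by measurable
  have A: "A \<ge> 0" using k(2) norm_ge_zero order_trans by blast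
  have "(\<integral>\<^sup>+x. \<integral>\<^sup>+z. ennreal (norm (k x z * (F x * G z))) \<partial>lborel \<partial>lborel)
    \<le> (\<integral>\<^sup>+x. \<integral>\<^sup>+z. ennreal A * ennreal (cmod (F x)) * ennreal (cmod (G z)) \<partial>lborel \<partial>lborel)"
    using k(2) A
    by (intro nn_integral_mono) (auto simp: norm_mult ennreal_mult[symmetric] mult.assoc intro!: ennreal_leI mult_right_mono)
  also have "\<dots> = ennreal A * (\<integral>\<^sup>+x. ennreal (cmod (F x)) \<partial>lborel) * (\<integral>\<^sup>+z. ennreal (cmod (G z)) \<partial>lborel)"
    by (simp add: nn_integral_cmult nn_integral_multc)
  also have "\<dots> < \<infinity>"
    using F G by (auto simp: integrable_iff_bounded ennreal_mult_less_top)
  finally show "(\<integral>\<^sup>+x. \<integral>\<^sup>+z. ennreal (norm (k x z * (F x * G z))) \<partial>lborel \<partial>lborel) < \<infinity>" .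
qed

lemma schr_eq: "\<tau> \<noteq> 0 \<Longrightarrow> schr \<tau> f x = (\<integral>y. schr_kernel \<tau> (x - y) * f y \<partial>lborel)"
  by (simp add: schr_def)

lemma integrable_kernel:
  fixes f :: "real^'n \<Rightarrow> complex"
  assumes "integrable lborel f"
  shows "integrable lborel (\<lambda>y. schr_kernel \<tau> (x - y) * f y)"
proof (rule Bochner_Integration.integrable_bound)
  have [measurable]: "f \<in> borel_measurable borel"
    using assms by (auto dest: borel_measurable_integrable)
  show "integrable lborel (\<lambda>y. (4 * pi * \<bar>\<tau>\<bar>) powr (- real CARD('n) / 2) * f y)"
    using assms by simp
  show "(\<lambda>y. schr_kernel \<tau> (x - y) * f y) \<in> borel_measurable lborel" by measurable
qed (auto simp: norm_mult cmod_schr_kernel)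

lemma cmod_schr_le:
  fixes f :: "real^'n \<Rightarrow> complex"
  assumes f: "integrable lborel f" and t: "\<tau> \<noteq> 0"
  shows "cmod (schr \<tau> f x) \<le> (4 * pi * \<bar>\<tau>\<bar>) powr (- real CARD('n) / 2) * (\<integral>y. cmod (f y) \<partial>lborel)"
proof -
  have "cmod (schr \<tau> f x) \<le> (\<integral>y. cmod (schr_kernel \<tau> (x - y) * f y) \<partial>lborel)"
    unfolding schr_eq[OF t] by (rule integral_norm_bound)
  thus ?thesis by (simp add: norm_mult cmod_schr_kernel)
qed

lemma schr_add:
  fixes f g :: "real^'n \<Rightarrow> complex"
  assumes "integrable lborel f" "integrable lborel g" 
  shows "schr \<tau> (\<lambda>x. f x + g x) x = schr \<tau> f x + schr \<tau> g x"
  using integrable_kernel[OF assms(1)] integrable_kernel[OF assms(2)]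
  by (simp add: schr_def algebra_simps)

lemma borel_measurable_schr [measurable]:
  fixes f :: "real^'n \<Rightarrow> complex"
  assumes [measurable]: "f \<in> borel_measurable borel"
  shows "schr \<tau> f \<in> borel_measurable borel"
proof -
  have [measurable]: "(\<lambda>x. \<integral>y. schr_kernel \<tau> (x - y) * f y \<partial>lborel) \<in> borel_measurable borel"
    by (rule lborel.borel_measurable_lebesgue_integral) measurable
  show ?thesis unfolding schr_def[abs_def] by measurable
qed

text \<open>For a nonzero time the kernel is bounded, so Fubini applies directly to integrable data;
  the conjugated kernel is the kernel of the opposite time.\<close>

lemma schr_adjoint:
  fixes F G :: "real^'n \<Rightarrow> complex"
  assumes F: "integrable lborel F" and G: "integrable lborel G" and b: "b \<noteq> 0"
  shows "(\<integral>x. F x * cnj (schr b G x) \<partial>lborel) = (\<integral>z. schr (- b) F z * cnj (G z) \<partial>lborel)"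
proof -
  have [measurable]: "F \<in> borel_measurable borel" "G \<in> borel_measurable borel"
    using F G by (auto dest: borel_measurable_integrable)
  have G': "integrable lborel (\<lambda>z. cnj (G z))" using G by simp
  let ?h = "\<lambda>x z. schr_kernel (- b) (z - x) * (F x * cnj (G z))"
  have hi: "integrable (lborel \<Otimes>\<^sub>M lborel) (case_prod ?h)"
    by (rule integrable_tensor[OF F G' _ eq_refl[OF cmod_schr_kernel]]) measurable
  have sw: "schr_kernel (- b) (z - x) = cnj (schr_kernel b (x - z))" for x z :: "real^'n"
    using schr_kernel_minus[of "- b" "x - z"] by (simp add: cnj_schr_kernel)
  have "(\<integral>x. F x * cnj (schr b G x) \<partial>lborel) = (\<integral>x. F x * (\<integral>z. cnj (schr_kernel b (x - z) * G z) \<partial>lborel) \<partial>lborel)"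
    unfolding schr_eq[OF b] Bochner_Integration.integral_cnj ..
  also have "\<dots> = (\<integral>x. (\<integral>z. ?h x z \<partial>lborel) \<partial>lborel)"
    by (subst integral_mult_right_zero[symmetric]) (simp add: sw mult_ac)
  also have "\<dots> = (\<integral>z. (\<integral>x. ?h x z \<partial>lborel) \<partial>lborel)"
    by (rule lborel_pair.Fubini_integral[OF hi, symmetric])
  also have "\<dots> = (\<integral>z. schr (- b) F z * cnj (G z) \<partial>lborel)"
  proof (intro Bochner_Integration.integral_cong refl)
    fix z
    have "schr (- b) F z * cnj (G z) = (\<integral>x. schr_kernel (- b) (z - x) * F x * cnj (G z) \<partial>lborel)"
      using b by (subst schr_eq) auto
    thus "(\<integral>x. ?h x z \<partial>lborel) = schr (- b) F z * cnj (G z)" by (simp add: mult.assoc)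
  qed
  finally show ?thesis .
qed

text \<open>The integral kernel of \<open>S(-b) exp(-\<epsilon>|x|^2) S(a)\<close>. Without the
  weight the integrand has constant modulus and the \<open>x\<close> integral diverges absolutely,
  so the kernels of the two propagators cannot be composed directly.\<close>

definition gauss_kernel :: "real \<Rightarrow> real \<Rightarrow> real \<Rightarrow> real^'n \<Rightarrow> real^'n \<Rightarrow> complex" where
  "gauss_kernel \<epsilon> a b z y =
    (\<integral>x. complex_of_real (exp (- \<epsilon> * norm x^2)) * (schr_kernel (- b) (z - x) * schr_kernel a (x - y)) \<partial>lborel)"

definition gauss_op :: "real \<Rightarrow> real \<Rightarrow> real \<Rightarrow> (real^'n \<Rightarrow> complex) \<Rightarrow> real^'n \<Rightarrow> complex" where
  "gauss_op \<epsilon> a b f = schr (- b) (\<lambda>x. complex_of_real (exp (- \<epsilon> * norm x^2)) * schr a f x)"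

lemma integrable_gaussian_complex:
  "\<epsilon> > 0 \<Longrightarrow> integrable lborel (\<lambda>x::'a::euclidean_space. complex_of_real (exp (- \<epsilon> * norm x^2)))"
  by (intro integrable_of_real gaussian_integral(1))

lemma integrable_gauss_schr:
  fixes f :: "real^'n \<Rightarrow> complex"
  assumes f: "integrable lborel f" and "a \<noteq> 0" "\<epsilon> > 0"
  shows "integrable lborel (\<lambda>x. complex_of_real (exp (- \<epsilon> * norm x^2)) * schr a f x)"
proof (rule Bochner_Integration.integrable_bound)
  let ?A = "(4 * pi * \<bar>a\<bar>) powr (- real CARD('n) / 2) * (\<integral>y. cmod (f y) \<partial>lborel)"
  have [measurable]: "f \<in> borel_measurable borel"
    using assms by (auto dest: borel_measurable_integrable)
  show "integrable lborel (\<lambda>x::real^'n. ?A * complex_of_real (exp (- \<epsilon> * norm x^2)))"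
    using assms by (intro integrable_mult_right integrable_gaussian_complex) auto
  show "(\<lambda>x. complex_of_real (exp (- \<epsilon> * norm x^2)) * schr a f x) \<in> borel_measurable lborel"
    by measurable
  have A: "0 \<le> ?A" by simp
  show "AE x in lborel. norm (complex_of_real (exp (- \<epsilon> * norm x^2)) * schr a f x)
    \<le> norm (?A * complex_of_real (exp (- \<epsilon> * norm x^2)))"
    using cmod_schr_le[OF f \<open>a \<noteq> 0\<close>] A
    by (intro AE_I2) (simp only: norm_mult norm_of_real abs_of_nonneg mult.commute[of ?A] mult_left_mono abs_ge_zero)
qed

lemma gauss_op_eq:
  fixes f :: "real^'n \<Rightarrow> complex"
  assumes f: "integrable lborel f" and a: "a \<noteq> 0" and b: "b \<noteq> 0" and e: "\<epsilon> > 0"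
  shows "gauss_op \<epsilon> a b f z = (\<integral>y. gauss_kernel \<epsilon> a b z y * f y \<partial>lborel)"
proof -
  let ?g = "\<lambda>x::real^'n. complex_of_real (exp (- \<epsilon> * norm x^2))"
  let ?h = "\<lambda>x y. (schr_kernel (- b) (z - x) * schr_kernel a (x - y)) * (?g x * f y)"
  have hi: "integrable (lborel \<Otimes>\<^sub>M lborel) (case_prod ?h)"
    by (rule integrable_tensor[OF integrable_gaussian_complex[OF e] f])
       (measurable, subst norm_mult, unfold cmod_schr_kernel, rule order_refl)
  have "gauss_op \<epsilon> a b f z = (\<integral>x. (\<integral>y. ?h x y \<partial>lborel) \<partial>lborel)"
    unfolding gauss_op_def using a b
    by (subst schr_eq, simp, intro Bochner_Integration.integral_cong refl, subst (1) schr_eq, simp)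
       (subst integral_mult_right_zero[symmetric], subst integral_mult_right_zero[symmetric], simp only: mult_ac)
  also have "\<dots> = (\<integral>y. (\<integral>x. ?h x y \<partial>lborel) \<partial>lborel)"
    by (rule lborel_pair.Fubini_integral[OF hi, symmetric])
  also have "\<dots> = (\<integral>y. gauss_kernel \<epsilon> a b z y * f y \<partial>lborel)"
    unfolding gauss_kernel_def
    by (intro Bochner_Integration.integral_cong refl, subst integral_mult_left_zero[symmetric])
       (simp add: mult_ac)
  finally show ?thesis .
qed

text \<open>After expansion of the squares, whatever does not depend on \<open>x\<close> is a phase
  times the two decay factors. The coefficient of the remaining quadratic phase vanishes exactly for
  \<open>a = b\<close>, hence the separate treatment of that case below.\<close>

lemma gauss_kernel_eq:
  fixes y z :: "real^'n"
  assumes "a \<noteq> 0" "b \<noteq> 0"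
  shows "cmod (gauss_kernel \<epsilon> a b z y) = (4 * pi * \<bar>a\<bar>) powr (- real CARD('n) / 2) * (4 * pi * \<bar>b\<bar>) powr (- real CARD('n) / 2)
    * cmod (\<integral>x. complex_of_real (exp (- \<epsilon> * norm x^2)) * cis ((1 / (4 * a) - 1 / (4 * b)) * norm x^2
         + ((1 / (2 * b)) *\<^sub>R z - (1 / (2 * a)) *\<^sub>R y) \<bullet> x) \<partial>lborel)"
proof -
  let ?c = "\<lambda>x::real^'n. complex_of_real (exp (- \<epsilon> * norm x^2)) * cis ((1 / (4 * a) - 1 / (4 * b)) * norm x^2
         + ((1 / (2 * b)) *\<^sub>R z - (1 / (2 * a)) *\<^sub>R y) \<bullet> x)"
  define k where "k = complex_of_real ((4 * pi * \<bar>a\<bar>) powr (- real CARD('n) / 2) * (4 * pi * \<bar>b\<bar>) powr (- real CARD('n) / 2))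
    * cis (- pi * real CARD('n) * sgn a / 4 + pi * real CARD('n) * sgn b / 4 + norm y^2 / (4 * a) - norm z^2 / (4 * b))"
  have nk: "cmod k = (4 * pi * \<bar>a\<bar>) powr (- real CARD('n) / 2) * (4 * pi * \<bar>b\<bar>) powr (- real CARD('n) / 2)"
    by (simp add: k_def norm_mult)
  have eq: "complex_of_real (exp (- \<epsilon> * norm x^2)) * (schr_kernel (- b) (z - x) * schr_kernel a (x - y)) = k * ?c x" for x
  proof -
    have n1: "norm (z - x)^2 = norm z^2 - 2 * (z \<bullet> x) + norm x^2"
      by (simp add: power2_norm_eq_inner algebra_simps inner_commute)
    have n2: "norm (x - y)^2 = norm x^2 - 2 * (y \<bullet> x) + norm y^2"
      by (simp add: power2_norm_eq_inner algebra_simps inner_commute)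
    have "schr_kernel (- b) (z - x) * schr_kernel a (x - y) =
      complex_of_real ((4 * pi * \<bar>a\<bar>) powr (- real CARD('n) / 2) * (4 * pi * \<bar>b\<bar>) powr (- real CARD('n) / 2)) *
      ((cis (- pi * real CARD('n) * sgn (- b) / 4) * cis (norm (z - x)^2 / (4 * (- b)))) *
       (cis (- pi * real CARD('n) * sgn a / 4) * cis (norm (x - y)^2 / (4 * a))))"
      by (simp add: schr_kernel_def mult_ac)
    also have "(cis (- pi * real CARD('n) * sgn (- b) / 4) * cis (norm (z - x)^2 / (4 * (- b)))) *
       (cis (- pi * real CARD('n) * sgn a / 4) * cis (norm (x - y)^2 / (4 * a)))
      = cis (- pi * real CARD('n) * sgn a / 4 + pi * real CARD('n) * sgn b / 4 + norm y^2 / (4 * a) - norm z^2 / (4 * b))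
       * cis ((1 / (4 * a) - 1 / (4 * b)) * norm x^2 + ((1 / (2 * b)) *\<^sub>R z - (1 / (2 * a)) *\<^sub>R y) \<bullet> x)"
      unfolding cis_mult n1 n2 using assms
      by (intro arg_cong[of _ _ cis]) (simp add: sgn_minus field_simps inner_diff_left)
    finally show ?thesis by (simp add: k_def mult_ac)
  qed
  show ?thesis unfolding gauss_kernel_def eq by (simp add: norm_mult nk)
qed

text \<open>The quadratic coefficient has modulus \<open>|a - b| / (4 |a| |b|)\<close>, and its
  denominator cancels the decay factors of the two single kernels. What remains is the decay
  expected of \<open>S(a - b)\<close>, uniformly in \<open>\<epsilon>\<close> because
  \<open>sqrt (\<epsilon>^2 + \<kappa>^2)\<close> is at least \<open>|\<kappa>|\<close>.\<close>

lemma gauss_kernel_bound_offdiag: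
  fixes y z :: "real^'n"
  assumes "a \<noteq> 0" "b \<noteq> 0" "a \<noteq> b" "\<epsilon> > 0"
  shows "cmod (gauss_kernel \<epsilon> a b z y) \<le> (4 * pi * \<bar>a - b\<bar>) powr (- real CARD('n) / 2)"
proof -
  define \<kappa> where "\<kappa> = 1 / (4 * a) - 1 / (4 * b)"
  have k: "\<bar>\<kappa>\<bar> = \<bar>a - b\<bar> / (4 * \<bar>a\<bar> * \<bar>b\<bar>)"
  proof -
    have "\<kappa> = (b - a) / (4 * a * b)" using assms by (simp add: \<kappa>_def field_simps)
    thus ?thesis by (simp add: abs_mult abs_divide abs_minus_commute)
  qed
  have k0: "\<bar>\<kappa>\<bar> > 0" using assms by (simp add: k)
  let ?d = "real CARD('n) / 2"
  have "cmod (gauss_kernel \<epsilon> a b z y) \<le> (4 * pi * \<bar>a\<bar>) powr (- ?d) * (4 * pi * \<bar>b\<bar>) powr (- ?d) *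
    (pi / sqrt (\<epsilon>^2 + \<kappa>^2)) powr ?d"
    unfolding gauss_kernel_eq[OF assms(1,2)] \<kappa>_def[symmetric] minus_divide_left[symmetric]
    using oscillatory_gaussian_bound[OF assms(4), of \<kappa> "(1 / (2 * b)) *\<^sub>R z - (1 / (2 * a)) *\<^sub>R y"]
    by (intro mult_left_mono) auto
  also have "(pi / sqrt (\<epsilon>^2 + \<kappa>^2)) powr ?d \<le> (pi / \<bar>\<kappa>\<bar>) powr ?d"
  proof (intro powr_mono2)
    have "\<bar>\<kappa>\<bar> \<le> sqrt (\<epsilon>^2 + \<kappa>^2)" by (rule real_le_rsqrt) simp
    thus "pi / sqrt (\<epsilon>^2 + \<kappa>^2) \<le> pi / \<bar>\<kappa>\<bar>"
      using k0 assms(4) by (intro divide_left_mono mult_pos_pos) (auto intro: add_pos_nonneg)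
  qed auto
  also have "(4 * pi * \<bar>a\<bar>) powr (- ?d) * (4 * pi * \<bar>b\<bar>) powr (- ?d) * (pi / \<bar>\<kappa>\<bar>) powr ?d = (4 * pi * \<bar>a - b\<bar>) powr (- ?d)"
  proof -
    have "(pi / \<bar>\<kappa>\<bar>) powr ?d = (\<bar>\<kappa>\<bar> / pi) powr (- ?d)"
      using k0 by (simp add: powr_minus powr_divide)
    hence "(4 * pi * \<bar>a\<bar>) powr (- ?d) * (4 * pi * \<bar>b\<bar>) powr (- ?d) * (pi / \<bar>\<kappa>\<bar>) powr ?d
      = ((4 * pi * \<bar>a\<bar>) * (4 * pi * \<bar>b\<bar>) * (\<bar>\<kappa>\<bar> / pi)) powr (- ?d)"
      by (simp only: powr_mult)
    also have "(4 * pi * \<bar>a\<bar>) * (4 * pi * \<bar>b\<bar>) * (\<bar>\<kappa>\<bar> / pi) = 4 * pi * \<bar>a - b\<bar>"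
      using assms unfolding k by (simp add: field_simps)
    finally show ?thesis .
  qed
  finally show ?thesis by (simp add: mult_left_mono)
qed

text \<open>For equal times the modulus is a Gaussian in \<open>z - y\<close> of total mass one: the
  prefactor is exactly its normalisation.\<close>

lemma gauss_kernel_diag:
  fixes y z :: "real^'n"
  assumes "a \<noteq> 0" "\<epsilon> > 0"
  shows "cmod (gauss_kernel \<epsilon> a a z y) =
    (1 / (16 * a^2 * \<epsilon> * pi)) powr (real CARD('n) / 2) * exp (- (1 / (16 * a^2 * \<epsilon>)) * norm (z - y)^2)"
proof -
  let ?d = "real CARD('n) / 2"
  let ?w = "(1 / (2 * a)) *\<^sub>R (z - y)"
  have "cmod (gauss_kernel \<epsilon> a a z y) = (4 * pi * \<bar>a\<bar>) powr (- ?d) * (4 * pi * \<bar>a\<bar>) powr (- ?d) *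
    cmod (\<integral>x. complex_of_real (exp (- \<epsilon> * norm x^2)) * cis (?w \<bullet> x) \<partial>lborel)"
    using gauss_kernel_eq[OF assms(1,1), of \<epsilon> z y] by (simp add: scaleR_diff_right)
  also have "cmod (\<integral>x. complex_of_real (exp (- \<epsilon> * norm x^2)) * cis (?w \<bullet> x) \<partial>lborel)
    = (pi / \<epsilon>) powr ?d * exp (- (norm ?w^2) / (4 * \<epsilon>))"
    unfolding gaussian_fourier(2)[OF assms(2)] by (simp add: norm_mult)
  also have "- (norm ?w^2) / (4 * \<epsilon>) = - (1 / (16 * a^2 * \<epsilon>)) * norm (z - y)^2"
    by (simp add: power_mult_distrib power_divide)
  also have "(4 * pi * \<bar>a\<bar>) powr (- ?d) * (4 * pi * \<bar>a\<bar>) powr (- ?d) * ((pi / \<epsilon>) powr ?d * exp (- (1 / (16 * a^2 * \<epsilon>)) * norm (z - y)^2))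
     = (1 / (4 * pi * \<bar>a\<bar>) * (1 / (4 * pi * \<bar>a\<bar>)) * (pi / \<epsilon>)) powr ?d * exp (- (1 / (16 * a^2 * \<epsilon>)) * norm (z - y)^2)"
    by (simp add: powr_mult powr_divide powr_minus_divide) (simp add: powr_mult[symmetric])
  also have "1 / (4 * pi * \<bar>a\<bar>) * (1 / (4 * pi * \<bar>a\<bar>)) * (pi / \<epsilon>) = 1 / (16 * a^2 * \<epsilon> * pi)"
    using assms by (simp add: field_simps power2_eq_square)
  finally show ?thesis by (simp add: mult_ac)
qed

lemma gauss_op_adjoint:
  fixes f g :: "real^'n \<Rightarrow> complex"
  assumes "integrable lborel f" "integrable lborel g" "a \<noteq> 0" "b \<noteq> 0" "\<epsilon> > 0"
  shows "(\<integral>x. complex_of_real (exp (- \<epsilon> * norm x^2)) * schr a f x * cnj (schr b g x) \<partial>lborel)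
    = (\<integral>z. gauss_op \<epsilon> a b f z * cnj (g z) \<partial>lborel)"
  unfolding gauss_op_def using assms by (intro schr_adjoint integrable_gauss_schr)

lemma cmod_gauss_op_le:
  fixes f :: "real^'n \<Rightarrow> complex"
  assumes f: "integrable lborel f" and "a \<noteq> 0" "b \<noteq> 0" "a \<noteq> b" "\<epsilon> > 0"
  shows "cmod (gauss_op \<epsilon> a b f z) \<le> (4 * pi * \<bar>a - b\<bar>) powr (- real CARD('n) / 2) * (\<integral>y. cmod (f y) \<partial>lborel)"
proof -
  have "cmod (gauss_op \<epsilon> a b f z) \<le> (\<integral>y. cmod (gauss_kernel \<epsilon> a b z y * f y) \<partial>lborel)"
    unfolding gauss_op_eq[OF f assms(2,3,5)] by (rule integral_norm_bound)
  also have "\<dots> \<le> (\<integral>y. (4 * pi * \<bar>a - b\<bar>) powr (- real CARD('n) / 2) * cmod (f y) \<partial>lborel)"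
    using f gauss_kernel_bound_offdiag[OF assms(2-5)]
    by (intro integral_mono') (auto simp: norm_mult intro!: mult_right_mono)
  finally show ?thesis by simp
qed

lemma borel_measurable_gauss_op [measurable]:
  assumes [measurable]: "f \<in> borel_measurable borel"
  shows "gauss_op \<epsilon> a b f \<in> borel_measurable borel"
  unfolding gauss_op_def by measurable

text \<open>Moving one propagator to the other side turns the weighted norm into the pairing of
  \<open>gauss_op \<epsilon> a a f\<close> with \<open>f\<close>. The modulus of its kernel has mass
  one in either variable, so the Schur test with
  \<open>2 |f y| |f z| \<le> |f y|^2 + |f z|^2\<close> closes the estimate with constant
  one.\<close>

lemma schr_L2_gauss:
  fixes f :: "real^'n \<Rightarrow> complex"
  assumes f: "integrable lborel f" and a: "a \<noteq> 0" and e: "\<epsilon> > 0"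
  shows "(\<integral>\<^sup>+x. ennreal (exp (- \<epsilon> * norm x^2) * (cmod (schr a f x))^2) \<partial>lborel) \<le> Lq_int 2 f"
proof -
  have fm [measurable]: "f \<in> borel_measurable borel"
    using f by (auto dest: borel_measurable_integrable)
  let ?d = "real CARD('n) / 2"
  define \<sigma> where "\<sigma> = 1 / (16 * a^2 * \<epsilon>)"
  have \<sigma>: "\<sigma> > 0" using a e by (simp add: \<sigma>_def)
  define k where "k u = (\<sigma> / pi) powr ?d * exp (- \<sigma> * norm u^2)" for u :: "real^'n"
  have km [measurable]: "k \<in> borel_measurable borel" unfolding k_def by measurable
  have k0: "k u \<ge> 0" for u by (simp add: k_def)
  have ksym: "k (u - v) = k (v - u)" for u v by (simp add: k_def norm_minus_commute)
  have kint: "(\<integral>\<^sup>+u. ennreal (k u) \<partial>lborel) = 1"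
  proof -
    have "(\<integral>\<^sup>+u. ennreal (k u) \<partial>lborel) = ennreal ((\<sigma> / pi) powr ?d) * ennreal ((pi / \<sigma>) powr ?d)"
      using nn_integral_gaussian[OF \<sigma>, where 'a="real^'n"]
      by (simp add: k_def ennreal_mult nn_integral_cmult)
    also have "\<dots> = 1"
      using \<sigma> by (simp add: ennreal_mult[symmetric] powr_mult[symmetric])
    finally show ?thesis .
  qed
  have kint': "(\<integral>\<^sup>+u. ennreal (k (u - v)) \<partial>lborel) = 1" for v
    using nn_integral_lborel_translate[of "\<lambda>u. ennreal (k u)" "- v"] kint by simp
  have gk: "cmod (gauss_kernel \<epsilon> a a z y) = k (z - y)" for y z :: "real^'n"
    unfolding gauss_kernel_diag[OF a e] k_def \<sigma>_def by (simp add: mult_ac)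
  let ?h = "\<lambda>x. complex_of_real (exp (- \<epsilon> * norm x^2)) * schr a f x"
  have hi: "integrable lborel (\<lambda>x. ?h x * cnj (schr a f x))"
  proof (rule Bochner_Integration.integrable_bound)
    let ?A = "(4 * pi * \<bar>a\<bar>) powr (- real CARD('n) / 2) * (\<integral>y. cmod (f y) \<partial>lborel)"
    show "integrable lborel (\<lambda>x. ?A * ?h x)"
      by (intro integrable_mult_right integrable_gauss_schr f a e)
    have A: "0 \<le> ?A" by simp
    show "AE x in lborel. norm (?h x * cnj (schr a f x)) \<le> norm (?A * ?h x)"
      using cmod_schr_le[OF f a] A
      by (intro AE_I2) (simp only: norm_mult norm_of_real complex_mod_cnj abs_of_nonneg mult.commute[of ?A] mult_left_mono abs_ge_zero mult_nonneg_nonneg norm_ge_zero)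
  qed measurable
  have sq: "?h x * cnj (schr a f x) = complex_of_real (exp (- \<epsilon> * norm x^2) * (cmod (schr a f x))^2)" for x
    by (simp only: of_real_mult complex_norm_square mult.assoc)
  have hr: "integrable lborel (\<lambda>x. exp (- \<epsilon> * norm x^2) * (cmod (schr a f x))^2)"
    using integrable_norm[OF hi] unfolding sq by (simp add: norm_mult norm_power)
  have "(\<integral>\<^sup>+x. ennreal (exp (- \<epsilon> * norm x^2) * (cmod (schr a f x))^2) \<partial>lborel)
    = ennreal (\<integral>x. exp (- \<epsilon> * norm x^2) * (cmod (schr a f x))^2 \<partial>lborel)"
    by (rule nn_integral_eq_integral[OF hr]) simp
  also have "(\<integral>x. exp (- \<epsilon> * norm x^2) * (cmod (schr a f x))^2 \<partial>lborel) = cmod (\<integral>x. ?h x * cnj (schr a f x) \<partial>lborel)"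
    unfolding sq by (subst integral_complex_of_real) (simp add: integral_nonneg_AE)
  also have "(\<integral>x. ?h x * cnj (schr a f x) \<partial>lborel) = (\<integral>z. gauss_op \<epsilon> a a f z * cnj (f z) \<partial>lborel)"
    by (rule gauss_op_adjoint[OF f f a a e])
  also have "ennreal (cmod (\<integral>z. gauss_op \<epsilon> a a f z * cnj (f z) \<partial>lborel))
     \<le> (\<integral>\<^sup>+z. ennreal (cmod (gauss_op \<epsilon> a a f z * cnj (f z))) \<partial>lborel)"
  proof (cases "integrable lborel (\<lambda>z. gauss_op \<epsilon> a a f z * cnj (f z))")
    case True thus ?thesis by (rule integral_norm_bound_ennreal)
  qed (simp add: not_integrable_integral_eq)
  also have "\<dots> \<le> (\<integral>\<^sup>+z. (\<integral>\<^sup>+y. ennreal (k (z - y)) * ennreal (cmod (f y) * cmod (f z)) \<partial>lborel) \<partial>lborel)"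
  proof (intro nn_integral_mono)
    fix z
    have "ennreal (cmod (gauss_op \<epsilon> a a f z)) \<le> (\<integral>\<^sup>+y. ennreal (k (z - y) * cmod (f y)) \<partial>lborel)"
    proof (cases "integrable lborel (\<lambda>y. gauss_kernel \<epsilon> a a z y * f y)")
      case True
      thus ?thesis using integral_norm_bound_ennreal[OF True]
        by (simp add: gauss_op_eq[OF f a a e] norm_mult gk)
    qed (simp add: gauss_op_eq[OF f a a e] not_integrable_integral_eq)
    hence "ennreal (cmod (gauss_op \<epsilon> a a f z * cnj (f z))) \<le> (\<integral>\<^sup>+y. ennreal (k (z - y) * cmod (f y)) \<partial>lborel) * ennreal (cmod (f z))"
      by (simp add: norm_mult ennreal_mult mult_right_mono)
    also have "\<dots> = (\<integral>\<^sup>+y. ennreal (k (z - y)) * ennreal (cmod (f y) * cmod (f z)) \<partial>lborel)"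
      by (subst nn_integral_multc[symmetric]) (auto simp: ennreal_mult k0 mult.assoc)
    finally show "ennreal (cmod (gauss_op \<epsilon> a a f z * cnj (f z))) \<le> \<dots>" .
  qed
  also have "\<dots> \<le> (\<integral>\<^sup>+z. (\<integral>\<^sup>+y. ennreal (k (z - y)) * ennreal ((cmod (f y))^2 / 2) + ennreal (k (z - y)) * ennreal ((cmod (f z))^2 / 2) \<partial>lborel) \<partial>lborel)"
  proof (intro nn_integral_mono)
    fix y z
    have "cmod (f y) * cmod (f z) \<le> (cmod (f y))^2 / 2 + (cmod (f z))^2 / 2"
      using sum_squares_bound[of "cmod (f y)" "cmod (f z)"] by simp
    hence "ennreal (cmod (f y) * cmod (f z)) \<le> ennreal ((cmod (f y))^2 / 2) + ennreal ((cmod (f z))^2 / 2)"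
      by (simp flip: ennreal_plus add: ennreal_leI)
    thus "ennreal (k (z - y)) * ennreal (cmod (f y) * cmod (f z)) \<le> ennreal (k (z - y)) * ennreal ((cmod (f y))^2 / 2) + ennreal (k (z - y)) * ennreal ((cmod (f z))^2 / 2)"
      by (metis distrib_left mult_left_mono zero_le)
  qed
  also have "\<dots> = (\<integral>\<^sup>+z. (\<integral>\<^sup>+y. ennreal (k (z - y)) * ennreal ((cmod (f y))^2 / 2) \<partial>lborel) \<partial>lborel)
      + (\<integral>\<^sup>+z. (\<integral>\<^sup>+y. ennreal (k (z - y)) * ennreal ((cmod (f z))^2 / 2) \<partial>lborel) \<partial>lborel)"
    by (subst nn_integral_add[symmetric]) (auto simp: nn_integral_add)
  also have "(\<integral>\<^sup>+z. (\<integral>\<^sup>+y. ennreal (k (z - y)) * ennreal ((cmod (f y))^2 / 2) \<partial>lborel) \<partial>lborel)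
     = (\<integral>\<^sup>+y. (\<integral>\<^sup>+z. ennreal (k (z - y)) * ennreal ((cmod (f y))^2 / 2) \<partial>lborel) \<partial>lborel)"
    by (rule lborel_pair.Fubini') measurable
  also have "\<dots> = (\<integral>\<^sup>+y. ennreal ((cmod (f y))^2 / 2) \<partial>lborel)"
    by (simp add: nn_integral_multc kint')
  also have "(\<integral>\<^sup>+z. (\<integral>\<^sup>+y. ennreal (k (z - y)) * ennreal ((cmod (f z))^2 / 2) \<partial>lborel) \<partial>lborel) = (\<integral>\<^sup>+z. ennreal ((cmod (f z))^2 / 2) \<partial>lborel)"
    by (subst ksym) (simp add: nn_integral_multc kint')
  also have "(\<integral>\<^sup>+y. ennreal ((cmod (f y))^2 / 2) \<partial>lborel) + (\<integral>\<^sup>+z. ennreal ((cmod (f z))^2 / 2) \<partial>lborel) = Lq_int 2 f"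
    unfolding Lq_int_def by (subst nn_integral_add[symmetric]) (auto simp flip: ennreal_plus)
  finally show ?thesis .
qed

lemma schr_L2:
  fixes f :: "real^'n \<Rightarrow> complex"
  assumes f: "integrable lborel f"
  shows "Lq_int 2 (schr \<tau> f) \<le> Lq_int 2 f"
proof (cases "\<tau> = 0")
  case True thus ?thesis by (simp add: Lq_int_def schr_def)
next
  case False
  have fm [measurable]: "f \<in> borel_measurable borel"
    using f by (auto dest: borel_measurable_integrable)
  \<comment> \<open>The weight tends to one along \<open>\<epsilon> = 1/(n + 1)\<close>, and Fatou's
    lemma removes it.\<close>
  let ?u = "\<lambda>n x. ennreal (exp (- (1 / real (Suc n)) * norm x^2) * (cmod (schr \<tau> f x))^2)"
  have lim: "(\<lambda>n. ?u n x) \<longlonglongrightarrow> ennreal ((cmod (schr \<tau> f x))^2)" for x :: "real^'n"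
  proof -
    have "(\<lambda>n. exp (- (1 / real (Suc n)) * norm x^2) * (cmod (schr \<tau> f x))^2) \<longlonglongrightarrow> exp (- 0 * norm x^2) * (cmod (schr \<tau> f x))^2"
      by (intro tendsto_intros LIMSEQ_Suc[OF lim_1_over_n])
    thus ?thesis by (intro tendsto_ennrealI) simp
  qed
  have "Lq_int 2 (schr \<tau> f) = (\<integral>\<^sup>+x. liminf (\<lambda>n. ?u n x) \<partial>lborel)"
    unfolding Lq_int_def using lim_imp_Liminf[OF _ lim] by (intro nn_integral_cong) auto
  also have "\<dots> \<le> liminf (\<lambda>n. (\<integral>\<^sup>+x. ?u n x \<partial>lborel))"
    by (rule nn_integral_liminf) measurable
  also have "\<dots> \<le> Lq_int 2 f"
    using schr_L2_gauss[OF f False, of "1 / real (Suc n)" for n]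
    by (intro Liminf_le) auto
  finally show ?thesis .
qed

section \<open>Interpolation and dispersive estimates\<close>

lemma powr_convex_comb:
  assumes q: "q \<ge> (1::real)" and "a > 0" "b > 0" "x \<ge> 0" "y \<ge> 0"
  shows "(x + y) powr q \<le> (a + b) powr q * (a / (a + b) * (x powr q / a powr q) + b / (a + b) * (y powr q / b powr q))"
proof -
  have ab: "a + b > 0" using assms by simp
  have edge: "y powr q \<le> (a + b) powr q * (b / (a + b) * (y powr q / b powr q))" if "a > 0" "b > 0" for a b y :: real
  proof -
    have "(a + b) powr q * (b / (a + b) * (y powr q / b powr q)) = y powr q * ((a + b) powr (q - 1) / b powr (q - 1))"
      using that by (simp add: powr_diff)
    moreover have "(a + b) powr (q - 1) / b powr (q - 1) \<ge> 1"
      using that q by (simp add: powr_mono2)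
    ultimately show ?thesis
      by (metis mult.right_neutral mult_left_mono powr_ge_zero)
  qed
  \<comment> \<open>The point \<open>(x + y)/(a + b)\<close> is a convex combination of
    \<open>x/a\<close> and \<open>y/b\<close>. Convexity of the power is applied to positive
    arguments, so the boundary cases are separated.\<close>
  consider "x = 0" | "y = 0" | "x > 0" "y > 0" using assms by linarith
  thus ?thesis
  proof cases
    case 1 thus ?thesis using edge[of a b y] assms by simp
  next
    case 2 thus ?thesis using edge[of b a x] assms by (simp add: add.commute)
  next
    case 3
    have "((1 - b / (a + b)) *\<^sub>R (x / a) + (b / (a + b)) *\<^sub>R (y / b)) powr q
       \<le> (1 - b / (a + b)) * ((x / a) powr q) + (b / (a + b)) * ((y / b) powr q)"
      using assms 3 by (intro convex_onD[OF powr_convex[OF q]]) (auto simp: field_simps)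
    also have "1 - b / (a + b) = a / (a + b)" using ab by (simp add: field_simps)
    also have "(a / (a + b)) *\<^sub>R (x / a) + (b / (a + b)) *\<^sub>R (y / b) = (x + y) / (a + b)"
      using assms ab by (simp add: add_divide_distrib)
    finally have "((x + y) / (a + b)) powr q \<le> a / (a + b) * (x / a) powr q + b / (a + b) * (y / b) powr q" .
    hence "(a + b) powr q * ((x + y) / (a + b)) powr q \<le> (a + b) powr q * (a / (a + b) * (x / a) powr q + b / (a + b) * (y / b) powr q)"
      by (intro mult_left_mono) auto
    thus ?thesis using assms ab by (simp add: powr_divide)
  qed
qed

lemma AE_zero_if_nn_integral_powr_0:
  fixes f :: "'a \<Rightarrow> real"
  assumes [measurable]: "f \<in> borel_measurable M" and "\<And>x. f x \<ge> 0"
    and "(\<integral>\<^sup>+x. ennreal (f x powr s) \<partial>M) \<le> ennreal (0 powr s)"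
  shows "AE x in M. f x = 0"
proof -
  have "(\<integral>\<^sup>+x. ennreal (f x powr s) \<partial>M) = 0" using assms(3) by simp
  hence "AE x in M. ennreal (f x powr s) = 0" by (subst (asm) nn_integral_0_iff_AE) auto
  thus ?thesis by eventually_elim (metis ennreal_eq_0_iff powr_gt_zero not_less)
qed

text \<open>Stated with upper bounds \<open>a\<close> and \<open>b\<close> in place of the norms, so
  that neither roots of extended reals nor finiteness conditions occur in applications. Young's
  inequality is applied to \<open>f/a\<close> and \<open>g/b\<close>; a vanishing bound forces the
  function to vanish almost everywhere.\<close>

lemma nn_Holder:
  fixes f g :: "'a \<Rightarrow> real"
  assumes [measurable]: "f \<in> borel_measurable M" "g \<in> borel_measurable M"
    and fg: "\<And>x. f x \<ge> 0" "\<And>x. g x \<ge> 0" and st: "s > 1" "t > 1" "1 / s + 1 / t = 1"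
    and ab: "a \<ge> 0" "b \<ge> 0"
    and fa: "(\<integral>\<^sup>+x. ennreal (f x powr s) \<partial>M) \<le> ennreal (a powr s)"
    and gb: "(\<integral>\<^sup>+x. ennreal (g x powr t) \<partial>M) \<le> ennreal (b powr t)"
  shows "(\<integral>\<^sup>+x. ennreal (f x * g x) \<partial>M) \<le> ennreal (a * b)"
proof (cases "a = 0 \<or> b = 0")
  case True
  have "AE x in M. f x * g x = 0"
  proof (cases "a = 0")
    case True
    thus ?thesis using AE_zero_if_nn_integral_powr_0[of f M s] fg fa by auto
  next
    case False
    hence "b = 0" using \<open>a = 0 \<or> b = 0\<close> by simp
    thus ?thesis using AE_zero_if_nn_integral_powr_0[of g M t] fg gb by auto
  qed
  hence "(\<integral>\<^sup>+x. ennreal (f x * g x) \<partial>M) = (\<integral>\<^sup>+x. 0 \<partial>M)"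
    by (intro nn_integral_cong_AE) auto
  thus ?thesis by simp
next
  case False
  hence a: "a > 0" and b: "b > 0" using ab by auto
  have "(\<integral>\<^sup>+x. ennreal (f x * g x) \<partial>M) \<le>
    (\<integral>\<^sup>+x. ennreal (a * b / (s * a powr s)) * ennreal (f x powr s) + ennreal (a * b / (t * b powr t)) * ennreal (g x powr t) \<partial>M)"
  proof (intro nn_integral_mono)
    fix x
    have "(f x / a) * (g x / b) \<le> (f x / a) powr s / s + (g x / b) powr t / t"
      using st fg a b by (intro Youngs_inequality) auto
    hence "(a * b) * ((f x / a) * (g x / b)) \<le> (a * b) * ((f x / a) powr s / s + (g x / b) powr t / t)"
      using a b by (intro mult_left_mono) auto
    hence "f x * g x \<le> a * b / (s * a powr s) * f x powr s + a * b / (t * b powr t) * g x powr t"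
      using a b by (simp add: powr_divide ring_distribs mult_ac)
    hence "ennreal (f x * g x) \<le> ennreal (a * b / (s * a powr s) * f x powr s + a * b / (t * b powr t) * g x powr t)"
      by (rule ennreal_leI)
    also have "\<dots> = ennreal (a * b / (s * a powr s)) * ennreal (f x powr s) + ennreal (a * b / (t * b powr t)) * ennreal (g x powr t)"
      using a b st fg by (subst ennreal_plus) (auto simp: ennreal_mult[symmetric])
    finally show "ennreal (f x * g x) \<le> \<dots>" .
  qed
  also have "\<dots> = ennreal (a * b / (s * a powr s)) * (\<integral>\<^sup>+x. ennreal (f x powr s) \<partial>M) + ennreal (a * b / (t * b powr t)) * (\<integral>\<^sup>+x. ennreal (g x powr t) \<partial>M)"
    by (simp add: nn_integral_add nn_integral_cmult)
  also have "\<dots> \<le> ennreal (a * b / (s * a powr s)) * ennreal (a powr s) + ennreal (a * b / (t * b powr t)) * ennreal (b powr t)"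
    by (intro add_mono mult_left_mono fa gb) auto
  also have "\<dots> = ennreal (a * b * (1 / s + 1 / t))"
    using a b st by (simp add: ennreal_mult[symmetric] ennreal_plus[symmetric] field_simps del: ennreal_plus)
  finally show ?thesis by (simp add: st)
qed

lemma nn_Minkowski:
  fixes f g :: "'a \<Rightarrow> real"
  assumes [measurable]: "f \<in> borel_measurable M" "g \<in> borel_measurable M"
    and fg: "\<And>x. f x \<ge> 0" "\<And>x. g x \<ge> 0" and q: "q \<ge> 1"
    and ab: "a \<ge> 0" "b \<ge> 0"
    and fa: "(\<integral>\<^sup>+x. ennreal (f x powr q) \<partial>M) \<le> ennreal (a powr q)"
    and gb: "(\<integral>\<^sup>+x. ennreal (g x powr q) \<partial>M) \<le> ennreal (b powr q)"
  shows "(\<integral>\<^sup>+x. ennreal ((f x + g x) powr q) \<partial>M) \<le> ennreal ((a + b) powr q)"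
proof -
  consider "a = 0" | "b = 0" | "a > 0" "b > 0" using ab by linarith
  thus ?thesis
  proof cases
    case 1
    hence "AE x in M. f x = 0" using AE_zero_if_nn_integral_powr_0[of f M q] fg fa by auto
    hence "(\<integral>\<^sup>+x. ennreal ((f x + g x) powr q) \<partial>M) = (\<integral>\<^sup>+x. ennreal (g x powr q) \<partial>M)"
      by (intro nn_integral_cong_AE) auto
    thus ?thesis using gb 1 by simp
  next
    case 2
    hence "AE x in M. g x = 0" using AE_zero_if_nn_integral_powr_0[of g M q] fg gb by auto
    hence "(\<integral>\<^sup>+x. ennreal ((f x + g x) powr q) \<partial>M) = (\<integral>\<^sup>+x. ennreal (f x powr q) \<partial>M)"
      by (intro nn_integral_cong_AE) auto
    thus ?thesis using fa 2 by simp
  next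
    case 3
    define A where "A = (a + b) powr q * (a / (a + b)) / a powr q"
    define B where "B = (a + b) powr q * (b / (a + b)) / b powr q"
    have AB: "A \<ge> 0" "B \<ge> 0" using 3 by (auto simp: A_def B_def)
    have "(\<integral>\<^sup>+x. ennreal ((f x + g x) powr q) \<partial>M) \<le> (\<integral>\<^sup>+x. ennreal A * ennreal (f x powr q) + ennreal B * ennreal (g x powr q) \<partial>M)"
    proof (intro nn_integral_mono)
      fix x
      have "(f x + g x) powr q \<le> A * f x powr q + B * g x powr q"
        using powr_convex_comb[OF q 3 fg(1)[of x] fg(2)[of x]] by (simp add: A_def B_def algebra_simps)
      hence "ennreal ((f x + g x) powr q) \<le> ennreal (A * f x powr q + B * g x powr q)"
        by (rule ennreal_leI)
      thus "ennreal ((f x + g x) powr q) \<le> ennreal A * ennreal (f x powr q) + ennreal B * ennreal (g x powr q)"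
        using AB by (simp add: ennreal_mult)
    qed
    also have "\<dots> = ennreal A * (\<integral>\<^sup>+x. ennreal (f x powr q) \<partial>M) + ennreal B * (\<integral>\<^sup>+x. ennreal (g x powr q) \<partial>M)"
      by (simp add: nn_integral_add nn_integral_cmult)
    also have "\<dots> \<le> ennreal A * ennreal (a powr q) + ennreal B * ennreal (b powr q)"
      by (intro add_mono mult_left_mono fa gb) auto
    also have "\<dots> = ennreal (A * a powr q + B * b powr q)"
      using AB by (simp add: ennreal_mult)
    also have "A * a powr q + B * b powr q = (a + b) powr q * (a / (a + b) + b / (a + b))"
      using 3 by (simp add: A_def B_def) (simp add: ring_distribs)
    also have "a / (a + b) + b / (a + b) = 1" using 3 by (simp flip: add_divide_distrib)
    finally show ?thesis by simp
  qed
qed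

text \<open>The class on which interpolation runs. It lies in every \<open>L^q\<close> and, unlike
  the test functions, is stable under restriction to measurable sets, which the splitting by levels
  requires.\<close>

definition bdd_supp :: "(real^'n \<Rightarrow> complex) \<Rightarrow> bool" where
  "bdd_supp f \<longleftrightarrow> f \<in> borel_measurable borel \<and> (\<exists>M. \<forall>x. cmod (f x) \<le> M \<and> (f x \<noteq> 0 \<longrightarrow> norm x \<le> M))"

lemma bdd_supp_measurable [measurable_dest]: "bdd_supp f \<Longrightarrow> f \<in> borel_measurable borel"
  by (simp add: bdd_supp_def)

lemma bdd_supp_dominated:
  assumes "bdd_supp f" "g \<in> borel_measurable borel" "\<And>x. cmod (g x) \<le> cmod (f x)"
  shows "bdd_supp g"
  using assms unfolding bdd_supp_def by (metis norm_le_zero_iff norm_zero order_trans)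

lemma bdd_supp_integrable_powr:
  fixes f :: "real^'n \<Rightarrow> complex"
  assumes f: "bdd_supp f" and q: "q > 0"
  shows "integrable lborel (\<lambda>x. cmod (f x) powr q)"
proof -
  obtain M where M: "\<And>x. cmod (f x) \<le> M" "\<And>x. f x \<noteq> 0 \<Longrightarrow> norm x \<le> M"
    using f by (auto simp: bdd_supp_def)
  have [measurable]: "f \<in> borel_measurable borel" using f by measurable
  show ?thesis
  proof (rule Bochner_Integration.integrable_bound)
    show "integrable lborel (\<lambda>x::real^'n. indicator (cball 0 M) x * (M powr q))"
      by (intro integrable_mult_left integrable_real_indicator) (use emeasure_lborel_cball_finite[of "0::real^'n" M] in auto)
    show "AE x in lborel. norm (cmod (f x) powr q) \<le> norm (indicator (cball 0 M) x * (M powr q))"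
    proof (intro AE_I2)
      fix x show "norm (cmod (f x) powr q) \<le> norm (indicator (cball 0 M) x * (M powr q))"
        using M[of x] q by (cases "f x = 0") (auto simp: indicator_def intro!: powr_mono2)
    qed
  qed measurable
qed

lemma bdd_supp_integrable: assumes "bdd_supp f" shows "integrable lborel f"
proof -
  have [measurable]: "f \<in> borel_measurable borel" using assms by measurable
  show ?thesis
    using bdd_supp_integrable_powr[OF assms, of 1] by (subst integrable_norm_iff[symmetric]) auto
qed

lemma Lq_int_bdd_supp:
  assumes "bdd_supp f" "q > 0"
  shows "Lq_int q f = ennreal (\<integral>x. cmod (f x) powr q \<partial>lborel)"
  unfolding Lq_int_def by (intro nn_integral_eq_integral bdd_supp_integrable_powr assms) auto

lemma nn_integral_powr_0:
  assumes "a > - 1" "c \<ge> (0::real)"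
  shows "(\<integral>\<^sup>+x. indicator {0..c} x * ennreal (x powr a) \<partial>lborel) = ennreal (c powr (a + 1) / (a + 1))"
proof -
  have "(\<integral>\<^sup>+x. ennreal (indicator {0..c} x * x powr a) \<partial>lborel) = ennreal (c powr (a + 1) / (a + 1))"
    using nn_integral_has_integral_lebesgue[OF _ has_integral_powr_from_0[OF assms]] by simp
  thus ?thesis by (simp add: ennreal_mult' ennreal_indicator)
qed

text \<open>At level \<open>l\<close> the function is split where \<open>l\<close> exceeds \<open>2 A E\<close> times the power \<open>1 - q\<close> of its
  modulus; the large part then contributes at most \<open>l / 2\<close> pointwise.\<close>

lemma marcinkiewicz_bound:
  fixes T :: "(real^'n \<Rightarrow> complex) \<Rightarrow> real^'n \<Rightarrow> complex"
  assumes Tm: "\<And>f. bdd_supp f \<Longrightarrow> T f \<in> borel_measurable borel"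
    and T1: "\<And>f x. bdd_supp f \<Longrightarrow> cmod (T f x) \<le> A * (\<integral>y. cmod (f y) \<partial>lborel)"
    and T2: "\<And>f. bdd_supp f \<Longrightarrow> Lq_int 2 (T f) \<le> Lq_int 2 f"
    and Tadd: "\<And>f g x. bdd_supp f \<Longrightarrow> bdd_supp g \<Longrightarrow> T (\<lambda>x. f x + g x) x = T f x + T g x"
    and A: "A \<ge> 0" and r: "r > 2" and f: "bdd_supp f"
  defines "q \<equiv> r / (r - 1)"
  defines "E \<equiv> \<integral>x. cmod (f x) powr q \<partial>lborel"
  shows "Lq_int r (T f) \<le> ennreal (4 * r / (r - 2) * (2 * A) powr (r - 2) * E powr (r - 1))"
\<comment> \<open>The splitting below divides by \<open>E\<close>.\<close>
proof (cases "E = 0")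
  case True
  have q: "q > 0" using r by (simp add: q_def)
  have "AE x in lborel. cmod (f x) powr q = 0"
    using True integral_nonneg_eq_0_iff_AE[OF bdd_supp_integrable_powr[OF f q]] by (auto simp: E_def)
  hence "AE x in lborel. cmod (f x) = 0" by eventually_elim simp
  hence "(\<integral>y. cmod (f y) \<partial>lborel) = (\<integral>y. 0 \<partial>(lborel :: (real^'n) measure))"
    using f by (intro integral_cong_AE) (auto simp: bdd_supp_def)
  hence "T f x = 0" for x using T1[OF f, of x] by simp
  thus ?thesis using r by (simp add: Lq_int_def)
next
  case False
  have q: "q > 0" using r by (simp add: q_def)
  have E: "E > 0" using False integral_nonneg_AE[of "\<lambda>x. cmod (f x) powr q" lborel] by (auto simp: E_def less_le)
  have fm [measurable]: "f \<in> borel_measurable borel" using f by measurable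
  have Tfm [measurable]: "T f \<in> borel_measurable borel" using Tm f by blast
  define \<mu> where "\<mu> x = 2 * A * E * cmod (f x) powr (1 - q)" for x
  have \<mu>m [measurable]: "\<mu> \<in> borel_measurable borel" unfolding \<mu>_def by measurable
  \<comment> \<open>The exponent \<open>1 - q\<close> is negative, so \<open>lo\<close> keeps the
    small values of \<open>f\<close>, estimated in \<open>L^2\<close>, and \<open>hi\<close> the
    large ones, estimated from \<open>L^1\<close> to \<open>L^\<infinity>\<close>.\<close>
  define lo where "lo l x = (if l \<le> \<mu> x then f x else 0)" for l x
  define hi where "hi l x = (if l \<le> \<mu> x then 0 else f x)" for l x
  have lo: "bdd_supp (lo l)" for l
    by (rule bdd_supp_dominated[OF f]) (auto simp: lo_def[abs_def])
  have hi: "bdd_supp (hi l)" for l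
    by (rule bdd_supp_dominated[OF f]) (auto simp: hi_def[abs_def])
  have hib: "cmod (T (hi l) x) \<le> l / 2" if l: "l > 0" for l x
  proof -
    \<comment> \<open>Where \<open>hi\<close> does not vanish, the threshold trades one power of
      \<open>|f|\<close> for its \<open>q\<close>-th power; the factor \<open>1/(2 * E)\<close> then
      makes the total exactly \<open>l / 2\<close>.\<close>
    have "A * cmod (hi l y) \<le> cmod (f y) powr q * (l / (2 * E))" for y
    proof (cases "f y = 0 \<or> l \<le> \<mu> y")
      case True thus ?thesis using l E by (auto simp: hi_def)
    next
      case False
      hence n: "cmod (f y) > 0" and "\<mu> y < l" by auto
      hence "A * cmod (f y) powr (1 - q) \<le> l / (2 * E)" using E by (simp add: \<mu>_def field_simps)
      hence "cmod (f y) powr q * (A * cmod (f y) powr (1 - q)) \<le> cmod (f y) powr q * (l / (2 * E))"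
        by (intro mult_left_mono) auto
      moreover have "cmod (f y) powr q * (A * cmod (f y) powr (1 - q)) = A * cmod (f y)"
        using n by (simp add: powr_add[symmetric] mult.left_commute)
      ultimately show ?thesis using False by (simp add: hi_def)
    qed
    hence "(\<integral>y. A * cmod (hi l y) \<partial>lborel) \<le> (\<integral>y. cmod (f y) powr q * (l / (2 * E)) \<partial>lborel)"
      using bdd_supp_integrable[OF hi[of l]] bdd_supp_integrable_powr[OF f q]
      by (intro integral_mono) auto
    also have "\<dots> = l / 2" using E by (simp add: E_def[symmetric])
    finally show ?thesis using T1[OF hi[of l], of x] by simp
  qed
  have split: "cmod (T (lo l) x) > l / 2" if "l > 0" "l < cmod (T f x)" for l x
  proof -
    have "f = (\<lambda>x. lo l x + hi l x)" by (auto simp: lo_def hi_def fun_eq_iff)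
    hence "T f x = T (lo l) x + T (hi l) x" using Tadd[OF lo[of l] hi[of l], of x] by simp
    thus ?thesis using norm_triangle_ineq[of "T (lo l) x" "T (hi l) x"] hib[OF that(1), of x] that(2) by simp
  qed
  \<comment> \<open>Chebyshev's inequality for \<open>T (lo l)\<close> at level
    \<open>l / 2\<close>, which is the origin of the factor 4.\<close>
  have cheb: "emeasure lborel {x. l < cmod (T f x)} \<le> ennreal (4 / l^2) * (\<integral>\<^sup>+x. indicator {x. l \<le> \<mu> x} x * ennreal ((cmod (f x))^2) \<partial>lborel)"
    if l: "l > 0" for l
  proof -
    have "emeasure lborel {x. l < cmod (T f x)} = (\<integral>\<^sup>+x. indicator {x. l < cmod (T f x)} x \<partial>lborel)"
      by (rule nn_integral_indicator[symmetric]) measurable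
    also have "\<dots> \<le> (\<integral>\<^sup>+x. ennreal (4 / l^2) * ennreal (cmod (T (lo l) x) powr 2) \<partial>lborel)"
    proof (intro nn_integral_mono)
      fix x
      show "indicator {x. l < cmod (T f x)} x \<le> ennreal (4 / l^2) * ennreal (cmod (T (lo l) x) powr 2)"
      proof (cases "l < cmod (T f x)")
        case True
        hence "(l / 2)^2 \<le> (cmod (T (lo l) x))^2" using split[OF l True] l by (intro power_mono) auto
        hence "1 \<le> 4 / l^2 * (cmod (T (lo l) x))^2" using l by (simp add: field_simps)
        hence "ennreal 1 \<le> ennreal (4 / l^2 * (cmod (T (lo l) x))^2)" by (intro ennreal_leI)
        thus ?thesis using l True by (simp add: ennreal_mult[symmetric])
      qed auto
    qed
    also have "\<dots> = ennreal (4 / l^2) * Lq_int 2 (T (lo l))"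
      unfolding Lq_int_def using Tm[OF lo[of l]] by (subst nn_integral_cmult) auto
    also have "\<dots> \<le> ennreal (4 / l^2) * Lq_int 2 (lo l)"
      by (intro mult_left_mono T2 lo) auto
    also have "Lq_int 2 (lo l) = (\<integral>\<^sup>+x. indicator {x. l \<le> \<mu> x} x * ennreal ((cmod (f x))^2) \<partial>lborel)"
      unfolding Lq_int_def by (intro nn_integral_cong) (auto simp: lo_def indicator_def)
    finally show ?thesis .
  qed
  \<comment> \<open>The layer cake formula: the norm is an integral of the distribution function
    over all levels, so that \<open>cheb\<close> can be inserted level by level.\<close>
  have "Lq_int r (T f) = (\<integral>\<^sup>+x. (\<integral>\<^sup>+l. indicator {0<..<cmod (T f x)} l * ennreal (r * l powr (r - 1)) \<partial>lborel) \<partial>lborel)"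
    unfolding Lq_int_def
  proof (intro nn_integral_cong)
    fix x
    have "(\<integral>\<^sup>+l. indicator {0<..<cmod (T f x)} l * ennreal (r * l powr (r - 1)) \<partial>lborel)
      = (\<integral>\<^sup>+l. ennreal r * (indicator {0..cmod (T f x)} l * ennreal (l powr (r - 1))) \<partial>lborel)"
      using AE_lborel_singleton[of "0::real"] AE_lborel_singleton[of "cmod (T f x)"]
      by (intro nn_integral_cong_AE, eventually_elim) (use r in \<open>auto simp: indicator_def ennreal_mult\<close>)
    also have "\<dots> = ennreal r * ennreal (cmod (T f x) powr (r - 1 + 1) / (r - 1 + 1))"
      using r by (subst nn_integral_cmult) (auto simp: nn_integral_powr_0)
    also have "\<dots> = ennreal (cmod (T f x) powr r)" using r by (simp add: ennreal_mult[symmetric])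
    finally show "ennreal (cmod (T f x) powr r) = (\<integral>\<^sup>+l. indicator {0<..<cmod (T f x)} l * ennreal (r * l powr (r - 1)) \<partial>lborel)" ..
  qed
  also have "\<dots> = (\<integral>\<^sup>+x. (\<integral>\<^sup>+l. indicator {0<..} l * ennreal (r * l powr (r - 1)) * indicator {x. l < cmod (T f x)} x \<partial>lborel) \<partial>lborel)"
    by (intro nn_integral_cong) (auto simp: indicator_def)
  also have "\<dots> = (\<integral>\<^sup>+l. (\<integral>\<^sup>+x. indicator {0<..} l * ennreal (r * l powr (r - 1)) * indicator {x. l < cmod (T f x)} x \<partial>lborel) \<partial>lborel)"
    by (rule lborel_pair.Fubini') measurable
  also have "\<dots> = (\<integral>\<^sup>+l. indicator {0<..} l * ennreal (r * l powr (r - 1)) * emeasure lborel {x. l < cmod (T f x)} \<partial>lborel)"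
    by (subst nn_integral_cmult) (auto intro!: nn_integral_cong)
  also have "\<dots> \<le> (\<integral>\<^sup>+l. (\<integral>\<^sup>+x. ennreal (4 * r * (cmod (f x))^2) * (indicator {0<..\<mu> x} l * ennreal (l powr (r - 3))) \<partial>lborel) \<partial>lborel)"
  proof (intro nn_integral_mono)
    fix l :: real
    show "indicator {0<..} l * ennreal (r * l powr (r - 1)) * emeasure lborel {x. l < cmod (T f x)}
      \<le> (\<integral>\<^sup>+x. ennreal (4 * r * (cmod (f x))^2) * (indicator {0<..\<mu> x} l * ennreal (l powr (r - 3))) \<partial>lborel)"
    proof (cases "l > 0")
      case True
      have "ennreal (r * l powr (r - 1)) * emeasure lborel {x. l < cmod (T f x)}
        \<le> ennreal (r * l powr (r - 1)) * (ennreal (4 / l^2) * (\<integral>\<^sup>+x. indicator {x. l \<le> \<mu> x} x * ennreal ((cmod (f x))^2) \<partial>lborel))"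
        using cheb[OF True] by (intro mult_left_mono) auto
      also have "\<dots> = (\<integral>\<^sup>+x. ennreal (r * l powr (r - 1) * (4 / l^2)) * (indicator {x. l \<le> \<mu> x} x * ennreal ((cmod (f x))^2)) \<partial>lborel)"
        using r by (subst nn_integral_cmult, simp, subst ennreal_mult) (auto simp: mult.assoc)
      also have "r * l powr (r - 1) * (4 / l^2) = 4 * r * l powr (r - 3)"
      proof -
        have "l powr (r - 1) = l powr (r - 3) * l^2"
          using True by (simp add: powr_add[symmetric] flip: powr_numeral)
        thus ?thesis using True by simp
      qed
      also have "(\<integral>\<^sup>+x. ennreal (4 * r * l powr (r - 3)) * (indicator {x. l \<le> \<mu> x} x * ennreal ((cmod (f x))^2)) \<partial>lborel)
        = (\<integral>\<^sup>+x. ennreal (4 * r * (cmod (f x))^2) * (indicator {0<..\<mu> x} l * ennreal (l powr (r - 3))) \<partial>lborel)"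
        using True r by (intro nn_integral_cong) (auto simp: indicator_def ennreal_mult[symmetric] mult_ac)
      finally show ?thesis using True by simp
    qed auto
  qed
  \<comment> \<open>With the order exchanged, the level runs only up to \<open>\<mu> x\<close>. The
    integral converges at 0 because \<open>r > 2\<close>.\<close>
  also have "\<dots> = (\<integral>\<^sup>+x. (\<integral>\<^sup>+l. ennreal (4 * r * (cmod (f x))^2) * (indicator {0<..\<mu> x} l * ennreal (l powr (r - 3))) \<partial>lborel) \<partial>lborel)"
    unfolding indicator_def greaterThanAtMost_iff by (rule lborel_pair.Fubini') measurable
  also have "\<dots> = (\<integral>\<^sup>+x. ennreal (4 * r * (cmod (f x))^2) * ennreal (\<mu> x powr (r - 2) / (r - 2)) \<partial>lborel)"
  proof (intro nn_integral_cong)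
    fix x
    have "(\<integral>\<^sup>+l. indicator {0<..\<mu> x} l * ennreal (l powr (r - 3)) \<partial>lborel) = (\<integral>\<^sup>+l. indicator {0..\<mu> x} l * ennreal (l powr (r - 3)) \<partial>lborel)"
      using AE_lborel_singleton[of "0::real"]
      by (intro nn_integral_cong_AE, eventually_elim) (auto simp: indicator_def)
    also have "\<dots> = ennreal (\<mu> x powr (r - 3 + 1) / (r - 3 + 1))"
      using r A E by (intro nn_integral_powr_0) (auto simp: \<mu>_def)
    also have "r - 3 + 1 = r - 2" by simp
    finally show "(\<integral>\<^sup>+l. ennreal (4 * r * (cmod (f x))^2) * (indicator {0<..\<mu> x} l * ennreal (l powr (r - 3))) \<partial>lborel)
       = ennreal (4 * r * (cmod (f x))^2) * ennreal (\<mu> x powr (r - 2) / (r - 2))"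
      by (subst nn_integral_cmult) auto
  qed
  also have "\<dots> = (\<integral>\<^sup>+x. ennreal (4 * r / (r - 2) * (2 * A) powr (r - 2) * E powr (r - 2)) * ennreal (cmod (f x) powr q) \<partial>lborel)"
  proof (intro nn_integral_cong)
    fix x
    have "(cmod (f x))^2 * cmod (f x) powr ((1 - q) * (r - 2)) = cmod (f x) powr q"
    proof (cases "f x = 0")
      case False
      have "2 + (1 - q) * (r - 2) = q" using r by (simp add: q_def field_simps)
      moreover have "(cmod (f x))^2 = cmod (f x) powr 2" by simp
      ultimately show ?thesis using False by (simp only: powr_add[symmetric])
    qed simp
    hence "4 * r * (cmod (f x))^2 * (\<mu> x powr (r - 2) / (r - 2)) = 4 * r / (r - 2) * (2 * A) powr (r - 2) * E powr (r - 2) * cmod (f x) powr q"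
      by (simp add: \<mu>_def powr_mult powr_powr mult_ac)
    thus "ennreal (4 * r * (cmod (f x))^2) * ennreal (\<mu> x powr (r - 2) / (r - 2)) =
      ennreal (4 * r / (r - 2) * (2 * A) powr (r - 2) * E powr (r - 2)) * ennreal (cmod (f x) powr q)"
      using r by (simp add: ennreal_mult[symmetric])
  qed
  also have "\<dots> = ennreal (4 * r / (r - 2) * (2 * A) powr (r - 2) * E powr (r - 2)) * ennreal E"
    using Lq_int_bdd_supp[OF f q] by (subst nn_integral_cmult) (auto simp: Lq_int_def E_def)
  also have "\<dots> = ennreal (4 * r / (r - 2) * (2 * A) powr (r - 2) * (E powr (r - 2) * E))"
    using E r by (simp add: ennreal_mult[symmetric] mult_ac)
  also have "E powr (r - 2) * E = E powr (r - 1)"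
    using E powr_add[of E "r - 2" 1] by simp
  finally show ?thesis .
qed

text \<open>The \<open>r\<close>-th root of the numerical factor in
  \<open>marcinkiewicz_bound\<close>, with the powers of \<open>A\<close> and \<open>E\<close> taken
  out.\<close>

definition disp_const :: "real \<Rightarrow> real" where
  "disp_const r = (4 * r / (r - 2)) powr (1 / r) * 2 powr ((r - 2) / r)"

lemma disp_const_pos: "r > 2 \<Longrightarrow> disp_const r > 0"
  by (simp add: disp_const_def)

lemma marcinkiewicz_norm:
  fixes T :: "(real^'n \<Rightarrow> complex) \<Rightarrow> real^'n \<Rightarrow> complex"
  assumes Tm: "\<And>f. bdd_supp f \<Longrightarrow> T f \<in> borel_measurable borel"
    and T1: "\<And>f x. bdd_supp f \<Longrightarrow> cmod (T f x) \<le> A * (\<integral>y. cmod (f y) \<partial>lborel)"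
    and T2: "\<And>f. bdd_supp f \<Longrightarrow> Lq_int 2 (T f) \<le> Lq_int 2 f"
    and Tadd: "\<And>f g x. bdd_supp f \<Longrightarrow> bdd_supp g \<Longrightarrow> T (\<lambda>x. f x + g x) x = T f x + T g x"
    and A: "A \<ge> 0" and r: "r > 2" and f: "bdd_supp f" and a: "a \<ge> 0"
    and fa: "Lq_int (r / (r - 1)) f \<le> ennreal (a powr (r / (r - 1)))"
  shows "Lq_int r (T f) \<le> ennreal ((disp_const r * A powr ((r - 2) / r) * a) powr r)"
proof -
  define q where "q = r / (r - 1)"
  have q: "q > 0" using r by (simp add: q_def)
  define E where "E = (\<integral>x. cmod (f x) powr q \<partial>lborel)"
  have E0: "E \<ge> 0" by (simp add: E_def)
  have "ennreal E \<le> ennreal (a powr q)"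
    using fa Lq_int_bdd_supp[OF f q] by (simp add: E_def q_def)
  hence "E \<le> a powr q" by simp
  hence "E powr (r - 1) \<le> (a powr q) powr (r - 1)" using E0 r by (intro powr_mono2) auto
  also have "\<dots> = a powr r" using r by (simp add: powr_powr q_def)
  finally have Er: "E powr (r - 1) \<le> a powr r" .
  have "Lq_int r (T f) \<le> ennreal (4 * r / (r - 2) * (2 * A) powr (r - 2) * E powr (r - 1))"
    unfolding E_def q_def by (rule marcinkiewicz_bound[OF Tm T1 T2 Tadd A r f])
  also have "\<dots> \<le> ennreal (4 * r / (r - 2) * (2 * A) powr (r - 2) * a powr r)"
    using Er r by (intro ennreal_leI mult_left_mono) auto
  also have "4 * r / (r - 2) * (2 * A) powr (r - 2) * a powr r = (disp_const r * A powr ((r - 2) / r) * a) powr r"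
  proof -
    have "(disp_const r * A powr ((r - 2) / r) * a) powr r
      = ((4 * r / (r - 2)) powr (1 / r)) powr r * (2 powr ((r - 2) / r)) powr r * (A powr ((r - 2) / r)) powr r * a powr r"
      by (simp only: disp_const_def powr_mult)
    also have "((4 * r / (r - 2)) powr (1 / r)) powr r = 4 * r / (r - 2)" using r by (simp add: powr_powr)
    also have "(2 powr ((r - 2) / r)) powr r = 2 powr (r - 2)" using r by (simp add: powr_powr)
    also have "(A powr ((r - 2) / r)) powr r = A powr (r - 2)" using r by (simp add: powr_powr)
    finally show ?thesis by (simp only: powr_mult mult.assoc)
  qed
  finally show ?thesis .
qed

text \<open>Interpolation raises the kernel bound to the power \<open>(r - 2)/r\<close>, which gives
  the rate that admissibility identifies with \<open>2/p\<close>. The factor \<open>4 * pi\<close>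
  only helps and is dropped. The disjunct \<open>d < 0\<close> plays the part of the assumption
  \<open>d \<ge> 0\<close>.\<close>

lemma kernel_decay_power:
  assumes "r > 2" "t \<noteq> 0"
  shows "((4 * pi * \<bar>t\<bar>) powr (- d / 2)) powr ((r - 2) / r) \<le> \<bar>t\<bar> powr (- (d / 2 - d / r)) \<or> d < 0"
proof (cases "d < 0")
  case False
  have e: "(- d / 2) * ((r - 2) / r) = - (d / 2 - d / r)" using assms by (simp add: field_simps)
  have g: "d / 2 - d / r \<ge> 0"
    using assms False mult_left_mono[of 2 r d] by (simp add: field_simps)
  have "((4 * pi * \<bar>t\<bar>) powr (- d / 2)) powr ((r - 2) / r) = (4 * pi * \<bar>t\<bar>) powr (- (d / 2 - d / r))"
    unfolding powr_powr e ..
  also have "\<dots> \<le> \<bar>t\<bar> powr (- (d / 2 - d / r))"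
  proof (rule powr_mono2')
    have "1 * \<bar>t\<bar> \<le> (4 * pi) * \<bar>t\<bar>" using pi_gt3 by (intro mult_right_mono) auto
    thus "\<bar>t\<bar> \<le> 4 * pi * \<bar>t\<bar>" by simp
  qed (use assms g in auto)
  finally show ?thesis ..
qed simp

lemma schr_dispersive:
  fixes f :: "real^'n \<Rightarrow> complex"
  assumes f: "bdd_supp f" and t: "\<tau> \<noteq> 0" and r: "r > 2" and a: "a \<ge> 0"
    and fa: "Lq_int (r / (r - 1)) f \<le> ennreal (a powr (r / (r - 1)))"
  shows "Lq_int r (schr \<tau> f) \<le> ennreal ((disp_const r * \<bar>\<tau>\<bar> powr (- (real CARD('n) / 2 - real CARD('n) / r)) * a) powr r)"
proof -
  let ?A = "(4 * pi * \<bar>\<tau>\<bar>) powr (- real CARD('n) / 2)"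
  have "Lq_int r (schr \<tau> f) \<le> ennreal ((disp_const r * ?A powr ((r - 2) / r) * a) powr r)"
    by (rule marcinkiewicz_norm[of "schr \<tau>", OF _ cmod_schr_le _ _ _ r f a fa])
       (auto intro!: t schr_L2 schr_add bdd_supp_integrable borel_measurable_schr bdd_supp_measurable)
  also have "\<dots> \<le> ennreal ((disp_const r * \<bar>\<tau>\<bar> powr (- (real CARD('n) / 2 - real CARD('n) / r)) * a) powr r)"
    using kernel_decay_power[OF r t, of "real CARD('n)"] disp_const_pos[OF r] a r
    by (intro ennreal_leI powr_mono2 mult_right_mono mult_left_mono) auto
  finally show ?thesis .
qed

lemma Lq_int_finite_2: 
  fixes f :: "real^'n \<Rightarrow> complex"
  assumes "bdd_supp f" shows "Lq_int 2 f < \<infinity>"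
  using Lq_int_bdd_supp[OF assms, of 2] by simp

lemma integrable_L2_mult:
  fixes f g :: "real^'n \<Rightarrow> complex"
  assumes [measurable]: "f \<in> borel_measurable borel" "g \<in> borel_measurable borel"
    and "Lq_int 2 f < \<infinity>" "Lq_int 2 g < \<infinity>"
  shows "integrable lborel (\<lambda>x. f x * cnj (g x))"
proof -
  have f: "integrable lborel (\<lambda>x. (cmod (f x))^2)" and g: "integrable lborel (\<lambda>x. (cmod (g x))^2)"
    using assms(3,4) by (auto simp: Lq_int_def intro!: integrableI_bounded)
  have "integrable lborel (\<lambda>x. (cmod (f x))^2 + (cmod (g x))^2)" using f g by simp
  thus ?thesis
  proof (rule Bochner_Integration.integrable_bound)
    show "AE x in lborel. norm (f x * cnj (g x)) \<le> norm ((cmod (f x))^2 + (cmod (g x))^2)"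
    proof (intro AE_I2)
      fix x
      have "2 * (cmod (f x) * cmod (g x)) \<le> (cmod (f x))^2 + (cmod (g x))^2"
        using sum_squares_bound[of "cmod (f x)" "cmod (g x)"] by simp
      moreover have "0 \<le> cmod (f x) * cmod (g x)" by simp
      ultimately show "norm (f x * cnj (g x)) \<le> norm ((cmod (f x))^2 + (cmod (g x))^2)"
        unfolding norm_mult complex_mod_cnj real_norm_def by linarith
    qed
  qed measurable
qed

text \<open>Interpolating \<open>gauss_op\<close> and pairing with \<open>g\<close> gives a bound
  free of \<open>\<epsilon>\<close>. The limit is justified by dominated convergence, since both
  propagated functions are in \<open>L^2\<close> and their product is integrable.\<close>

lemma schr_inner_bound:
  fixes f g :: "real^'n \<Rightarrow> complex"
  assumes f: "bdd_supp f" and g: "bdd_supp g" and ab: "a \<noteq> 0" "b \<noteq> 0" "a \<noteq> b" and r: "r > 2"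
    and \<alpha>: "\<alpha> \<ge> 0" "Lq_int (r / (r - 1)) f \<le> ennreal (\<alpha> powr (r / (r - 1)))"
    and \<beta>: "\<beta> \<ge> 0" "Lq_int (r / (r - 1)) g \<le> ennreal (\<beta> powr (r / (r - 1)))"
  shows "cmod (\<integral>x. schr a f x * cnj (schr b g x) \<partial>lborel)
    \<le> disp_const r * \<bar>a - b\<bar> powr (- (real CARD('n) / 2 - real CARD('n) / r)) * \<alpha> * \<beta>"
proof -
  have [measurable]: "f \<in> borel_measurable borel" "g \<in> borel_measurable borel" using f g by measurable
  note fi = bdd_supp_integrable[OF f] and gi = bdd_supp_integrable[OF g]
  let ?K = "disp_const r * \<bar>a - b\<bar> powr (- (real CARD('n) / 2 - real CARD('n) / r)) * \<alpha>"
  let ?A = "(4 * pi * \<bar>a - b\<bar>) powr (- real CARD('n) / 2)"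
  have K0: "?K \<ge> 0" using disp_const_pos[OF r] \<alpha> by simp
  have bd: "cmod (\<integral>x. complex_of_real (exp (- \<epsilon> * norm x^2)) * schr a f x * cnj (schr b g x) \<partial>lborel) \<le> ?K * \<beta>"
    if e: "\<epsilon> > 0" for \<epsilon>
  proof -
    have "Lq_int r (gauss_op \<epsilon> a b f) \<le> ennreal ((disp_const r * ?A powr ((r - 2) / r) * \<alpha>) powr r)"
    proof (rule marcinkiewicz_norm[of "gauss_op \<epsilon> a b", OF _ _ _ _ _ r f \<alpha>])
      fix h :: "real^'n \<Rightarrow> complex" assume h: "bdd_supp h"
      note hi = bdd_supp_integrable[OF h]
      have [measurable]: "h \<in> borel_measurable borel" using h by measurable
      show "gauss_op \<epsilon> a b h \<in> borel_measurable borel" by measurable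
      show "cmod (gauss_op \<epsilon> a b h x) \<le> ?A * (\<integral>y. cmod (h y) \<partial>lborel)" for x
        by (rule cmod_gauss_op_le[OF hi ab e])
      \<comment> \<open>A contraction, a multiplication by a weight of at most one, and another
        contraction.\<close>
      have "Lq_int 2 (gauss_op \<epsilon> a b h) \<le> Lq_int 2 (\<lambda>x. complex_of_real (exp (- \<epsilon> * norm x^2)) * schr a h x)"
        unfolding gauss_op_def by (intro schr_L2 integrable_gauss_schr hi ab e)
      also have "\<dots> \<le> Lq_int 2 (schr a h)"
        unfolding Lq_int_def
      proof (intro nn_integral_mono ennreal_leI powr_mono2)
        fix x :: "real^'n"
        have "exp (- \<epsilon> * norm x^2) \<le> 1" using e by simp
        thus "cmod (complex_of_real (exp (- \<epsilon> * norm x^2)) * schr a h x) \<le> cmod (schr a h x)"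
          by (simp add: norm_mult mult_left_le_one_le)
      qed auto
      also have "\<dots> \<le> Lq_int 2 h" by (rule schr_L2[OF hi])
      finally show "Lq_int 2 (gauss_op \<epsilon> a b h) \<le> Lq_int 2 h" .
    next
      fix h k :: "real^'n \<Rightarrow> complex" and x assume hk: "bdd_supp h" "bdd_supp k"
      note hi = bdd_supp_integrable[OF hk(1)] and ki = bdd_supp_integrable[OF hk(2)]
      show "gauss_op \<epsilon> a b (\<lambda>x. h x + k x) x = gauss_op \<epsilon> a b h x + gauss_op \<epsilon> a b k x"
        unfolding gauss_op_def schr_add[OF hi ki] distrib_left
        by (intro schr_add integrable_gauss_schr hi ki ab e)
    qed simp
    also have "\<dots> \<le> ennreal (?K powr r)"
      using kernel_decay_power[OF r, of "a - b" "real CARD('n)"] disp_const_pos[OF r] \<alpha>(1) r ab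
      by (intro ennreal_leI powr_mono2 mult_right_mono mult_left_mono) auto
    finally have T: "Lq_int r (gauss_op \<epsilon> a b f) \<le> ennreal (?K powr r)" .
    have "cmod (\<integral>x. complex_of_real (exp (- \<epsilon> * norm x^2)) * schr a f x * cnj (schr b g x) \<partial>lborel)
      = cmod (\<integral>z. gauss_op \<epsilon> a b f z * cnj (g z) \<partial>lborel)"
      by (subst gauss_op_adjoint[OF fi gi ab(1,2) e]) simp
    also have "ennreal \<dots> \<le> (\<integral>\<^sup>+z. ennreal (cmod (gauss_op \<epsilon> a b f z) * cmod (g z)) \<partial>lborel)"
    proof (cases "integrable lborel (\<lambda>z. gauss_op \<epsilon> a b f z * cnj (g z))")
      case True
      from integral_norm_bound_ennreal[OF True] show ?thesis by (simp add: norm_mult)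
    qed (simp add: not_integrable_integral_eq)
    also have "\<dots> \<le> ennreal (?K * \<beta>)"
      using T \<beta>(2) r unfolding Lq_int_def
      by (intro nn_Holder[where s = r and t = "r / (r - 1)"] K0 \<beta>(1)) (auto simp: field_simps)
    finally show ?thesis using K0 \<beta>(1) by (subst (asm) ennreal_le_iff) auto
  qed
  have "(\<lambda>n. \<integral>x. complex_of_real (exp (- (1 / real (Suc n)) * norm x^2)) * schr a f x * cnj (schr b g x) \<partial>lborel)
     \<longlonglongrightarrow> (\<integral>x. schr a f x * cnj (schr b g x) \<partial>lborel)"
  proof (rule integral_dominated_convergence)
    show "integrable lborel (\<lambda>x. cmod (schr a f x * cnj (schr b g x)))"
      using schr_L2[OF fi, of a] schr_L2[OF gi, of b] Lq_int_finite_2[OF f] Lq_int_finite_2[OF g]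
      by (intro integrable_norm integrable_L2_mult) auto
    show "AE x in lborel. (\<lambda>n. complex_of_real (exp (- (1 / real (Suc n)) * norm x^2)) * schr a f x * cnj (schr b g x))
        \<longlonglongrightarrow> schr a f x * cnj (schr b g x)"
    proof (intro AE_I2)
      fix x :: "real^'n"
      have "(\<lambda>n. complex_of_real (exp (- (1 / real (Suc n)) * norm x^2)) * schr a f x * cnj (schr b g x))
        \<longlonglongrightarrow> complex_of_real (exp (- 0 * norm x^2)) * schr a f x * cnj (schr b g x)"
        by (intro tendsto_intros LIMSEQ_Suc[OF lim_1_over_n])
      thus "(\<lambda>n. complex_of_real (exp (- (1 / real (Suc n)) * norm x^2)) * schr a f x * cnj (schr b g x))
        \<longlonglongrightarrow> schr a f x * cnj (schr b g x)" by simp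
    qed
    show "AE x in lborel. norm (complex_of_real (exp (- (1 / real (Suc n)) * norm x^2)) * schr a f x * cnj (schr b g x))
        \<le> cmod (schr a f x * cnj (schr b g x))" for n
      by (intro AE_I2) (auto simp: norm_mult intro!: mult_right_mono mult_left_le_one_le)
  qed measurable
  moreover have "cmod (\<integral>x. complex_of_real (exp (- (1 / real (Suc n)) * norm x^2)) * schr a f x * cnj (schr b g x) \<partial>lborel) \<le> ?K * \<beta>" for n
    by (rule bd) simp
  ultimately show ?thesis by (intro Lim_bounded[OF tendsto_norm]) auto
qed

section \<open>Test functions and duality\<close>

text \<open>For \<open>k = 0\<close> the standard flat function. The negative powers are included so
  that differentiation stays within polynomial multiples of the family, which turns smoothness into
  an algebraic closure property.\<close>

definition bump_profile :: "nat \<Rightarrow> real \<Rightarrow> real" where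
  "bump_profile k y = (if y > 0 then exp (- 1 / y) / y ^ k else 0)"

lemma bump_profile_shift: "bump_profile k y = y^2 * bump_profile (k + 2) y"
  by (auto simp: bump_profile_def power_add power2_eq_square)

lemma bump_profile_deriv:
  "(bump_profile k has_real_derivative (1 - real k * y) * bump_profile (k + 2) y) (at y)"
proof -
  consider "y > 0" | "y < 0" | "y = 0" by linarith
  thus ?thesis
  proof cases
    case 1
    have "((\<lambda>y. exp (- 1 / y) / y ^ k) has_real_derivative (1 - real k * y) * bump_profile (k + 2) y) (at y)"
    proof -
      have "((\<lambda>y. exp (- 1 / y) / y ^ k) has_real_derivative
        (exp (- 1 / y) * (1 / y^2) * y ^ k - exp (- 1 / y) * (real k * y ^ (k - 1))) / (y ^ k * y ^ k)) (at y)"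
        using 1 by (auto intro!: derivative_eq_intros simp: power2_eq_square)
      moreover have "(exp (- 1 / y) * (1 / y^2) * y ^ k - exp (- 1 / y) * (real k * y ^ (k - 1))) / (y ^ k * y ^ k)
         = (1 - real k * y) * bump_profile (k + 2) y"
        using 1 by (cases k) (auto simp: bump_profile_def field_simps power2_eq_square)
      ultimately show ?thesis by simp
    qed
    moreover have "\<forall>\<^sub>F z in nhds y. bump_profile k z = exp (- 1 / z) / z ^ k"
      using 1 eventually_nhds_in_open[of "{0<..}" y]
      by (auto simp: bump_profile_def elim!: eventually_mono)
    ultimately show ?thesis by (subst DERIV_cong_ev) auto
  next
    case 2
    have "\<forall>\<^sub>F z in nhds y. bump_profile k z = 0"
      using 2 eventually_nhds_in_open[of "{..<0}" y]
      by (auto simp: bump_profile_def elim!: eventually_mono)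
    hence "(bump_profile k has_real_derivative 0) (at y) \<longleftrightarrow> ((\<lambda>_. 0) has_real_derivative 0) (at y)"
      by (intro DERIV_cong_ev) auto
    thus ?thesis using 2 by (simp add: bump_profile_def)
  next
    case 3
    \<comment> \<open>At 0 the difference quotient is \<open>bump_profile k z / z\<close>; from the
      right, \<open>x = 1/z\<close> turns it into \<open>x ^ (k + 1) / exp x\<close>, and from the
      left it is 0.\<close>
    have "((\<lambda>z. bump_profile k z / z) \<longlongrightarrow> 0) (at_right 0)"
    proof -
      have "((\<lambda>x::real. x ^ (k + 1) / exp x) \<longlongrightarrow> 0) at_top" by (rule tendsto_power_div_exp_0)
      hence "((\<lambda>z::real. inverse z ^ (k + 1) / exp (inverse z)) \<longlongrightarrow> 0) (at_right 0)"
        by (rule filterlim_compose[OF _ filterlim_inverse_at_top_right])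
      moreover have "\<forall>\<^sub>F z::real in at_right 0. inverse z ^ (k + 1) / exp (inverse z) = bump_profile k z / z"
        using eventually_at_right_less[of "0::real"]
        by eventually_elim (simp add: bump_profile_def field_simps exp_minus)
      ultimately show ?thesis by (rule Lim_transform_eventually)
    qed
    moreover have "((\<lambda>z. bump_profile k z / z) \<longlongrightarrow> 0) (at_left 0)"
    proof (rule tendsto_eventually)
      show "\<forall>\<^sub>F z in at_left 0. bump_profile k z / z = 0"
        using eventually_at_left_real[of "-1" 0] by (auto elim!: eventually_mono simp: bump_profile_def)
    qed
    ultimately have "((\<lambda>z. bump_profile k z / z) \<longlongrightarrow> 0) (at 0)"
      by (simp add: filterlim_split_at)
    thus ?thesis using 3 by (simp add: has_field_derivative_iff bump_profile_def)
  qed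
qed

lemma real_polynomial_derivative:
  fixes p :: "'a::euclidean_space \<Rightarrow> real"
  assumes "real_polynomial_function p"
  shows "\<exists>D. (\<forall>x. (p has_derivative D x) (at x)) \<and> (\<forall>v. real_polynomial_function (\<lambda>x. D x v))"
  using assms
proof (induction rule: real_polynomial_function.induct)
  case (linear f)
  thus ?case
    by (intro exI[of _ "\<lambda>_. f"]) (auto intro: bounded_linear_imp_has_derivative real_polynomial_function.intros(2))
next
  case (const c)
  show ?case by (intro exI[of _ "\<lambda>_ _. 0"]) (auto intro: real_polynomial_function.intros(2))
next
  case (add f g)
  then obtain D E where "\<forall>x. (f has_derivative D x) (at x)" "\<forall>v. real_polynomial_function (\<lambda>x. D x v)"
    "\<forall>x. (g has_derivative E x) (at x)" "\<forall>v. real_polynomial_function (\<lambda>x. E x v)" by blast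
  thus ?case
    by (intro exI[of _ "\<lambda>x v. D x v + E x v"]) (auto intro: has_derivative_add)
next
  case (mult f g)
  then obtain D E where "\<forall>x. (f has_derivative D x) (at x)" "\<forall>v. real_polynomial_function (\<lambda>x. D x v)"
    "\<forall>x. (g has_derivative E x) (at x)" "\<forall>v. real_polynomial_function (\<lambda>x. E x v)" by blast
  thus ?case using mult.hyps
    by (intro exI[of _ "\<lambda>x v. f x * E x v + D x v * g x"]) (auto intro!: has_derivative_mult real_polynomial_function.intros(3,4))
qed

lemma real_polynomial_norm_square: "real_polynomial_function (\<lambda>x::'a::euclidean_space. x \<bullet> x)"
proof -
  have "(\<lambda>x::'a. x \<bullet> x) = (\<lambda>x. \<Sum>b\<in>Basis. (x \<bullet> b) * (x \<bullet> b))"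
    by (rule ext) (rule euclidean_inner)
  moreover have "real_polynomial_function (\<lambda>x::'a. \<Sum>b\<in>Basis. (x \<bullet> b) * (x \<bullet> b))"
    by (intro real_polynomial_function_sum real_polynomial_function.intros(4) real_polynomial_function.intros(1)
        bounded_linear_inner_left finite_Basis)
  ultimately show ?thesis by simp
qed

text \<open>Smooth functions vanishing outside the ball of radius \<open>N\<close>, in a form that
  directional derivatives preserve up to a shift of \<open>k\<close> by 2 and a new
  polynomial.\<close>

definition bump_poly :: "real \<Rightarrow> nat \<Rightarrow> ('a::euclidean_space \<Rightarrow> real) \<Rightarrow> 'a \<Rightarrow> real" where
  "bump_poly N k p x = p x * bump_profile k (N^2 - x \<bullet> x)"

lemma bump_poly_derivative:
  fixes p :: "'a::euclidean_space \<Rightarrow> real"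
  assumes "real_polynomial_function p"
  obtains D where "\<And>x. (bump_poly N k p has_derivative D x) (at x)"
    "\<And>v. \<exists>p'. real_polynomial_function p' \<and> (\<lambda>x. D x v) = bump_poly N (k + 2) p'"
proof -
  obtain D where D: "\<And>x. (p has_derivative D x) (at x)" "\<And>v. real_polynomial_function (\<lambda>x. D x v)"
    using real_polynomial_derivative[OF assms] by blast
  let ?s = "\<lambda>x::'a. N^2 - x \<bullet> x"
  let ?D = "\<lambda>x v. p x * (((1 - real k * ?s x) * bump_profile (k + 2) (?s x)) * (- (2 * (x \<bullet> v)))) + D x v * bump_profile k (?s x)"
  have s: "(?s has_derivative (\<lambda>v. - (2 * (x \<bullet> v)))) (at x)" for x
    by (auto intro!: derivative_eq_intros simp: inner_commute)
  have "((\<lambda>x. bump_profile k (?s x)) has_derivative (\<lambda>v. ((1 - real k * ?s x) * bump_profile (k + 2) (?s x)) * (- (2 * (x \<bullet> v))))) (at x)" for x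
    using has_derivative_compose[OF s bump_profile_deriv[unfolded has_field_derivative_def]] .
  hence 1: "(bump_poly N k p has_derivative ?D x) (at x)" for x
    unfolding bump_poly_def[abs_def] by (intro has_derivative_mult D)
  have 2: "\<exists>p'. real_polynomial_function p' \<and> (\<lambda>x. ?D x v) = bump_poly N (k + 2) p'" for v
  proof (intro exI conjI)
    let ?p = "\<lambda>x. p x * ((1 - real k * ?s x) * (- (2 * (x \<bullet> v)))) + D x v * (?s x)^2"
    show "(\<lambda>x. ?D x v) = bump_poly N (k + 2) ?p"
      unfolding bump_poly_def by (subst bump_profile_shift) (simp add: algebra_simps)
    have "real_polynomial_function (\<lambda>x::'a. x \<bullet> v)"
      by (intro real_polynomial_function.intros(1) bounded_linear_inner_left)
    thus "real_polynomial_function ?p"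
      by (intro real_polynomial_function.intros(3) real_polynomial_function.intros(4) real_polynomial_function_diff
          real_polynomial_function_power real_polynomial_function.intros(2) real_polynomial_function_minus
          real_polynomial_norm_square assms D)
  qed
  show ?thesis by (rule that[OF 1 2])
qed

lemma smooth_bump_poly:
  fixes p q :: "'a::euclidean_space \<Rightarrow> real"
  assumes "real_polynomial_function p" "real_polynomial_function q"
  shows "smooth_fun (\<lambda>x. Complex (bump_poly N k p x) (bump_poly N k q x))"
proof -
  \<comment> \<open>The index \<open>k\<close> is quantified inside \<open>C\<close> because every
    derivative raises it. Invariance under \<open>dir_deriv\<close> and differentiability of all
    members then give smoothness by induction on the list of directions.\<close>
  define C where "C = {F :: 'a \<Rightarrow> complex. \<exists>k p q. real_polynomial_function p \<and> real_polynomial_function q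
     \<and> F = (\<lambda>x. Complex (bump_poly N k p x) (bump_poly N k q x))}"
  have der: "(\<forall>x. F differentiable (at x)) \<and> (\<forall>v. dir_deriv v F \<in> C)" if FC: "F \<in> C" for F
  proof -
    obtain k p q where F: "F = (\<lambda>x. Complex (bump_poly N k p x) (bump_poly N k q x))"
      and p: "real_polynomial_function p" and q: "real_polynomial_function q"
      using FC unfolding C_def by auto
    obtain D where D: "\<And>x. (bump_poly N k p has_derivative D x) (at x)"
      "\<And>v. \<exists>p'. real_polynomial_function p' \<and> (\<lambda>x. D x v) = bump_poly N (k + 2) p'"
      using bump_poly_derivative[OF p] by metis
    obtain E where E: "\<And>x. (bump_poly N k q has_derivative E x) (at x)"
      "\<And>v. \<exists>p'. real_polynomial_function p' \<and> (\<lambda>x. E x v) = bump_poly N (k + 2) p'"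
      using bump_poly_derivative[OF q] by metis
    have FD: "(F has_derivative (\<lambda>v. Complex (D x v) (E x v))) (at x)" for x
      unfolding F Complex_eq by (intro derivative_intros D E)
    have dd: "dir_deriv v F = (\<lambda>x. Complex (D x v) (E x v))" for v
      unfolding dir_deriv_def frechet_derivative_at[OF FD, symmetric] ..
    have "dir_deriv v F \<in> C" for v
    proof -
      obtain p' q' where "real_polynomial_function p'" "(\<lambda>x. D x v) = bump_poly N (k + 2) p'"
        "real_polynomial_function q'" "(\<lambda>x. E x v) = bump_poly N (k + 2) q'"
        using D(2) E(2) by blast
      thus ?thesis unfolding dd C_def by (auto simp: fun_eq_iff)
    qed
    thus ?thesis using FD by (auto simp: differentiable_def)
  qed
  have "foldr dir_deriv vs F \<in> C" if "F \<in> C" for vs F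
    using that der by (induction vs) auto
  moreover have "(\<lambda>x. Complex (bump_poly N k p x) (bump_poly N k q x)) \<in> C"
    using assms unfolding C_def by blast
  ultimately show ?thesis unfolding smooth_fun_def using der by blast
qed

lemma bump_poly_eq_0: "norm x \<ge> N \<Longrightarrow> N \<ge> 0 \<Longrightarrow> bump_poly N k p x = 0"
  unfolding bump_poly_def bump_profile_def
  using power_mono[of N "norm x" 2] by (simp add: power2_norm_eq_inner)

lemma test_fun_bump_poly:
  fixes p q :: "'a::euclidean_space \<Rightarrow> real"
  assumes "real_polynomial_function p" "real_polynomial_function q" "N \<ge> 0"
  shows "test_fun (\<lambda>x. Complex (bump_poly N k p x) (bump_poly N k q x))"
  unfolding test_fun_def
proof (intro conjI smooth_bump_poly assms boundedI[of _ N])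
  fix x assume "x \<in> {x. Complex (bump_poly N k p x) (bump_poly N k q x) \<noteq> 0}"
  thus "norm x \<le> N" using bump_poly_eq_0[of N x k] assms(3)
    by (cases "norm x \<le> N") (auto simp: Complex_eq_0)
qed

text \<open>Instead of a mollification, \<open>f\<close> divided by a bump is approximated by a
  polynomial on a ball and the polynomial is multiplied by the bump again. The bump is at most one,
  so the uniform error survives the multiplication.\<close>

lemma test_fun_approx_continuous:
  fixes f :: "'a::euclidean_space \<Rightarrow> complex"
  assumes f: "continuous_on UNIV f" and N: "N > 0" and sup: "\<And>x. norm x \<ge> N \<Longrightarrow> f x = 0" and e: "e > 0"
  obtains \<phi> where "test_fun \<phi>" "\<And>x. cmod (\<phi> x - f x) \<le> e" "\<And>x. norm x \<ge> N + 1 \<Longrightarrow> \<phi> x = 0"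
proof -
  define wt where "wt x = bump_profile 0 ((N + 1)^2 - x \<bullet> x)" for x :: 'a
  have wtc: "continuous_on UNIV wt"
  proof -
    have "continuous_on UNIV (bump_profile 0)"
      using bump_profile_deriv[of 0] by (intro DERIV_continuous_on) auto
    hence "continuous_on UNIV (\<lambda>x::'a. bump_profile 0 ((N + 1)^2 - x \<bullet> x))"
      by (rule continuous_on_compose2) (auto intro!: continuous_intros)
    thus ?thesis by (simp add: wt_def[abs_def])
  qed
  have wt1: "0 \<le> wt x \<and> wt x \<le> 1" for x by (auto simp: wt_def bump_profile_def)
  \<comment> \<open>The value of \<open>wt\<close> on the sphere of radius \<open>N\<close>, hence a
    lower bound inside. The bump has the larger radius \<open>N + 1\<close> so that this value is
    positive.\<close>
  define c where "c = bump_profile 0 ((N + 1)^2 - N^2)"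
  have c: "c > 0"
  proof -
    have "(N + 1)^2 - N^2 > 0" using N by (simp add: power2_eq_square algebra_simps)
    thus ?thesis by (simp add: c_def bump_profile_def)
  qed
  have wtc': "wt x \<ge> c" if "norm x < N" for x
  proof -
    have "x \<bullet> x \<le> N^2" using that by (simp add: power2_norm_eq_inner[symmetric] power_mono)
    moreover have p: "(N + 1)^2 - N^2 > 0" using N by (simp add: power2_eq_square algebra_simps)
    ultimately have "(N + 1)^2 - N^2 \<le> (N + 1)^2 - x \<bullet> x" by simp
    hence "- 1 / ((N + 1)^2 - N^2) \<le> - 1 / ((N + 1)^2 - x \<bullet> x)"
      using p by (simp add: frac_le)
    thus ?thesis using p \<open>(N + 1)^2 - N^2 \<le> (N + 1)^2 - x \<bullet> x\<close>
      unfolding wt_def c_def bump_profile_def by simp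
  qed
  \<comment> \<open>The maximum with \<open>c\<close> removes the zeros of \<open>wt\<close> at
    places where \<open>f\<close> vanishes anyway; thus \<open>G\<close> is continuous on the closed
    ball and \<open>G * wt = f\<close>.\<close>
  define G where "G x = f x / complex_of_real (max (wt x) c)" for x
  have "continuous_on (cball 0 (N + 1)) G"
    unfolding G_def using c f wtc
    by (intro continuous_intros) (auto intro: continuous_on_subset simp: max_def)
  then obtain P where P: "polynomial_function P" "\<forall>x\<in>cball 0 (N + 1). norm (G x - P x) < e"
    using Stone_Weierstrass_polynomial_function[of "cball 0 (N + 1)" G e] e by auto
  have Pr: "real_polynomial_function (\<lambda>x. Re (P x))" "real_polynomial_function (\<lambda>x. Im (P x))"
    using P(1) bounded_linear_Re bounded_linear_Im unfolding polynomial_function_def o_def by auto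
  define \<phi> where "\<phi> x = Complex (bump_poly (N + 1) 0 (\<lambda>x. Re (P x)) x) (bump_poly (N + 1) 0 (\<lambda>x. Im (P x)) x)" for x
  have \<phi>eq: "\<phi> x = P x * complex_of_real (wt x)" for x
    by (simp add: \<phi>_def bump_poly_def wt_def complex_eq_iff)
  have z: "wt x = 0" if "norm x \<ge> N + 1" for x
    using bump_poly_eq_0[of "N + 1" x 0 "\<lambda>_. 1"] that N by (simp add: bump_poly_def wt_def)
  show ?thesis
  proof (rule that)
    show "test_fun \<phi>" unfolding \<phi>_def[abs_def] using N by (intro test_fun_bump_poly Pr) auto
    show "\<phi> x = 0" if "norm x \<ge> N + 1" for x using z[OF that] by (simp add: \<phi>eq)
    show "cmod (\<phi> x - f x) \<le> e" for x
    proof (cases "norm x \<ge> N + 1")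
      case True thus ?thesis using z[OF True] sup[of x] e by (simp add: \<phi>eq)
    next
      case False
      have "f x = G x * complex_of_real (wt x)"
      proof (cases "norm x < N")
        case True
        hence "max (wt x) c = wt x" "wt x \<noteq> 0" using wtc'[OF True] c by auto
        thus ?thesis by (simp add: G_def)
      next
        case False thus ?thesis using sup[of x] by (simp add: G_def)
      qed
      hence "\<phi> x - f x = (P x - G x) * complex_of_real (wt x)" by (simp add: \<phi>eq algebra_simps)
      hence "cmod (\<phi> x - f x) = cmod (G x - P x) * wt x" using wt1[of x] by (simp add: norm_mult norm_minus_commute)
      also have "\<dots> \<le> e * 1" using P(2) False wt1[of x] e by (intro mult_mono) (auto simp: less_imp_le)
      finally show ?thesis by simp
    qed
  qed
qed

text \<open>A common bound and a common support for the whole sequence are what dominated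
  convergence needs. A measurable function is almost everywhere a limit of continuous ones; these
  are clipped, cut off in space and replaced by nearby test functions.\<close>

lemma bdd_supp_approx:
  fixes \<psi> :: "real^'n \<Rightarrow> complex"
  assumes "bdd_supp \<psi>"
  obtains \<phi> :: "nat \<Rightarrow> real^'n \<Rightarrow> complex" and M where "\<And>n. test_fun (\<phi> n)"
    "\<And>n x. cmod (\<phi> n x) \<le> M" "\<And>n x. norm x > M \<Longrightarrow> \<phi> n x = 0" "AE x in lborel. (\<lambda>n. \<phi> n x) \<longlonglongrightarrow> \<psi> x"
proof -
  obtain M0 where M0: "\<And>x. cmod (\<psi> x) \<le> M0" "\<And>x. \<psi> x \<noteq> 0 \<Longrightarrow> norm x \<le> M0"
    using assms by (auto simp: bdd_supp_def)
  define M where "M = max M0 1"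
  have M: "M > 0" "\<And>x. cmod (\<psi> x) \<le> M" "\<And>x. \<psi> x \<noteq> 0 \<Longrightarrow> norm x \<le> M"
    using M0 by (auto simp: M_def le_max_iff_disj)
  have "\<psi> \<in> borel_measurable lebesgue" using bdd_supp_measurable[OF assms] by (simp add: measurable_completion)
  hence "\<psi> measurable_on UNIV" by (rule lebesgue_measurable_imp_measurable_on) simp
  then obtain Z g where Z: "negligible Z" and g: "\<And>n. continuous_on UNIV (g n)"
    and lim: "\<And>x. x \<notin> Z \<Longrightarrow> (\<lambda>n. g n x) \<longlonglongrightarrow> \<psi> x"
    unfolding measurable_on_def by auto
  define cut where "cut x = max 0 (min 1 (M + 1 - norm x))" for x :: "real^'n"
  \<comment> \<open>The first factor retracts the values radially to the disc of radius
    \<open>M\<close>; both it and \<open>cut\<close> leave the limit \<open>\<psi>\<close>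
    unchanged, since \<open>\<psi>\<close> obeys the bound \<open>M\<close> in size and
    support.\<close>
  define f where "f n x = (g n x * complex_of_real (M / max M (cmod (g n x)))) * complex_of_real (cut x)" for n x
  have fc: "continuous_on UNIV (f n)" for n
    unfolding f_def cut_def using g M(1) by (intro continuous_intros) (auto simp: max_def)
  have clip: "cmod (g n x * complex_of_real (M / max M (cmod (g n x)))) \<le> M" for n x
  proof (cases "cmod (g n x) \<le> M")
    case True thus ?thesis using M(1) by (simp add: norm_mult max_def)
  next
    case False
    hence "max M (cmod (g n x)) = cmod (g n x)" by simp
    thus ?thesis using M(1) False unfolding norm_mult norm_of_real by simp
  qed
  have cut01: "0 \<le> cut x \<and> cut x \<le> 1" for x by (auto simp: cut_def)
  have fM: "cmod (f n x) \<le> M" for n x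
    using mult_mono[OF clip[of n x] conjunct2[OF cut01[of x]]] cut01[of x] M(1)
    unfolding f_def norm_mult[of "g n x * _"] by simp
  have f0: "f n x = 0" if "norm x \<ge> M + 1" for n x using that by (simp add: f_def cut_def)
  have flim: "(\<lambda>n. f n x) \<longlonglongrightarrow> \<psi> x" if "x \<notin> Z" for x
  proof -
    have "(\<lambda>n. f n x) \<longlonglongrightarrow> (\<psi> x * complex_of_real (M / max M (cmod (\<psi> x)))) * complex_of_real (cut x)"
      unfolding f_def using M(1) by (intro tendsto_intros lim that) (auto simp: max_def)
    moreover have "(\<psi> x * complex_of_real (M / max M (cmod (\<psi> x)))) * complex_of_real (cut x) = \<psi> x"
      using M(1) M(2,3)[of x] by (cases "\<psi> x = 0") (auto simp: max_def cut_def)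
    ultimately show ?thesis by simp
  qed
  have "\<exists>\<phi>. test_fun \<phi> \<and> (\<forall>x. cmod (\<phi> x - f n x) \<le> 1 / real (Suc n)) \<and> (\<forall>x. norm x \<ge> M + 1 + 1 \<longrightarrow> \<phi> x = 0)" for n
    by (rule test_fun_approx_continuous[OF fc[of n], of "M + 1" "1 / real (Suc n)"]) (use f0 M(1) in auto)
  then obtain \<phi> where \<phi>: "\<And>n. test_fun (\<phi> n)" "\<And>n x. cmod (\<phi> n x - f n x) \<le> 1 / real (Suc n)"
    "\<And>n x. norm x \<ge> M + 2 \<Longrightarrow> \<phi> n x = 0"
    by (metis add.assoc one_add_one)
  show ?thesis
  proof (rule that[of \<phi> "M + 2"])
    show "test_fun (\<phi> n)" for n by fact
    show "cmod (\<phi> n x) \<le> M + 2" for n x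
    proof -
      have "cmod (\<phi> n x) \<le> cmod (\<phi> n x - f n x) + cmod (f n x)"
        using norm_triangle_ineq[of "\<phi> n x - f n x" "f n x"] by simp
      also have "\<dots> \<le> 1 / real (Suc n) + M" by (intro add_mono \<phi> fM)
      also have "1 / real (Suc n) \<le> 1" by simp
      finally show ?thesis by simp
    qed
    show "\<phi> n x = 0" if "norm x > M + 2" for n x using \<phi>(3) that by simp
    have "Z \<in> null_sets lebesgue" using Z by (simp add: negligible_iff_null_sets)
    hence "AE x in lebesgue. x \<notin> Z" by (rule AE_not_in)
    hence "AE x in lborel. x \<notin> Z" by (simp add: AE_completion_iff)
    thus "AE x in lborel. (\<lambda>n. \<phi> n x) \<longlonglongrightarrow> \<psi> x"
    proof eventually_elim
      case (elim x)
      have "(\<lambda>n. \<phi> n x - f n x) \<longlonglongrightarrow> 0"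
        by (rule Lim_null_comparison[OF _ LIMSEQ_Suc[OF lim_1_over_n]]) (use \<phi>(2) in auto)
      from tendsto_add[OF this flim[OF elim]] show ?case by simp
    qed
  qed
qed

section \<open>Norms by duality with test functions\<close>

lemma test_fun_continuous: "test_fun \<phi> \<Longrightarrow> continuous_on UNIV \<phi>"
  unfolding test_fun_def smooth_fun_def
  by (auto simp: continuous_on_eq_continuous_at intro!: differentiable_imp_continuous_within dest: spec[of _ "[]"])

lemma test_fun_bdd_supp: "test_fun (\<phi> :: real^'n \<Rightarrow> complex) \<Longrightarrow> bdd_supp \<phi>"
proof -
  assume t: "test_fun \<phi>"
  have c: "continuous_on UNIV \<phi>" by (rule test_fun_continuous[OF t])
  obtain N where N: "\<And>x. \<phi> x \<noteq> 0 \<Longrightarrow> norm x \<le> N"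
    using t unfolding test_fun_def bounded_iff by auto
  have "bounded (\<phi> ` cball 0 N)"
    by (intro compact_imp_bounded compact_continuous_image continuous_on_subset[OF c]) auto
  then obtain B where B: "\<And>x. norm x \<le> N \<Longrightarrow> cmod (\<phi> x) \<le> B"
    unfolding bounded_iff by (metis imageI mem_cball_0)
  have "\<forall>x. cmod (\<phi> x) \<le> max (max B N) 0 \<and> (\<phi> x \<noteq> 0 \<longrightarrow> norm x \<le> max (max B N) 0)"
    using N B by (metis max.coboundedI1 max.coboundedI2 norm_zero order_refl)
  thus ?thesis using c by (auto simp: bdd_supp_def borel_measurable_continuous_onI)
qed

text \<open>The weak identity is tested with smooth functions only, whereas the extremiser in
  \<open>dual_bound\<close> is merely bounded and measurable with bounded support. Approximation
  under a common bound carries both sides of the inequality over.\<close>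

lemma dual_bound_bdd_supp:
  fixes g \<psi> :: "real^'n \<Rightarrow> complex"
  assumes gm [measurable]: "g \<in> borel_measurable borel"
    and gl: "\<And>N. integrable lborel (\<lambda>x. indicator (cball 0 N) x *\<^sub>R g x)" and q: "q > 1"
    and hyp: "\<And>\<phi> b. test_fun \<phi> \<Longrightarrow> b \<ge> 0 \<Longrightarrow> Lq_int q \<phi> \<le> ennreal (b powr q) \<Longrightarrow>
       cmod (\<integral>x. g x * cnj (\<phi> x) \<partial>lborel) \<le> B * b"
    and \<psi>: "bdd_supp \<psi>"
  shows "cmod (\<integral>x. g x * cnj (\<psi> x) \<partial>lborel) \<le> B * (\<integral>x. cmod (\<psi> x) powr q \<partial>lborel) powr (1 / q)"
proof -
  obtain \<phi> M where \<phi>: "\<And>n. test_fun (\<phi> n)" "\<And>n x. cmod (\<phi> n x) \<le> M" "\<And>n x. norm x > M \<Longrightarrow> \<phi> n x = 0"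
    "AE x in lborel. (\<lambda>n. \<phi> n x) \<longlonglongrightarrow> \<psi> x"
    by (rule bdd_supp_approx[OF \<psi>]) (rule that)
  have M: "M \<ge> 0" using \<phi>(2) norm_ge_zero order_trans by blast
  have [measurable]: "\<phi> n \<in> borel_measurable borel" "\<psi> \<in> borel_measurable borel" for n
    using bdd_supp_measurable[OF test_fun_bdd_supp[OF \<phi>(1)]] bdd_supp_measurable[OF \<psi>] by auto
  have 1: "(\<lambda>n. \<integral>x. g x * cnj (\<phi> n x) \<partial>lborel) \<longlonglongrightarrow> (\<integral>x. g x * cnj (\<psi> x) \<partial>lborel)"
  proof (rule integral_dominated_convergence)
    show "integrable lborel (\<lambda>x. M * cmod (indicator (cball 0 M) x *\<^sub>R g x))"
      by (intro integrable_mult_right integrable_norm gl)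
    show "AE x in lborel. (\<lambda>n. g x * cnj (\<phi> n x)) \<longlonglongrightarrow> g x * cnj (\<psi> x)"
      using \<phi>(4) by eventually_elim (intro tendsto_intros)
    show "AE x in lborel. norm (g x * cnj (\<phi> n x)) \<le> M * cmod (indicator (cball 0 M) x *\<^sub>R g x)" for n
    proof (intro AE_I2)
      fix x show "norm (g x * cnj (\<phi> n x)) \<le> M * cmod (indicator (cball 0 M) x *\<^sub>R g x)"
        using \<phi>(2)[of n x] \<phi>(3)[of x n] M
        by (cases "norm x > M") (auto simp: norm_mult mult.commute[of M] intro!: mult_left_mono)
    qed
  qed measurable
  have 2: "(\<lambda>n. \<integral>x. cmod (\<phi> n x) powr q \<partial>lborel) \<longlonglongrightarrow> (\<integral>x. cmod (\<psi> x) powr q \<partial>lborel)"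
  proof (rule integral_dominated_convergence)
    show "integrable lborel (\<lambda>x::real^'n. indicator (cball 0 M) x * (M powr q))"
      using emeasure_lborel_cball_finite[of "0::real^'n" M]
      by (intro integrable_mult_left integrable_real_indicator) auto
    show "AE x in lborel. (\<lambda>n. cmod (\<phi> n x) powr q) \<longlonglongrightarrow> cmod (\<psi> x) powr q"
      using \<phi>(4) by eventually_elim (use q in \<open>intro tendsto_powr' tendsto_intros, auto\<close>)
    show "AE x in lborel. norm (cmod (\<phi> n x) powr q) \<le> indicator (cball 0 M) x * (M powr q)" for n
    proof (intro AE_I2)
      fix x show "norm (cmod (\<phi> n x) powr q) \<le> indicator (cball 0 M) x * (M powr q)"
        using \<phi>(2)[of n x] \<phi>(3)[of x n] q by (cases "norm x > M") (auto intro!: powr_mono2)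
    qed
  qed measurable
  have "(\<lambda>n. B * (\<integral>x. cmod (\<phi> n x) powr q \<partial>lborel) powr (1 / q)) \<longlonglongrightarrow> B * (\<integral>x. cmod (\<psi> x) powr q \<partial>lborel) powr (1 / q)"
    using q by (intro tendsto_intros tendsto_powr' 2) (auto intro!: always_eventually)
  moreover have "cmod (\<integral>x. g x * cnj (\<phi> n x) \<partial>lborel) \<le> B * (\<integral>x. cmod (\<phi> n x) powr q \<partial>lborel) powr (1 / q)" for n
  proof (rule hyp[OF \<phi>(1)])
    show "Lq_int q (\<phi> n) \<le> ennreal (((\<integral>x. cmod (\<phi> n x) powr q \<partial>lborel) powr (1 / q)) powr q)"
      using q by (subst Lq_int_bdd_supp[OF test_fun_bdd_supp[OF \<phi>(1)]]) (auto simp: powr_powr)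
  qed simp
  ultimately show ?thesis
    using tendsto_le[OF trivial_limit_sequentially _ tendsto_norm[OF 1]] by auto
qed

text \<open>The converse of Hoelder's inequality, with finiteness of the norm as part of the
  conclusion. The extremiser is therefore truncated to sets \<open>S n\<close> on which everything
  is finite, and the truncation is removed by monotone convergence.\<close>

lemma dual_bound:
  fixes g :: "real^'n \<Rightarrow> complex"
  assumes gm [measurable]: "g \<in> borel_measurable borel"
    and gl: "\<And>N. integrable lborel (\<lambda>x. indicator (cball 0 N) x *\<^sub>R g x)" and r: "r > 1" and B: "B \<ge> 0"
    and hyp: "\<And>\<phi> b. test_fun \<phi> \<Longrightarrow> b \<ge> 0 \<Longrightarrow> Lq_int (r / (r - 1)) \<phi> \<le> ennreal (b powr (r / (r - 1))) \<Longrightarrow>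
       cmod (\<integral>x. g x * cnj (\<phi> x) \<partial>lborel) \<le> B * b"
  shows "Lq_int r g \<le> ennreal (B powr r)"
proof -
  define q where "q = r / (r - 1)"
  have q: "q > 1" using r by (simp add: q_def)
  define S where "S n = {x. cmod (g x) \<le> real n \<and> norm x \<le> real n}" for n
  have [measurable]: "S n \<in> sets borel" for n unfolding S_def by measurable
  have bd: "(\<integral>\<^sup>+x. indicator (S n) x * ennreal (cmod (g x) powr r) \<partial>lborel) \<le> ennreal (B powr r)" for n
  proof -
    \<comment> \<open>The extremiser of Hoelder's inequality: its product with \<open>g\<close> and
      its own \<open>q\<close>-th power are both the \<open>r\<close>-th power of \<open>|g|\<close>
      on \<open>S n\<close>.\<close>
    define \<psi> where "\<psi> x = (if x \<in> S n then complex_of_real (cmod (g x) powr (r - 2)) * g x else 0)" for x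
    have pq: "cmod (\<psi> x) = indicator (S n) x * cmod (g x) powr (r - 1)" for x
    proof -
      have "cmod (g x) powr (r - 2) * cmod (g x) = cmod (g x) powr (r - 1)"
        using powr_add[of "cmod (g x)" "r - 2" 1] by (cases "g x = 0") auto
      thus ?thesis by (simp add: \<psi>_def norm_mult)
    qed
    have \<psi>: "bdd_supp \<psi>"
      unfolding bdd_supp_def
    proof (intro conjI exI allI)
      show "\<psi> \<in> borel_measurable borel" unfolding \<psi>_def[abs_def] by measurable
      fix x
      show "cmod (\<psi> x) \<le> max (real n) (real n powr (r - 1))"
        unfolding pq using r by (auto simp: indicator_def S_def le_max_iff_disj intro!: disjI2 powr_mono2)
      show "\<psi> x \<noteq> 0 \<longrightarrow> norm x \<le> max (real n) (real n powr (r - 1))"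
        by (auto simp: \<psi>_def S_def)
    qed
    define E where "E = (\<integral>x. cmod (\<psi> x) powr q \<partial>lborel)"
    have E0: "E \<ge> 0" by (simp add: E_def)
    have pr: "cmod (\<psi> x) powr q = indicator (S n) x * cmod (g x) powr r" for x
      unfolding pq using r by (auto simp: indicator_def powr_powr q_def)
    have pe: "g x * cnj (\<psi> x) = complex_of_real (cmod (\<psi> x) powr q)" for x
    proof (cases "x \<in> S n \<and> g x \<noteq> 0")
      case True
      have "cmod (g x) powr (r - 2) * (cmod (g x))^2 = cmod (g x) powr r"
        using True powr_add[of "cmod (g x)" "r - 2" 2] by simp
      hence "complex_of_real (cmod (g x) powr (r - 2)) * complex_of_real ((cmod (g x))^2) = complex_of_real (cmod (g x) powr r)"
        by (metis of_real_mult)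
      thus ?thesis unfolding pr using True by (simp add: \<psi>_def complex_norm_square mult_ac del: of_real_power)
    qed (auto simp: pr, auto simp: \<psi>_def)
    have "cmod (\<integral>x. g x * cnj (\<psi> x) \<partial>lborel) \<le> B * E powr (1 / q)"
      unfolding E_def using hyp by (intro dual_bound_bdd_supp gl q \<psi> gm) (auto simp: q_def)
    \<comment> \<open>The truncation makes \<open>E\<close> a finite number, so the power on the
      right can be divided out.\<close>
    hence le: "E \<le> B * E powr (1 / q)" unfolding pe using E0 by (simp add: E_def)
    have "E \<le> B powr r"
    proof (cases "E = 0")
      case False
      hence E: "E > 0" using E0 by simp
      have "1 / q = 1 - 1 / r" using r by (simp add: q_def field_simps)
      hence "E powr (1 / r) * E powr (1 / q) \<le> B * E powr (1 / q)"
        using le E by (simp add: powr_add[symmetric])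
      hence "E powr (1 / r) \<le> B" using E by simp
      hence "(E powr (1 / r)) powr r \<le> B powr r" using r by (intro powr_mono2) auto
      thus ?thesis using r E by (simp add: powr_powr)
    qed simp
    moreover have "(\<integral>\<^sup>+x. indicator (S n) x * ennreal (cmod (g x) powr r) \<partial>lborel) = ennreal E"
    proof -
      have "(\<integral>\<^sup>+x. indicator (S n) x * ennreal (cmod (g x) powr r) \<partial>lborel) = Lq_int q \<psi>"
        unfolding Lq_int_def pr by (intro nn_integral_cong) (auto simp: indicator_def)
      thus ?thesis using Lq_int_bdd_supp[OF \<psi>, of q] q by (simp add: E_def)
    qed
    ultimately show ?thesis by (simp add: ennreal_leI)
  qed
  have "Lq_int r g = (\<integral>\<^sup>+x. (SUP n. indicator (S n) x * ennreal (cmod (g x) powr r)) \<partial>lborel)"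
    unfolding Lq_int_def
  proof (intro nn_integral_cong antisym)
    fix x
    obtain n where n: "max (cmod (g x)) (norm x) \<le> real n" using real_arch_simple by blast
    hence "x \<in> S n" by (simp add: S_def)
    thus "ennreal (cmod (g x) powr r) \<le> (SUP n. indicator (S n) x * ennreal (cmod (g x) powr r))"
      by (intro SUP_upper2[of n]) auto
    show "(SUP n. indicator (S n) x * ennreal (cmod (g x) powr r)) \<le> ennreal (cmod (g x) powr r)"
      by (intro SUP_least) (auto simp: indicator_def)
  qed
  also have "\<dots> = (SUP n. (\<integral>\<^sup>+x. indicator (S n) x * ennreal (cmod (g x) powr r) \<partial>lborel))"
  proof (rule nn_integral_monotone_convergence_SUP)
    show "incseq (\<lambda>n x. indicator (S n) x * ennreal (cmod (g x) powr r))"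
    proof (intro incseq_SucI le_funI mult_right_mono)
      fix n x
      have "S n \<subseteq> S (Suc n)" by (auto simp: S_def)
      thus "indicator (S n) x \<le> (indicator (S (Suc n)) x :: ennreal)" by (auto simp: indicator_def)
    qed simp
  qed measurable
  also have "\<dots> \<le> ennreal (B powr r)" by (intro SUP_least bd)
  finally show ?thesis .
qed

section \<open>Fractional integration in time\<close>

lemma nn_Holder3:
  fixes f g h :: "'a \<Rightarrow> real"
  assumes [measurable]: "f \<in> borel_measurable M" "g \<in> borel_measurable M" "h \<in> borel_measurable M"
    and nn: "\<And>x. f x \<ge> 0" "\<And>x. g x \<ge> 0" "\<And>x. h x \<ge> 0"
    and abc: "a > 0" "b > 0" "c > 0" "a + b + c = 1"
    and XYZ: "X \<ge> 0" "Y \<ge> 0" "Z \<ge> 0"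
    and fX: "(\<integral>\<^sup>+x. ennreal (f x) \<partial>M) \<le> ennreal X"
    and gY: "(\<integral>\<^sup>+x. ennreal (g x) \<partial>M) \<le> ennreal Y"
    and hZ: "(\<integral>\<^sup>+x. ennreal (h x) \<partial>M) \<le> ennreal Z"
  shows "(\<integral>\<^sup>+x. ennreal (f x powr a * (g x powr b * h x powr c)) \<partial>M) \<le> ennreal (X powr a * (Y powr b * Z powr c))"
proof -
  define e where "e = 1 - a"
  have e: "e > 0" "e = b + c" "e < 1" using abc by (auto simp: e_def)
  have gh: "(\<integral>\<^sup>+x. ennreal (g x powr (b / e) * h x powr (c / e)) \<partial>M) \<le> ennreal (Y powr (b / e) * Z powr (c / e))"
  proof (rule nn_Holder[where s = "e / b" and t = "e / c"])
    show "1 / (e / b) + 1 / (e / c) = 1" using e abc by (simp add: add_divide_distrib[symmetric])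
  qed (use e abc nn XYZ gY hZ in \<open>auto simp: powr_powr\<close>)
  show ?thesis
  proof (rule nn_Holder[where s = "1 / a" and t = "1 / e"])
    show "1 / (1 / a) + 1 / (1 / e) = 1" using e abc by simp
    show "(\<integral>\<^sup>+x. ennreal ((g x powr b * h x powr c) powr (1 / e)) \<partial>M) \<le> ennreal ((Y powr b * Z powr c) powr (1 / e))"
      using gh by (simp add: powr_mult powr_powr)
  qed (use e abc nn XYZ fX in \<open>auto simp: powr_powr\<close>)
qed

text \<open>Each side of \<open>t\<close> contributes at most the integral of
  \<open>x powr (- k)\<close> over \<open>[0, T]\<close>, hence the factor 2 and a bound independent
  of \<open>t\<close>.\<close>

lemma nn_integral_abs_powr_window:
  assumes "0 \<le> k" "k < 1" "0 < t" "t < T"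
  shows "(\<integral>\<^sup>+s. indicator {0<..<T} s * ennreal (\<bar>t - s\<bar> powr (- k)) \<partial>lborel) \<le> ennreal (2 * T powr (1 - k) / (1 - k))"
proof -
  have I: "(\<integral>\<^sup>+x. indicator {0..T} x * ennreal (x powr (- k)) \<partial>lborel) = ennreal (T powr (1 - k) / (1 - k))"
    using nn_integral_powr_0[of "- k" T] assms by (simp add: add.commute)
  have "(\<integral>\<^sup>+s. indicator {0<..<T} s * ennreal (\<bar>t - s\<bar> powr (- k)) \<partial>lborel)
    \<le> (\<integral>\<^sup>+s. indicator {0..T} (t + (- 1) * s) * ennreal ((t + (- 1) * s) powr (- k))
         + indicator {0..T} ((- t) + 1 * s) * ennreal (((- t) + 1 * s) powr (- k)) \<partial>lborel)"
    using assms by (intro nn_integral_mono) (auto simp: indicator_def abs_if)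
  also have "\<dots> = (\<integral>\<^sup>+s. indicator {0..T} (t + (- 1) * s) * ennreal ((t + (- 1) * s) powr (- k)) \<partial>lborel)
     + (\<integral>\<^sup>+s. indicator {0..T} ((- t) + 1 * s) * ennreal (((- t) + 1 * s) powr (- k)) \<partial>lborel)"
    by (rule nn_integral_add) measurable
  also have "(\<integral>\<^sup>+s. indicator {0..T} (t + (- 1) * s) * ennreal ((t + (- 1) * s) powr (- k)) \<partial>lborel)
     = ennreal (T powr (1 - k) / (1 - k))"
    using nn_integral_real_affine[of "\<lambda>x. indicator {0..T} x * ennreal (x powr (- k))" "- 1" t] I by simp
  also have "(\<integral>\<^sup>+s. indicator {0..T} ((- t) + 1 * s) * ennreal (((- t) + 1 * s) powr (- k)) \<partial>lborel)
     = ennreal (T powr (1 - k) / (1 - k))"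
    using nn_integral_real_affine[of "\<lambda>x. indicator {0..T} x * ennreal (x powr (- k))" 1 "- t"] I by simp
  also have "ennreal (T powr (1 - k) / (1 - k)) + ennreal (T powr (1 - k) / (1 - k)) = ennreal (2 * T powr (1 - k) / (1 - k))"
    using assms by (subst ennreal_plus[symmetric]) auto
  finally show ?thesis .
qed

text \<open>Young's inequality from \<open>L^m\<close> with \<open>m = p/(r - 1)\<close> to
  \<open>L^p\<close> needs the kernel in \<open>L^\<kappa>\<close> with
  \<open>1/\<kappa> = (p - r + 2)/p\<close>. The kernel \<open>|t| powr (- 2/p)\<close> to the power
  \<open>\<kappa>\<close> has exponent \<open>- k\<close> with \<open>k = 2/(p - r + 2)\<close>, and
  \<open>k < 1\<close> means \<open>p > r\<close>. The constant is the norm of the kernel on a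
  window, without its power of \<open>T\<close>.\<close>

definition young_const :: "real \<Rightarrow> real \<Rightarrow> real" where
  "young_const p r = (2 / (1 - 2 / (p - r + 2))) powr ((p - r + 2) / p)"

lemma young_const_pos: "p > r \<Longrightarrow> r > 2 \<Longrightarrow> young_const p r > 0"
  by (simp add: young_const_def field_simps)

text \<open>Young's convolution inequality proved by splitting the integrand into three factors. The
  result is a measurable majorant \<open>Y\<close> because the convolution may be infinite on a null
  set of times.\<close>

lemma young_time:
  fixes h :: "real \<Rightarrow> real"
  assumes hm [measurable]: "h \<in> borel_measurable borel" and h0: "\<And>s. h s \<ge> 0" "\<And>s. s \<notin> {0<..<T} \<Longrightarrow> h s = 0"
    and pr: "r > 2" "p > r" and T: "T > 0" and B: "B \<ge> 0"
    and hB: "(\<integral>\<^sup>+s. ennreal (h s powr (p / (r - 1))) \<partial>lborel) \<le> ennreal (B powr (p / (r - 1)))"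
  obtains Y :: "real \<Rightarrow> real" where "Y \<in> borel_measurable borel" "\<And>t. Y t \<ge> 0"
    "AE t in lborel. t \<in> {0<..<T} \<longrightarrow> (\<integral>\<^sup>+s. ennreal (\<bar>t - s\<bar> powr (- 2 / p) * h s) \<partial>lborel) \<le> ennreal (Y t)"
    "(\<integral>\<^sup>+t. indicator {0<..<T} t * ennreal (Y t powr p) \<partial>lborel) \<le> ennreal ((young_const p r * T powr ((p - r) / p) * B) powr p)"
proof -
  define m where "m = p / (r - 1)"
  define k where "k = 2 / (p - r + 2)"
  define Q where "Q = 2 * T powr (1 - k) / (1 - k)"
  have m: "m > 0" using pr by (simp add: m_def)
  have k: "0 < k" "k < 1" using pr by (auto simp: k_def)
  have Q: "Q \<ge> 0" using k by (simp add: Q_def)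
  \<comment> \<open>The Hoelder weights: the kernel receives \<open>?a + ?b = (p - r + 2)/p\<close>,
    the function \<open>h\<close> receives \<open>?a + ?c = (r - 1)/p\<close>, and the three add up
    to one. Positivity of \<open>?c\<close> uses \<open>r > 2\<close>.\<close>
  let ?a = "1 / p" and ?b = "(p - r + 1) / p" and ?c = "(r - 2) / p"
  define X where "X t = (\<integral>\<^sup>+s. ennreal (\<bar>t - s\<bar> powr (- k) * h s powr m) \<partial>lborel)" for t
  have Xm [measurable]: "X \<in> borel_measurable borel" unfolding X_def by measurable
  have win: "(\<integral>\<^sup>+s. ennreal (indicator {0<..<T} s * \<bar>t - s\<bar> powr (- k)) \<partial>lborel) \<le> ennreal Q" if "t \<in> {0<..<T}" for t
    using nn_integral_abs_powr_window[of k t T] k that by (simp add: Q_def ennreal_mult' ennreal_indicator)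
  have intX: "(\<integral>\<^sup>+t. indicator {0<..<T} t * X t \<partial>lborel) \<le> ennreal (Q * B powr m)"
  proof -
    have "(\<integral>\<^sup>+t. indicator {0<..<T} t * X t \<partial>lborel) = (\<integral>\<^sup>+t. (\<integral>\<^sup>+s. indicator {0<..<T} t * ennreal (\<bar>t - s\<bar> powr (- k) * h s powr m) \<partial>lborel) \<partial>lborel)"
      unfolding X_def by (subst nn_integral_cmult) auto
    also have "\<dots> = (\<integral>\<^sup>+s. (\<integral>\<^sup>+t. indicator {0<..<T} t * ennreal (\<bar>t - s\<bar> powr (- k) * h s powr m) \<partial>lborel) \<partial>lborel)"
      by (rule lborel_pair.Fubini') measurable
    also have "\<dots> \<le> (\<integral>\<^sup>+s. ennreal Q * ennreal (h s powr m) \<partial>lborel)"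
    proof (intro nn_integral_mono)
      fix s
      have "(\<integral>\<^sup>+t. indicator {0<..<T} t * ennreal (\<bar>t - s\<bar> powr (- k) * h s powr m) \<partial>lborel)
         = (\<integral>\<^sup>+t. ennreal (indicator {0<..<T} t * \<bar>s - t\<bar> powr (- k)) * ennreal (h s powr m) \<partial>lborel)"
        by (intro nn_integral_cong) (auto simp: indicator_def ennreal_mult abs_minus_commute)
      also have "\<dots> = (\<integral>\<^sup>+t. ennreal (indicator {0<..<T} t * \<bar>s - t\<bar> powr (- k)) \<partial>lborel) * ennreal (h s powr m)"
        by (rule nn_integral_multc) measurable
      also have "\<dots> \<le> ennreal Q * ennreal (h s powr m)"
        using win[of s] h0(2)[of s] m by (cases "s \<in> {0<..<T}") (auto intro: mult_right_mono)
      finally show "(\<integral>\<^sup>+t. indicator {0<..<T} t * ennreal (\<bar>t - s\<bar> powr (- k) * h s powr m) \<partial>lborel) \<le> ennreal Q * ennreal (h s powr m)" .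
    qed
    also have "\<dots> = ennreal Q * (\<integral>\<^sup>+s. ennreal (h s powr m) \<partial>lborel)" by (rule nn_integral_cmult) measurable
    also have "\<dots> \<le> ennreal Q * ennreal (B powr m)" using hB by (intro mult_left_mono) (auto simp: m_def)
    finally show ?thesis using Q by (simp add: ennreal_mult)
  qed
  have finX: "AE t in lborel. t \<in> {0<..<T} \<longrightarrow> X t < \<infinity>"
  proof -
    have "(\<integral>\<^sup>+t. indicator {0<..<T} t * X t \<partial>lborel) \<noteq> \<infinity>" using intX by (auto simp: top_unique)
    hence "AE t in lborel. indicator {0<..<T} t * X t \<noteq> \<infinity>" by (intro nn_integral_PInf_AE) auto
    thus ?thesis by eventually_elim (auto simp: indicator_def less_top)
  qed
  \<comment> \<open>Where \<open>X\<close> is infinite, \<open>enn2real\<close> yields 0; the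
    pointwise bound is claimed only off that null set.\<close>
  define Y where "Y t = enn2real (X t) powr ?a * (Q powr ?b * (B powr m) powr ?c)" for t
  show ?thesis
  proof (rule that[of Y])
    show "Y \<in> borel_measurable borel" unfolding Y_def by measurable
    show "Y t \<ge> 0" for t by (simp add: Y_def)
    show "AE t in lborel. t \<in> {0<..<T} \<longrightarrow> (\<integral>\<^sup>+s. ennreal (\<bar>t - s\<bar> powr (- 2 / p) * h s) \<partial>lborel) \<le> ennreal (Y t)"
      using finX
    proof eventually_elim
      case (elim t)
      show ?case
      proof
        assume t: "t \<in> {0<..<T}"
        hence X: "X t = ennreal (enn2real (X t))" using elim by (simp add: ennreal_enn2real_if)
        have "(\<integral>\<^sup>+s. ennreal (\<bar>t - s\<bar> powr (- 2 / p) * h s) \<partial>lborel) =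
          (\<integral>\<^sup>+s. ennreal ((\<bar>t - s\<bar> powr (- k) * h s powr m) powr ?a * ((indicator {0<..<T} s * \<bar>t - s\<bar> powr (- k)) powr ?b * (h s powr m) powr ?c)) \<partial>lborel)"
        proof (intro nn_integral_cong arg_cong[of _ _ ennreal])
          fix s
          show "\<bar>t - s\<bar> powr (- 2 / p) * h s = (\<bar>t - s\<bar> powr (- k) * h s powr m) powr ?a * ((indicator {0<..<T} s * \<bar>t - s\<bar> powr (- k)) powr ?b * (h s powr m) powr ?c)"
          proof (cases "s \<in> {0<..<T} \<and> h s \<noteq> 0 \<and> t \<noteq> s")
            case False
            thus ?thesis using h0(2)[of s] m by auto
          next
            case True
            have "(\<bar>t - s\<bar> powr (- k) * h s powr m) powr ?a * ((indicator {0<..<T} s * \<bar>t - s\<bar> powr (- k)) powr ?b * (h s powr m) powr ?c)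
              = \<bar>t - s\<bar> powr (- k * ?a + - k * ?b) * h s powr (m * ?a + m * ?c)"
            proof -
              have i: "indicator {0<..<T} s = (1::real)" using True by simp
              show ?thesis by (simp only: i mult_1 powr_mult powr_powr powr_add mult_ac)
            qed
            also have "- k * ?a + - k * ?b = - 2 / p"
            proof -
              have "- k * ?a + - k * ?b = - (k * (p - r + 2)) / p"
                by (simp add: add_divide_distrib diff_divide_distrib algebra_simps)
              also have "k * (p - r + 2) = 2"
              proof -
                have "p - r + 2 \<noteq> 0" using pr by simp
                thus ?thesis using nonzero_divide_eq_eq[of "p - r + 2" 2 k] by (simp add: k_def)
              qed
              finally show ?thesis .
            qed
            also have "m * ?a + m * ?c = 1" using pr by (simp add: m_def divide_simps)
            finally show ?thesis using h0(1)[of s] by simp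
          qed
        qed
        also have "\<dots> \<le> ennreal (enn2real (X t) powr ?a * (Q powr ?b * (B powr m) powr ?c))"
        proof (rule nn_Holder3)
          show "(\<integral>\<^sup>+s. ennreal (\<bar>t - s\<bar> powr (- k) * h s powr m) \<partial>lborel) \<le> ennreal (enn2real (X t))"
            using X by (simp add: X_def)
          show "?a + ?b + ?c = 1" using pr by (simp add: divide_simps)
        qed (use pr Q win[OF t] hB h0(1) in \<open>auto simp: m_def\<close>)
        finally show "(\<integral>\<^sup>+s. ennreal (\<bar>t - s\<bar> powr (- 2 / p) * h s) \<partial>lborel) \<le> ennreal (Y t)" by (simp add: Y_def)
      qed
    qed
    have "(\<integral>\<^sup>+t. indicator {0<..<T} t * ennreal (Y t powr p) \<partial>lborel) \<le>
      (\<integral>\<^sup>+t. ennreal (Q powr (p - r + 1) * (B powr m) powr (r - 2)) * (indicator {0<..<T} t * X t) \<partial>lborel)"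
    proof (intro nn_integral_mono_AE)
      show "AE t in lborel. indicator {0<..<T} t * ennreal (Y t powr p) \<le> ennreal (Q powr (p - r + 1) * (B powr m) powr (r - 2)) * (indicator {0<..<T} t * X t)"
        using finX
      proof eventually_elim
        case (elim t)
        show ?case
        proof (cases "t \<in> {0<..<T}")
          case True
          hence X: "X t = ennreal (enn2real (X t))" using elim by (simp add: ennreal_enn2real_if)
          have "Y t powr p = (Q powr (p - r + 1) * (B powr m) powr (r - 2)) * enn2real (X t)"
            using pr by (simp add: Y_def powr_mult powr_powr)
          hence "ennreal (Y t powr p) = ennreal (Q powr (p - r + 1) * (B powr m) powr (r - 2)) * X t"
            by (subst X) (simp add: ennreal_mult)
          thus ?thesis using True by simp
        qed simp
      qed
    qed
    also have "\<dots> = ennreal (Q powr (p - r + 1) * (B powr m) powr (r - 2)) * (\<integral>\<^sup>+t. indicator {0<..<T} t * X t \<partial>lborel)"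
      by (rule nn_integral_cmult) measurable
    also have "\<dots> \<le> ennreal (Q powr (p - r + 1) * (B powr m) powr (r - 2)) * ennreal (Q * B powr m)"
      by (intro mult_left_mono intX) auto
    also have "\<dots> = ennreal ((Q powr (p - r + 1) * Q powr 1) * ((B powr m) powr (r - 2) * (B powr m) powr 1))"
      using Q by (simp add: ennreal_mult[symmetric] mult_ac)
    also have "(Q powr (p - r + 1) * Q powr 1) * ((B powr m) powr (r - 2) * (B powr m) powr 1) = Q powr (p - r + 2) * B powr p"
    proof -
      have "m * (r - 2) + m * 1 = m * (r - 1)" by (simp add: algebra_simps)
      also have "\<dots> = p" using pr by (simp add: m_def)
      finally have "m * (r - 2) + m * 1 = p" .
      moreover have "p - r + 1 + 1 = p - r + 2" by simp
      ultimately show ?thesis by (simp only: powr_add[symmetric] powr_powr)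
    qed
    also have "\<dots> = (young_const p r * T powr ((p - r) / p) * B) powr p"
    proof -
      have "Q powr (p - r + 2) = (2 / (1 - k)) powr (p - r + 2) * T powr ((1 - k) * (p - r + 2))"
        by (simp add: Q_def powr_mult powr_divide powr_powr)
      also have "(1 - k) * (p - r + 2) = (p - r) / p * p" using pr by (simp add: k_def field_simps)
      finally have "Q powr (p - r + 2) = (2 / (1 - k)) powr (p - r + 2) * (T powr ((p - r) / p)) powr p"
        by (simp add: powr_powr)
      moreover have "young_const p r powr p = (2 / (1 - k)) powr (p - r + 2)"
        using pr by (simp add: young_const_def k_def powr_powr)
      ultimately show ?thesis by (simp only: powr_mult)
    qed
    finally show "(\<integral>\<^sup>+t. indicator {0<..<T} t * ennreal (Y t powr p) \<partial>lborel) \<le> ennreal ((young_const p r * T powr ((p - r) / p) * B) powr p)" .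
  qed
qed

text \<open>The convolution, bounded in \<open>L^p\<close> by \<open>young_time\<close>, is paired
  with \<open>h\<close>, which lies in the dual space because \<open>(0, T)\<close> is bounded. The
  power of \<open>T\<close> is paid once in Young's inequality and once in this embedding, hence the
  square.\<close>

lemma young_time_dual:
  fixes h :: "real \<Rightarrow> real"
  assumes hm [measurable]: "h \<in> borel_measurable borel" and h0: "\<And>s. h s \<ge> 0" "\<And>s. s \<notin> {0<..<T} \<Longrightarrow> h s = 0"
    and pr: "r > 2" "p > r" and T: "T > 0" and B: "B \<ge> 0"
    and hB: "(\<integral>\<^sup>+s. ennreal (h s powr (p / (r - 1))) \<partial>lborel) \<le> ennreal (B powr (p / (r - 1)))"
  shows "(\<integral>\<^sup>+t. (\<integral>\<^sup>+s. ennreal (\<bar>t - s\<bar> powr (- 2 / p) * h s * h t) \<partial>lborel) \<partial>lborel)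
    \<le> ennreal (young_const p r * (T powr ((p - r) / p) * B)^2)"
proof -
  obtain Y where Y [measurable]: "Y \<in> borel_measurable borel" and Y0: "\<And>t. Y t \<ge> 0"
    and Y1: "AE t in lborel. t \<in> {0<..<T} \<longrightarrow> (\<integral>\<^sup>+s. ennreal (\<bar>t - s\<bar> powr (- 2 / p) * h s) \<partial>lborel) \<le> ennreal (Y t)"
    and Y2: "(\<integral>\<^sup>+t. indicator {0<..<T} t * ennreal (Y t powr p) \<partial>lborel) \<le> ennreal ((young_const p r * T powr ((p - r) / p) * B) powr p)"
    by (rule young_time[OF assms]) (assumption | rule that)+
  define q where "q = p / (p - 1)"
  define m where "m = p / (r - 1)"
  have q: "q > 1" using pr by (simp add: q_def)
  have m: "m > 0" using pr by (simp add: m_def)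
  \<comment> \<open>The difference \<open>1/q - 1/m\<close> of the reciprocal exponents, that is,
    the power of \<open>T\<close> that the embedding of \<open>L^m\<close> into \<open>L^q\<close>
    costs.\<close>
  define w where "w = (p - r) / p"
  have w: "w > 0" using pr by (simp add: w_def)
  have hq: "(\<integral>\<^sup>+s. ennreal (h s powr q) \<partial>lborel) \<le> ennreal ((T powr w * B) powr q)"
  proof -
    have mq: "m / q > 1" using pr by (simp add: m_def q_def field_simps)
    have e: "1 / (m / q) + 1 / (1 / (w * q)) = 1"
    proof -
      have "1 / (m / q) = (r - 1) / (p - 1)" "1 / (1 / (w * q)) = (p - r) / (p - 1)"
        using pr by (simp_all add: m_def q_def w_def)
      thus ?thesis using pr by (simp add: add_divide_distrib[symmetric])
    qed
    have wq: "w * q > 0" "w * q < 1"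
    proof -
      show "w * q > 0" using w q by simp
      have "1 / (m / q) > 0" using m q by simp
      thus "w * q < 1" using e by simp
    qed
    have "(\<integral>\<^sup>+s. ennreal (h s powr q * indicator {0<..<T} s) \<partial>lborel) \<le> ennreal (B powr q * T powr (w * q))"
    proof (rule nn_Holder[where s = "m / q" and t = "1 / (w * q)"])
      show "(\<integral>\<^sup>+s. ennreal (indicator {0<..<T} s powr (1 / (w * q))) \<partial>lborel) \<le> ennreal ((T powr (w * q)) powr (1 / (w * q)))"
      proof -
        have "(\<integral>\<^sup>+s. ennreal (indicator {0<..<T} s powr (1 / (w * q))) \<partial>lborel) = (\<integral>\<^sup>+s. indicator {0<..<T} s \<partial>lborel)"
          by (intro nn_integral_cong) (auto simp: indicator_def)
        also have "\<dots> = ennreal T" using T by simp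
        finally show ?thesis using T w q by (simp add: powr_powr)
      qed
    qed (use mq e wq h0 hB q in \<open>auto simp: powr_powr m_def\<close>)
    moreover have "h s powr q * indicator {0<..<T} s = h s powr q" for s
      using h0(2)[of s] by (auto simp: indicator_def)
    ultimately show ?thesis by (simp add: powr_mult powr_powr mult.commute)
  qed
  have "(\<integral>\<^sup>+t. (\<integral>\<^sup>+s. ennreal (\<bar>t - s\<bar> powr (- 2 / p) * h s * h t) \<partial>lborel) \<partial>lborel)
    \<le> (\<integral>\<^sup>+t. ennreal (h t * (indicator {0<..<T} t * Y t)) \<partial>lborel)"
  proof (intro nn_integral_mono_AE)
    show "AE t in lborel. (\<integral>\<^sup>+s. ennreal (\<bar>t - s\<bar> powr (- 2 / p) * h s * h t) \<partial>lborel) \<le> ennreal (h t * (indicator {0<..<T} t * Y t))"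
      using Y1
    proof eventually_elim
      case (elim t)
      have "(\<integral>\<^sup>+s. ennreal (\<bar>t - s\<bar> powr (- 2 / p) * h s * h t) \<partial>lborel) = (\<integral>\<^sup>+s. ennreal (\<bar>t - s\<bar> powr (- 2 / p) * h s) \<partial>lborel) * ennreal (h t)"
        using h0 by (subst nn_integral_multc[symmetric]) (auto simp: ennreal_mult[symmetric] intro!: nn_integral_cong)
      also have "\<dots> \<le> ennreal (indicator {0<..<T} t * Y t) * ennreal (h t)"
        using elim h0(2)[of t] by (cases "t \<in> {0<..<T}") (auto intro: mult_right_mono)
      also have "\<dots> = ennreal (h t * (indicator {0<..<T} t * Y t))"
        using h0 Y0 by (simp add: ennreal_mult[symmetric] mult.commute)
      finally show ?case .
    qed
  qed
  also have "\<dots> \<le> ennreal ((T powr w * B) * (young_const p r * T powr w * B))"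
  proof (rule nn_Holder[where s = q and t = p])
    show "1 / q + 1 / p = 1" using pr by (simp add: q_def field_simps)
    have "(\<integral>\<^sup>+t. ennreal ((indicator {0<..<T} t * Y t) powr p) \<partial>lborel) = (\<integral>\<^sup>+t. indicator {0<..<T} t * ennreal (Y t powr p) \<partial>lborel)"
      by (intro nn_integral_cong) (auto simp: indicator_def)
    thus "(\<integral>\<^sup>+t. ennreal ((indicator {0<..<T} t * Y t) powr p) \<partial>lborel) \<le> ennreal ((young_const p r * T powr w * B) powr p)"
      using Y2 by (simp add: w_def)
  qed (use h0 Y0 q pr B young_const_pos[of r p] hq in auto)
  also have "(T powr w * B) * (young_const p r * T powr w * B) = young_const p r * (T powr ((p - r) / p) * B)^2"
    by (simp add: w_def power2_eq_square)
  finally show ?thesis .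
qed

section \<open>The Duhamel integral of bounded data\<close>

text \<open>Time, point and data may all depend on the parameter; the approximations need this,
  because their truncated sources depend on the final time \<open>t\<close> themselves.\<close>

lemma borel_measurable_schr_param:
  fixes F :: "'w \<Rightarrow> real^'n \<Rightarrow> complex"
  assumes [measurable]: "f \<in> borel_measurable N" "g \<in> borel_measurable N"
    "(\<lambda>(w, y). F w y) \<in> borel_measurable (N \<Otimes>\<^sub>M borel)"
  shows "(\<lambda>w. schr (f w) (F w) (g w)) \<in> borel_measurable N"
proof -
  have 1: "(\<lambda>w. F w (g w)) \<in> borel_measurable N"
    using measurable_compose[of "\<lambda>w. (w, g w)" N "N \<Otimes>\<^sub>M borel" "\<lambda>(w, y). F w y" borel] by simp
  have 2: "(\<lambda>w. \<integral>y. schr_kernel (f w) (g w - y) * F w y \<partial>lborel) \<in> borel_measurable N"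
  proof (rule lborel.borel_measurable_lebesgue_integral)
    have "(\<lambda>(w, y). schr_kernel (f w) (g w - y) * F w y) \<in> borel_measurable (N \<Otimes>\<^sub>M (borel :: (real^'n) measure))"
      by measurable
    thus "(\<lambda>(w, y). schr_kernel (f w) (g w - y) * F w y) \<in> borel_measurable (N \<Otimes>\<^sub>M lborel)"
      by (simp cong: measurable_cong_sets sets_pair_measure_cong)
  qed
  show ?thesis unfolding schr_def using 1 2 by measurable
qed

text \<open>Used with \<open>a < t\<close>: then \<open>t - s\<close> stays away from 0 on the
  support, and the kernel of \<open>S(t - s)\<close> is uniformly bounded there.\<close>

definition bdd_supp_time :: "real \<Rightarrow> (real \<Rightarrow> real^'n \<Rightarrow> complex) \<Rightarrow> bool" where
  "bdd_supp_time a F \<longleftrightarrow> case_prod F \<in> borel_measurable (borel \<Otimes>\<^sub>M borel) \<and>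
     (\<exists>M. \<forall>s x. cmod (F s x) \<le> M \<and> (F s x \<noteq> 0 \<longrightarrow> norm x \<le> M \<and> s \<in> {0<..<a}))"

lemma bdd_supp_time_measurable: "bdd_supp_time a F \<Longrightarrow> case_prod F \<in> borel_measurable (borel \<Otimes>\<^sub>M borel)"
  by (simp add: bdd_supp_time_def)

lemma measurable_slice:
  "case_prod F \<in> borel_measurable (borel \<Otimes>\<^sub>M borel) \<Longrightarrow> F s \<in> borel_measurable borel"
  by (drule measurable_Pair2[where x = s]) auto

lemma measurable_uncurry:
  assumes "case_prod F \<in> borel_measurable (borel \<Otimes>\<^sub>M borel)" "f \<in> borel_measurable N" "g \<in> borel_measurable N"
  shows "(\<lambda>w. F (f w) (g w)) \<in> borel_measurable N"
  using measurable_compose[OF measurable_Pair[OF assms(2,3)] assms(1)] by simp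

lemma bdd_supp_bdd_supp_time: "bdd_supp_time a F \<Longrightarrow> bdd_supp (F s)"
  unfolding bdd_supp_time_def bdd_supp_def using measurable_slice by blast

lemma schr_zero_fun: "(\<And>x. f x = 0) \<Longrightarrow> schr \<tau> f x = 0"
  by (simp add: schr_def)

lemma integrable_bounded_support:
  fixes f :: "'a::euclidean_space \<Rightarrow> complex"
  assumes [measurable]: "f \<in> borel_measurable borel" and "\<And>x. cmod (f x) \<le> C" "\<And>x. f x \<noteq> 0 \<Longrightarrow> norm x \<le> N"
  shows "integrable lborel f"
proof (rule Bochner_Integration.integrable_bound)
  show "integrable lborel (\<lambda>x::'a. indicator (cball 0 N) x * C)"
    using emeasure_lborel_cball_finite[of "0::'a" N]
    by (intro integrable_mult_left integrable_real_indicator) auto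
  show "AE x in lborel. norm (f x) \<le> norm (indicator (cball 0 N) x * C)"
  proof (intro AE_I2)
    fix x
    have "0 \<le> C" using assms(2)[of x] norm_ge_zero order_trans by blast
    thus "norm (f x) \<le> norm (indicator (cball 0 N) x * C)"
      using assms(2,3)[of x] by (cases "f x = 0") auto
  qed
qed measurable

text \<open>The Duhamel integral at time \<open>t\<close> of a source that is switched off before
  \<open>t\<close>. Here it exists pointwise as \<open>G\<close>, and the weak formulation follows
  from Fubini and \<open>schr_adjoint\<close>.\<close>

locale bdd_supp_time_flow =
  fixes F :: "real \<Rightarrow> real^'n \<Rightarrow> complex" and a t :: real
  assumes F: "bdd_supp_time a F" and at: "a < t"
begin

definition W :: "real \<Rightarrow> real^'n \<Rightarrow> complex" where "W s x = schr (t - s) (F s) x"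
definition G :: "real^'n \<Rightarrow> complex" where "G x = (\<integral>s. W s x \<partial>lborel)"

lemma Fm [measurable]: "case_prod F \<in> borel_measurable (borel \<Otimes>\<^sub>M borel)"
  using F by (rule bdd_supp_time_measurable)

lemma Wm: "case_prod W \<in> borel_measurable (borel \<Otimes>\<^sub>M borel)"
  unfolding W_def case_prod_beta
  by (intro borel_measurable_schr_param measurable_uncurry[OF Fm]) measurable

lemmas Wm' [measurable] = Wm[unfolded measurable_lborel_pair[symmetric]]

lemma W_slice [measurable]: "W s \<in> borel_measurable borel" "(\<lambda>s. W s x) \<in> borel_measurable borel"
  using Wm measurable_slice[OF Wm] measurable_Pair1[OF Wm, of x] by auto

lemma Gm [measurable]: "G \<in> borel_measurable borel"
  unfolding G_def[abs_def] by measurable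

lemma F_out: "s \<notin> {0<..<a} \<Longrightarrow> F s x = 0"
  using F unfolding bdd_supp_time_def by blast

lemma W_out: "s \<notin> {0<..<a} \<Longrightarrow> W s x = 0"
  unfolding W_def by (intro schr_zero_fun F_out)

lemma W_bounded: "\<exists>C. \<forall>s x. cmod (W s x) \<le> C"
proof -
  obtain M where M: "\<And>s x. cmod (F s x) \<le> M" "\<And>s x. F s x \<noteq> 0 \<Longrightarrow> norm x \<le> M"
    using F unfolding bdd_supp_time_def by blast
  have M0: "M \<ge> 0" using M(1) norm_ge_zero order_trans by blast
  let ?m = "measure lborel (cball (0::real^'n) M)"
  let ?C = "(4 * pi * (t - a)) powr (- real CARD('n) / 2) * (M * ?m)"
  have "cmod (W s x) \<le> ?C" for s x
  proof (cases "s \<in> {0<..<a}")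
    case False thus ?thesis using W_out[OF False] M0 by simp
  next
    case True
    have "(\<integral>y. cmod (F s y) \<partial>lborel) \<le> (\<integral>y. M * indicator (cball (0::real^'n) M) y \<partial>lborel)"
    proof (rule integral_mono')
      show "integrable lborel (\<lambda>y. M * indicator (cball (0::real^'n) M) y)"
        using emeasure_lborel_cball_finite[of "0::real^'n" M] by (intro integrable_mult_right integrable_real_indicator) auto
      show "cmod (F s y) \<le> M * indicator (cball 0 M) y" for y
        using M(1)[of s y] M(2)[of s y] M0 by (cases "F s y = 0") auto
    qed (use M0 in auto)
    also have "\<dots> = M * ?m" by simp
    finally have 1: "(\<integral>y. cmod (F s y) \<partial>lborel) \<le> M * ?m" .
    have "cmod (W s x) \<le> (4 * pi * \<bar>t - s\<bar>) powr (- real CARD('n) / 2) * (\<integral>y. cmod (F s y) \<partial>lborel)"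
      unfolding W_def using True at by (intro cmod_schr_le bdd_supp_integrable bdd_supp_bdd_supp_time[OF F]) auto
    also have "\<dots> \<le> ?C"
      using True at 1 by (intro mult_mono powr_mono2') auto
    finally show ?thesis .
  qed
  thus ?thesis by blast
qed

lemma W_L2_bounded: "\<exists>C\<ge>0. \<forall>s. Lq_int 2 (W s) \<le> ennreal C"
proof -
  obtain M where M: "\<And>s x. cmod (F s x) \<le> M" "\<And>s x. F s x \<noteq> 0 \<Longrightarrow> norm x \<le> M"
    using F unfolding bdd_supp_time_def by blast
  have M0: "M \<ge> 0" using M(1) norm_ge_zero order_trans by blast
  let ?m = "measure lborel (cball (0::real^'n) M)"
  have "Lq_int 2 (W s) \<le> ennreal (M^2 * ?m)" for s
  proof -
    have "Lq_int 2 (W s) \<le> Lq_int 2 (F s)"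
      unfolding W_def[abs_def] by (intro schr_L2 bdd_supp_integrable bdd_supp_bdd_supp_time[OF F])
    also have "\<dots> \<le> (\<integral>\<^sup>+y. ennreal (M^2) * indicator (cball (0::real^'n) M) y \<partial>lborel)"
      unfolding Lq_int_def
    proof (intro nn_integral_mono)
      fix y show "ennreal (cmod (F s y) powr 2) \<le> ennreal (M^2) * indicator (cball 0 M) y"
        using M(1)[of s y] M(2)[of s y] by (cases "F s y = 0") (auto intro!: ennreal_leI power_mono)
    qed
    also have "\<dots> = ennreal (M^2) * emeasure lborel (cball (0::real^'n) M)"
      by (rule nn_integral_cmult_indicator) simp
    also have "emeasure lborel (cball (0::real^'n) M) = ennreal ?m"
      using emeasure_lborel_cball_finite[of "0::real^'n" M] by (intro emeasure_eq_ennreal_measure) auto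
    also have "ennreal (M^2) * ennreal ?m = ennreal (M^2 * ?m)" by (simp add: ennreal_mult)
    finally show ?thesis .
  qed
  moreover have "0 \<le> M^2 * ?m" by simp
  ultimately show ?thesis by blast
qed

lemma W_integrable: "integrable lborel (\<lambda>s. W s x)"
proof -
  obtain C where "\<And>s x. cmod (W s x) \<le> C" using W_bounded by blast
  moreover have "norm s \<le> a" if "W s x \<noteq> 0" for s using W_out[of s x] that by (cases "s \<in> {0<..<a}") auto
  ultimately show ?thesis by (intro integrable_bounded_support[of _ C a] W_slice)
qed

lemma schr_dual_bounded:
  fixes \<phi> :: "real^'n \<Rightarrow> complex"
  assumes "bdd_supp \<phi>"
  shows "\<exists>C. \<forall>s\<in>{0<..<a}. \<forall>x. cmod (schr (s - t) \<phi> x) \<le> C"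
proof (intro exI ballI allI)
  fix s x assume s: "s \<in> {0<..<a}"
  have "cmod (schr (s - t) \<phi> x) \<le> (4 * pi * \<bar>s - t\<bar>) powr (- real CARD('n) / 2) * (\<integral>y. cmod (\<phi> y) \<partial>lborel)"
    using s at by (intro cmod_schr_le bdd_supp_integrable assms) auto
  also have "\<dots> \<le> (4 * pi * (t - a)) powr (- real CARD('n) / 2) * (\<integral>y. cmod (\<phi> y) \<partial>lborel)"
    using s at by (intro mult_right_mono powr_mono2') auto
  finally show "cmod (schr (s - t) \<phi> x) \<le> (4 * pi * (t - a)) powr (- real CARD('n) / 2) * (\<integral>y. cmod (\<phi> y) \<partial>lborel)" .
qed

lemma schr_dual_measurable:
  fixes \<phi> :: "real^'n \<Rightarrow> complex"
  assumes "bdd_supp \<phi>"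
  shows "(\<lambda>(s, x). schr (s - t) \<phi> x) \<in> borel_measurable (borel \<Otimes>\<^sub>M borel)"
proof -
  note bdd_supp_measurable[OF assms, measurable]
  show ?thesis unfolding case_prod_beta by (rule borel_measurable_schr_param) measurable
qed

lemma pairing_integrable:
  fixes \<phi> :: "real^'n \<Rightarrow> complex"
  assumes \<phi>: "bdd_supp \<phi>"
  shows "integrable (lborel \<Otimes>\<^sub>M lborel) (\<lambda>(s, x). F s x * cnj (schr (s - t) \<phi> x))"
proof -
  note schr_dual_measurable[OF \<phi>, measurable]
  obtain M where M: "\<And>s x. cmod (F s x) \<le> M" "\<And>s x. F s x \<noteq> 0 \<Longrightarrow> norm x \<le> M \<and> s \<in> {0<..<a}"
    using F unfolding bdd_supp_time_def by blast
  have M0: "M \<ge> 0" using M(1) norm_ge_zero order_trans by blast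
  obtain C where C: "\<And>s x. s \<in> {0<..<a} \<Longrightarrow> cmod (schr (s - t) \<phi> x) \<le> C" using schr_dual_bounded[OF \<phi>] by blast
  have "integrable lborel (\<lambda>(s, x). F s x * cnj (schr (s - t) \<phi> x))"
  proof (rule integrable_bounded_support)
    show "(\<lambda>(s, x). F s x * cnj (schr (s - t) \<phi> x)) \<in> borel_measurable borel"
      unfolding borel_prod[symmetric] by measurable
    show "cmod (case z of (s, x) \<Rightarrow> F s x * cnj (schr (s - t) \<phi> x)) \<le> M * max C 0" for z
    proof (cases "F (fst z) (snd z) = 0")
      case True thus ?thesis using M0 by (simp add: case_prod_beta)
    next
      case False
      hence "cmod (schr (fst z - t) \<phi> (snd z)) \<le> max C 0" using C M(2) by (meson max.coboundedI1)
      thus ?thesis using M(1) M0 by (simp add: case_prod_beta norm_mult mult_mono)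
    qed
    show "norm z \<le> \<bar>a\<bar> + M" if "(case z of (s, x) \<Rightarrow> F s x * cnj (schr (s - t) \<phi> x)) \<noteq> 0" for z
    proof -
      have "norm (snd z) \<le> M \<and> fst z \<in> {0<..<a}" using M(2) that by (auto simp: case_prod_beta)
      thus ?thesis using norm_Pair_le[of "fst z" "snd z"] by simp
    qed
  qed
  thus ?thesis by (simp add: lborel_prod)
qed

lemma pairing_eq:
  fixes \<phi> :: "real^'n \<Rightarrow> complex"
  assumes \<phi>: "bdd_supp \<phi>"
  shows "(\<integral>x. G x * cnj (\<phi> x) \<partial>lborel) = (\<integral>s. (\<integral>x. F s x * cnj (schr (s - t) \<phi> x) \<partial>lborel) \<partial>lborel)"
proof -
  note bdd_supp_measurable[OF \<phi>, measurable]
  obtain C where C: "\<And>s x. cmod (W s x) \<le> C" using W_bounded by blast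
  have C0: "C \<ge> 0" using C norm_ge_zero order_trans by blast
  obtain M where M: "\<And>x. cmod (\<phi> x) \<le> M" "\<And>x. \<phi> x \<noteq> 0 \<Longrightarrow> norm x \<le> M" using \<phi> unfolding bdd_supp_def by blast
  have "integrable lborel (\<lambda>(s, x). W s x * cnj (\<phi> x))"
  proof (rule integrable_bounded_support)
    show "(\<lambda>(s, x). W s x * cnj (\<phi> x)) \<in> borel_measurable borel"
      unfolding borel_prod[symmetric] using Wm by measurable
    show "cmod (case z of (s, x) \<Rightarrow> W s x * cnj (\<phi> x)) \<le> C * M" for z
      using C M(1) C0 by (simp add: case_prod_beta norm_mult mult_mono)
    show "norm z \<le> \<bar>a\<bar> + M" if "(case z of (s, x) \<Rightarrow> W s x * cnj (\<phi> x)) \<noteq> 0" for z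
    proof -
      have "norm (snd z) \<le> M" "fst z \<in> {0<..<a}" using M(2) W_out that by (auto simp: case_prod_beta)
      thus ?thesis using norm_Pair_le[of "fst z" "snd z"] by simp
    qed
  qed
  hence hi: "integrable (lborel \<Otimes>\<^sub>M lborel) (\<lambda>(s, x). W s x * cnj (\<phi> x))" by (simp add: lborel_prod)
  have "(\<integral>x. G x * cnj (\<phi> x) \<partial>lborel) = (\<integral>x. (\<integral>s. W s x * cnj (\<phi> x) \<partial>lborel) \<partial>lborel)"
    unfolding G_def by simp
  also have "\<dots> = (\<integral>s. (\<integral>x. W s x * cnj (\<phi> x) \<partial>lborel) \<partial>lborel)"
    by (rule lborel_pair.Fubini_integral[OF hi])
  also have "\<dots> = (\<integral>s. (\<integral>x. F s x * cnj (schr (s - t) \<phi> x) \<partial>lborel) \<partial>lborel)"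
  proof (rule Bochner_Integration.integral_cong[OF refl])
    fix s
    show "(\<integral>x. W s x * cnj (\<phi> x) \<partial>lborel) = (\<integral>x. F s x * cnj (schr (s - t) \<phi> x) \<partial>lborel)"
    proof (cases "s \<in> {0<..<a}")
      case True
      thus ?thesis using schr_adjoint[OF bdd_supp_integrable[OF bdd_supp_bdd_supp_time[OF F]] bdd_supp_integrable[OF \<phi>], of "s - t" s] at
        unfolding W_def by simp
    qed (simp add: W_out F_out)
  qed
  finally show ?thesis .
qed

text \<open>The \<open>TT*\<close> identity: the squared norm of \<open>G\<close> is a double time
  integral, and integrating in space first leaves the pairings of \<open>S(t - s) F(s)\<close> with
  \<open>S(t - s') F(s')\<close>, which \<open>schr_inner_bound\<close> controls through
  \<open>|s - s'|\<close> alone.\<close>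

lemma G_L2:
  assumes r: "r > 2"
  shows "Lq_int 2 G < \<infinity>"
    "Lq_int 2 G \<le> (\<integral>\<^sup>+s. (\<integral>\<^sup>+s'. ennreal (disp_const r *
        (\<bar>s - s'\<bar> powr (- (real CARD('n) / 2 - real CARD('n) / r)) * Lq_norm (r / (r - 1)) (F s') * Lq_norm (r / (r - 1)) (F s))) \<partial>lborel) \<partial>lborel)"
proof -
  \<comment> \<open>The two times form one variable, so that the triple integral is exchanged by
    Fubini for two factors.\<close>
  define V where "V z x = W (fst z) x * cnj (W (snd z) x)" for z :: "real \<times> real" and x
  have Wfs [measurable]: "(\<lambda>z. W (fst (fst z)) (snd z)) \<in> borel_measurable ((borel \<Otimes>\<^sub>M borel) \<Otimes>\<^sub>M borel)"
    "(\<lambda>z. W (snd (fst z)) (snd z)) \<in> borel_measurable ((borel \<Otimes>\<^sub>M borel) \<Otimes>\<^sub>M borel)"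
    by (intro measurable_uncurry[OF Wm]; measurable)+
  have Vm: "case_prod V \<in> borel_measurable (lborel \<Otimes>\<^sub>M lborel)"
    unfolding measurable_lborel_pair V_def case_prod_beta borel_prod[symmetric] by measurable
  obtain C where C: "C \<ge> 0" "\<And>s. Lq_int 2 (W s) \<le> ennreal C" using W_L2_bounded by blast
  \<comment> \<open>Cauchy-Schwarz in space and the bounded range of times give the absolute
    integrability that the exchange needs.\<close>
  have inner: "(\<integral>\<^sup>+x. ennreal (cmod (V z x)) \<partial>lborel) \<le> ennreal C * indicator (cbox (0, 0) (a, a)) z" for z
  proof (cases "fst z \<in> {0<..<a} \<and> snd z \<in> {0<..<a}")
    case False
    hence "V z x = 0" for x using W_out by (auto simp: V_def)
    thus ?thesis by simp
  next
    case True
    have "(\<integral>\<^sup>+x. ennreal (cmod (W (fst z) x) * cmod (W (snd z) x)) \<partial>lborel) \<le> ennreal (sqrt C * sqrt C)"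
      using C unfolding Lq_int_def by (intro nn_Holder[where s = 2 and t = 2]) auto
    moreover have "z \<in> cbox (0, 0) (a, a)" using True by (cases z) (auto simp: mem_box Basis_prod_def)
    ultimately show ?thesis using C by (simp add: V_def norm_mult)
  qed
  have "(\<integral>\<^sup>+z. (\<integral>\<^sup>+x. ennreal (cmod (V z x)) \<partial>lborel) \<partial>lborel) \<le> (\<integral>\<^sup>+z. ennreal C * indicator (cbox (0, 0) (a, a)) z \<partial>lborel)"
    by (intro nn_integral_mono inner)
  also have "\<dots> = ennreal C * emeasure lborel (cbox (0::real, 0::real) (a, a))"
    by (simp add: nn_integral_cmult)
  also have "\<dots> < \<infinity>" using emeasure_lborel_cbox_finite[of "(0::real, 0::real)" "(a, a)"] by (simp add: ennreal_mult_less_top)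
  finally have hi: "integrable (lborel \<Otimes>\<^sub>M lborel) (case_prod V)"
    by (intro integrable_pairI Vm)
  have VG: "(\<integral>z. V z x \<partial>lborel) = complex_of_real ((cmod (G x))^2)" for x
  proof -
    have i: "integrable (lborel \<Otimes>\<^sub>M lborel) (\<lambda>(s, s'). 1 * (W s x * cnj (W s' x)))"
      by (rule integrable_tensor[where A = 1]) (use W_integrable[of x] in auto)
    have "(\<integral>z. V z x \<partial>lborel) = (\<integral>z. (case z of (s, s') \<Rightarrow> W s x * cnj (W s' x)) \<partial>(lborel \<Otimes>\<^sub>M lborel))"
      by (simp add: V_def case_prod_beta lborel_prod)
    also have "\<dots> = (\<integral>s. (\<integral>s'. W s x * cnj (W s' x) \<partial>lborel) \<partial>lborel)"
      using lborel_pair.integral_fst[OF i] by simp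
    also have "\<dots> = G x * cnj (G x)"
      unfolding G_def by (simp add: Bochner_Integration.integral_cnj)
    finally show ?thesis by (simp only: complex_norm_square)
  qed
  have "integrable lborel (\<lambda>x. \<integral>z. V z x \<partial>lborel)" by (rule lborel_pair.integrable_snd[OF hi])
  hence "integrable lborel (\<lambda>x. complex_of_real ((cmod (G x))^2))" unfolding VG .
  from integrable_norm[OF this] have Gi: "integrable lborel (\<lambda>x. (cmod (G x))^2)" by (simp add: norm_power)
  have LG: "Lq_int 2 G = ennreal (\<integral>x. (cmod (G x))^2 \<partial>lborel)"
    using nn_integral_eq_integral[OF Gi] by (simp add: Lq_int_def)
  thus "Lq_int 2 G < \<infinity>" by simp
  have "(\<integral>x. (cmod (G x))^2 \<partial>lborel) = cmod (\<integral>x. (\<integral>z. V z x \<partial>lborel) \<partial>lborel)"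
    unfolding VG by (subst integral_complex_of_real) (simp add: integral_nonneg_AE)
  also have "(\<integral>x. (\<integral>z. V z x \<partial>lborel) \<partial>lborel) = (\<integral>z. (\<integral>x. V z x \<partial>lborel) \<partial>lborel)"
    by (rule lborel_pair.Fubini_integral[OF hi])
  finally have "Lq_int 2 G = ennreal (cmod (\<integral>z. (\<integral>x. V z x \<partial>lborel) \<partial>lborel))" unfolding LG by simp
  also have "\<dots> \<le> (\<integral>\<^sup>+z. ennreal (cmod (\<integral>x. V z x \<partial>lborel)) \<partial>lborel)"
    by (intro integral_norm_bound_ennreal lborel_pair.integrable_fst hi)
  also have "\<dots> = (\<integral>\<^sup>+z. ennreal (cmod (\<integral>x. V z x \<partial>lborel)) \<partial>(lborel \<Otimes>\<^sub>M lborel))"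
    by (simp add: lborel_prod)
  also have "\<dots> = (\<integral>\<^sup>+s. (\<integral>\<^sup>+s'. ennreal (cmod (\<integral>x. V (s, s') x \<partial>lborel)) \<partial>lborel) \<partial>lborel)"
  proof (rule lborel.nn_integral_fst[symmetric])
    have "(\<lambda>z. \<integral>x. V z x \<partial>lborel) \<in> borel_measurable lborel"
      using lborel_pair.integrable_fst[OF hi] by (rule borel_measurable_integrable)
    thus "(\<lambda>z. ennreal (cmod (\<integral>x. V z x \<partial>lborel))) \<in> borel_measurable (lborel \<Otimes>\<^sub>M lborel)"
      unfolding lborel_prod by measurable
  qed
  also have "\<dots> \<le> (\<integral>\<^sup>+s. (\<integral>\<^sup>+s'. ennreal (disp_const r *
        (\<bar>s - s'\<bar> powr (- (real CARD('n) / 2 - real CARD('n) / r)) * Lq_norm (r / (r - 1)) (F s') * Lq_norm (r / (r - 1)) (F s))) \<partial>lborel) \<partial>lborel)"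
  proof (rule nn_integral_mono, rule nn_integral_mono_AE)
    fix s
    show "AE s' in lborel. ennreal (cmod (\<integral>x. V (s, s') x \<partial>lborel)) \<le> ennreal (disp_const r *
        (\<bar>s - s'\<bar> powr (- (real CARD('n) / 2 - real CARD('n) / r)) * Lq_norm (r / (r - 1)) (F s') * Lq_norm (r / (r - 1)) (F s)))"
      \<comment> \<open>At \<open>s = s'\<close> the right side is 0, because
        \<open>0 powr x\<close> is 0, and no bound can be expected there; the diagonal is discarded
        as a null set.\<close>
      using AE_lborel_singleton[of s]
    proof eventually_elim
      case (elim s')
      have nn: "Lq_norm (r / (r - 1)) (F s) \<ge> 0" for s by (simp add: Lq_norm_def)
      have eq: "Lq_int (r / (r - 1)) (F s) \<le> ennreal (Lq_norm (r / (r - 1)) (F s) powr (r / (r - 1)))" for s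
        using r Lq_int_bdd_supp[OF bdd_supp_bdd_supp_time[OF F, of s], of "r / (r - 1)"]
        by (simp add: Lq_norm_def powr_powr)
      show ?case
      proof (cases "s \<in> {0<..<a} \<and> s' \<in> {0<..<a}")
        case False
        hence "V (s, s') x = 0" for x using W_out by (auto simp: V_def)
        thus ?thesis by simp
      next
        case True
        have "cmod (\<integral>x. V (s, s') x \<partial>lborel) \<le> disp_const r * \<bar>(t - s) - (t - s')\<bar> powr (- (real CARD('n) / 2 - real CARD('n) / r))
          * Lq_norm (r / (r - 1)) (F s) * Lq_norm (r / (r - 1)) (F s')"
          unfolding V_def W_def fst_conv snd_conv
          by (rule schr_inner_bound) (use True at elim r nn eq bdd_supp_bdd_supp_time[OF F] in auto)
        also have "\<bar>(t - s) - (t - s')\<bar> = \<bar>s - s'\<bar>" by simp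
        finally show ?thesis by (intro ennreal_leI) (simp add: mult_ac)
      qed
    qed
  qed
  finally show "Lq_int 2 G \<le> (\<integral>\<^sup>+s. (\<integral>\<^sup>+s'. ennreal (disp_const r *
        (\<bar>s - s'\<bar> powr (- (real CARD('n) / 2 - real CARD('n) / r)) * Lq_norm (r / (r - 1)) (F s') * Lq_norm (r / (r - 1)) (F s))) \<partial>lborel) \<partial>lborel)" .
qed

end

section \<open>Dual Strichartz estimates\<close>

text \<open>The condition of \<open>duhamel_rel\<close> at a single time, with the nonlinear source
  replaced by an arbitrary one. This makes it linear in the pair of source and solution.\<close>

definition lin_duhamel :: "(real \<Rightarrow> real^'n \<Rightarrow> complex) \<Rightarrow> real \<Rightarrow> (real^'n \<Rightarrow> complex) \<Rightarrow> bool" where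
  "lin_duhamel f t g \<longleftrightarrow> g \<in> borel_measurable borel \<and> Lq_int 2 g < \<infinity> \<and>
     (\<forall>\<phi>. test_fun \<phi> \<longrightarrow>
        (AE s in lborel. s \<in> {0<..<t} \<longrightarrow> integrable lborel (\<lambda>x. f s x * cnj (schr (s - t) \<phi> x)))
      \<and> set_integrable lborel {0<..<t} (\<lambda>s. \<integral>x. f s x * cnj (schr (s - t) \<phi> x) \<partial>lborel)
      \<and> (\<integral>x. g x * cnj (\<phi> x) \<partial>lborel)
          = (LINT s:{0<..<t}|lborel. (\<integral>x. f s x * cnj (schr (s - t) \<phi> x) \<partial>lborel)))"

lemma L2_locally_integrable:
  fixes g :: "real^'n \<Rightarrow> complex"
  assumes [measurable]: "g \<in> borel_measurable borel" and "Lq_int 2 g < \<infinity>"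
  shows "integrable lborel (\<lambda>x. indicator (cball 0 N) x *\<^sub>R g x)"
proof -
  let ?k = "\<lambda>x::real^'n. complex_of_real (indicator (cball 0 N) x)"
  have k: "bdd_supp ?k" unfolding bdd_supp_def
    by (intro conjI exI[of _ "max 1 N"]) (measurable, auto simp: indicator_def)
  have "integrable lborel (\<lambda>x. g x * cnj (?k x))"
    using Lq_int_finite_2[OF k] assms(2) bdd_supp_measurable[OF k] by (intro integrable_L2_mult) auto
  thus ?thesis by (simp add: scaleR_conv_of_real mult.commute)
qed

lemma L2_diff:
  fixes f g :: "real^'n \<Rightarrow> complex"
  assumes [measurable]: "f \<in> borel_measurable borel" "g \<in> borel_measurable borel"
    and "Lq_int 2 f < \<infinity>" "Lq_int 2 g < \<infinity>"
  shows "Lq_int 2 (\<lambda>x. f x - g x) < \<infinity>"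
proof -
  have "Lq_int 2 (\<lambda>x. f x - g x) \<le> (\<integral>\<^sup>+x. 2 * ennreal (cmod (f x) powr 2) + 2 * ennreal (cmod (g x) powr 2) \<partial>lborel)"
    unfolding Lq_int_def
  proof (rule nn_integral_mono)
    fix x
    have "(cmod (f x - g x))^2 \<le> (cmod (f x) + cmod (g x))^2"
      by (intro power_mono norm_triangle_ineq4) auto
    also have "\<dots> \<le> 2 * (cmod (f x))^2 + 2 * (cmod (g x))^2"
      using sum_squares_bound[of "cmod (f x)" "cmod (g x)"] by (simp add: power2_sum)
    finally show "ennreal (cmod (f x - g x) powr 2) \<le> 2 * ennreal (cmod (f x) powr 2) + 2 * ennreal (cmod (g x) powr 2)"
      by (simp add: ennreal_leI flip: ennreal_plus ennreal_numeral ennreal_mult')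
  qed
  also have "\<dots> = 2 * Lq_int 2 f + 2 * Lq_int 2 g"
    unfolding Lq_int_def by (simp add: nn_integral_add nn_integral_cmult)
  also have "\<dots> < \<infinity>" using assms(3,4) by (simp add: ennreal_mult_less_top)
  finally show ?thesis .
qed

lemma pairing_measurable:
  fixes f :: "real \<Rightarrow> real^'n \<Rightarrow> complex"
  assumes f: "case_prod f \<in> borel_measurable (borel \<Otimes>\<^sub>M borel)" and \<phi> [measurable]: "\<phi> \<in> borel_measurable borel"
  shows "(\<lambda>s. \<integral>x. f s x * cnj (schr (s - t) \<phi> x) \<partial>lborel) \<in> borel_measurable borel"
proof (rule lborel.borel_measurable_lebesgue_integral)
  have [measurable]: "(\<lambda>z. schr (fst z - t) \<phi> (snd z)) \<in> borel_measurable (borel \<Otimes>\<^sub>M borel)"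
    by (rule borel_measurable_schr_param) measurable
  have [measurable]: "(\<lambda>z. f (fst z) (snd z)) \<in> borel_measurable (borel \<Otimes>\<^sub>M borel)"
    using f by (simp add: case_prod_beta)
  have "(\<lambda>(s, x). f s x * cnj (schr (s - t) \<phi> x)) \<in> borel_measurable (borel \<Otimes>\<^sub>M borel)"
    unfolding case_prod_beta by measurable
  thus "(\<lambda>(s, x). f s x * cnj (schr (s - t) \<phi> x)) \<in> borel_measurable (borel \<Otimes>\<^sub>M lborel)"
    by (simp cong: measurable_cong_sets sets_pair_measure_cong)
qed

lemma lin_duhamel_diff:
  fixes f1 f2 :: "real \<Rightarrow> real^'n \<Rightarrow> complex"
  assumes f1: "case_prod f1 \<in> borel_measurable (borel \<Otimes>\<^sub>M borel)"
    and f2: "case_prod f2 \<in> borel_measurable (borel \<Otimes>\<^sub>M borel)"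
    and 1: "lin_duhamel f1 t g1" and 2: "lin_duhamel f2 t g2"
  shows "lin_duhamel (\<lambda>s x. f1 s x - f2 s x) t (\<lambda>x. g1 x - g2 x)"
  unfolding lin_duhamel_def
proof (intro conjI allI impI)
  have m [measurable]: "g1 \<in> borel_measurable borel" "g2 \<in> borel_measurable borel"
    and L: "Lq_int 2 g1 < \<infinity>" "Lq_int 2 g2 < \<infinity>"
    using 1 2 by (auto simp: lin_duhamel_def)
  show "(\<lambda>x. g1 x - g2 x) \<in> borel_measurable borel" by measurable
  show "Lq_int 2 (\<lambda>x. g1 x - g2 x) < \<infinity>" by (rule L2_diff[OF m L])
  fix \<phi> :: "real^'n \<Rightarrow> complex" assume \<phi>: "test_fun \<phi>"
  note b = test_fun_bdd_supp[OF \<phi>]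
  let ?F = "\<lambda>f s. \<integral>x. f s x * cnj (schr (s - t) \<phi> x) \<partial>lborel"
  have a1: "AE s in lborel. s \<in> {0<..<t} \<longrightarrow> integrable lborel (\<lambda>x. f1 s x * cnj (schr (s - t) \<phi> x))"
    and a2: "AE s in lborel. s \<in> {0<..<t} \<longrightarrow> integrable lborel (\<lambda>x. f2 s x * cnj (schr (s - t) \<phi> x))"
    and i1: "set_integrable lborel {0<..<t} (?F f1)" and i2: "set_integrable lborel {0<..<t} (?F f2)"
    and e1: "(\<integral>x. g1 x * cnj (\<phi> x) \<partial>lborel) = (LINT s:{0<..<t}|lborel. ?F f1 s)"
    and e2: "(\<integral>x. g2 x * cnj (\<phi> x) \<partial>lborel) = (LINT s:{0<..<t}|lborel. ?F f2 s)"
    using 1 2 \<phi> unfolding lin_duhamel_def by blast+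
  show "AE s in lborel. s \<in> {0<..<t} \<longrightarrow> integrable lborel (\<lambda>x. (f1 s x - f2 s x) * cnj (schr (s - t) \<phi> x))"
    using a1 a2 by eventually_elim (auto simp: left_diff_distrib)
  \<comment> \<open>The inner integrals are additive only for the almost all \<open>s\<close> at
    which both integrands are integrable, so the outer integrals are compared through equality
    almost everywhere.\<close>
  have d: "AE s in lborel. s \<in> {0<..<t} \<longrightarrow> ?F (\<lambda>s x. f1 s x - f2 s x) s = ?F f1 s - ?F f2 s"
    using a1 a2 by eventually_elim (auto simp: left_diff_distrib)
  have e: "AE s in lborel. indicator {0<..<t} s *\<^sub>R ?F f1 s - indicator {0<..<t} s *\<^sub>R ?F f2 s = indicator {0<..<t} s *\<^sub>R ?F (\<lambda>s x. f1 s x - f2 s x) s"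
    using d by eventually_elim (auto simp: indicator_def)
  have M: "(\<lambda>s. indicator {0<..<t} s *\<^sub>R ?F (\<lambda>s x. f1 s x - f2 s x) s) \<in> borel_measurable lborel"
  proof -
    have "case_prod (\<lambda>s x. f1 s x - f2 s x) \<in> borel_measurable (borel \<Otimes>\<^sub>M borel)"
      using f1 f2 by (simp add: case_prod_beta)
    note pairing_measurable[OF this bdd_supp_measurable[OF b], measurable]
    show ?thesis by measurable
  qed
  have i: "integrable lborel (\<lambda>s. indicator {0<..<t} s *\<^sub>R ?F f1 s - indicator {0<..<t} s *\<^sub>R ?F f2 s)"
    using i1 i2 unfolding set_integrable_def by simp
  have "integral\<^sup>L lborel (\<lambda>s. indicator {0<..<t} s *\<^sub>R ?F (\<lambda>s x. f1 s x - f2 s x) s) =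
      integral\<^sup>L lborel (\<lambda>s. indicator {0<..<t} s *\<^sub>R ?F f1 s - indicator {0<..<t} s *\<^sub>R ?F f2 s)"
    using e M i by (intro integral_cong_AE) auto
  moreover have "integrable lborel (\<lambda>s. indicator {0<..<t} s *\<^sub>R ?F (\<lambda>s x. f1 s x - f2 s x) s)"
    using integrable_cong_AE_imp[OF i M e] .
  ultimately have ae: "integral\<^sup>L lborel (\<lambda>s. indicator {0<..<t} s *\<^sub>R ?F (\<lambda>s x. f1 s x - f2 s x) s) =
    integral\<^sup>L lborel (\<lambda>s. indicator {0<..<t} s *\<^sub>R ?F f1 s) - integral\<^sup>L lborel (\<lambda>s. indicator {0<..<t} s *\<^sub>R ?F f2 s)
    \<and> integrable lborel (\<lambda>s. indicator {0<..<t} s *\<^sub>R ?F (\<lambda>s x. f1 s x - f2 s x) s)"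
    using i1 i2 unfolding set_integrable_def by simp
  show "set_integrable lborel {0<..<t} (?F (\<lambda>s x. f1 s x - f2 s x))"
    using ae unfolding set_integrable_def by simp
  have "(\<integral>x. (g1 x - g2 x) * cnj (\<phi> x) \<partial>lborel) = (\<integral>x. g1 x * cnj (\<phi> x) \<partial>lborel) - (\<integral>x. g2 x * cnj (\<phi> x) \<partial>lborel)"
    using integrable_L2_mult[OF m(1) bdd_supp_measurable[OF b] L(1) Lq_int_finite_2[OF b]]
      integrable_L2_mult[OF m(2) bdd_supp_measurable[OF b] L(2) Lq_int_finite_2[OF b]]
    by (simp add: left_diff_distrib)
  thus "(\<integral>x. (g1 x - g2 x) * cnj (\<phi> x) \<partial>lborel) = (LINT s:{0<..<t}|lborel. ?F (\<lambda>s x. f1 s x - f2 s x) s)"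
    unfolding e1 e2 set_lebesgue_integral_def using ae by simp
qed

text \<open>A square root because the \<open>TT*\<close> argument bounds the square of the
  norm.\<close>

definition key_const :: "real \<Rightarrow> real \<Rightarrow> real" where
  "key_const p r = sqrt (disp_const r * young_const p r)"

lemma key_const_pos: "r > 2 \<Longrightarrow> p > r \<Longrightarrow> key_const p r > 0"
  by (simp add: key_const_def disp_const_pos young_const_pos)

text \<open>The function \<open>H\<close> majorises the spatial norm of the source in the exponent
  dual to \<open>r\<close>, and \<open>B\<close> the norm of \<open>H\<close> in \<open>L^m\<close>
  with \<open>m = p/(r - 1)\<close>. Majorants are used because applications obtain them from
  Hoelder's inequality, and because \<open>H\<close> is defined at every time while the norms are
  controlled at almost every time. The equation \<open>gam\<close> makes \<open>2/p\<close> the rate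
  of dispersive decay.\<close>

locale duhamel_data =
  fixes p r T B :: real and f :: "real \<Rightarrow> real^'n \<Rightarrow> complex" and H :: "real \<Rightarrow> real"
  assumes pr: "r > 2" "p > r" and gam: "2 / p = real CARD('n) / 2 - real CARD('n) / r"
    and T: "T > 0" and B: "B \<ge> 0"
    and fm: "case_prod f \<in> borel_measurable (borel \<Otimes>\<^sub>M borel)"
    and Hm [measurable]: "H \<in> borel_measurable borel" and H0: "\<And>s. H s \<ge> 0"
    and Hout: "\<And>s. s \<notin> {0<..<T} \<Longrightarrow> H s = 0"
    and Hf: "AE s in lborel. s \<in> {0<..<T} \<longrightarrow> Lq_int (r / (r - 1)) (f s) \<le> ennreal (H s powr (r / (r - 1)))"
    and HB: "(\<integral>\<^sup>+s. ennreal (H s powr (p / (r - 1))) \<partial>lborel) \<le> ennreal (B powr (p / (r - 1)))"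
begin

abbreviation bound where "bound \<equiv> key_const p r * T powr ((p - r) / p) * B"

lemma bound_nonneg: "bound \<ge> 0"
  using key_const_pos[OF pr] B by simp

text \<open>The source is only required to be dominated by \<open>f\<close> in modulus, which leaves
  its phase free; \<open>key_estimate\<close> exploits this freedom.\<close>

lemma bdd_supp_time_flow_L2:
  assumes F: "bdd_supp_time a F" and at: "a < t" "t \<le> T" and le: "\<And>s x. cmod (F s x) \<le> cmod (f s x)"
  shows "Lq_int 2 (bdd_supp_time_flow.G F t) \<le> ennreal (bound^2)"
proof -
  interpret F: bdd_supp_time_flow F a t using F at by unfold_locales
  define q where "q = r / (r - 1)"
  have q: "q > 0" using pr by (simp add: q_def)
  define h where "h s = Lq_norm q (F s)" for s
  have Lm [measurable]: "(\<lambda>s. Lq_int q (F s)) \<in> borel_measurable borel"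
    unfolding Lq_int_def by (intro lborel.borel_measurable_nn_integral) (use F.Fm in measurable)
  have hm: "h \<in> borel_measurable borel" unfolding h_def[abs_def] Lq_norm_def by measurable
  have h0: "h s \<ge> 0" for s by (simp add: h_def Lq_norm_def)
  have hout: "h s = 0" if "s \<notin> {0<..<T}" for s
  proof -
    have "F s x = 0" for x using F.F_out[of s x] that at by auto
    thus ?thesis by (simp add: h_def Lq_norm_def Lq_int_def)
  qed
  have hH: "AE s in lborel. h s \<le> H s"
    using Hf
  proof eventually_elim
    case (elim s)
    show ?case
    proof (cases "s \<in> {0<..<T}")
      case True
      have "Lq_int q (F s) \<le> Lq_int q (f s)"
        unfolding Lq_int_def using le q by (intro nn_integral_mono ennreal_leI powr_mono2) auto
      hence "Lq_int q (F s) \<le> ennreal (H s powr q)" using elim True by (auto simp: q_def)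
      hence "enn2real (Lq_int q (F s)) \<le> H s powr q" by (intro enn2real_leI) auto
      hence "h s \<le> (H s powr q) powr (1 / q)"
        unfolding h_def Lq_norm_def using q by (intro powr_mono2) auto
      thus ?thesis using q H0[of s] by (simp add: powr_powr)
    qed (use hout H0 in auto)
  qed
  have hB: "(\<integral>\<^sup>+s. ennreal (h s powr (p / (r - 1))) \<partial>lborel) \<le> ennreal (B powr (p / (r - 1)))"
  proof -
    have "(\<integral>\<^sup>+s. ennreal (h s powr (p / (r - 1))) \<partial>lborel) \<le> (\<integral>\<^sup>+s. ennreal (H s powr (p / (r - 1))) \<partial>lborel)"
    proof (rule nn_integral_mono_AE)
      show "AE s in lborel. ennreal (h s powr (p / (r - 1))) \<le> ennreal (H s powr (p / (r - 1)))"
        using hH by eventually_elim (use h0 pr in \<open>auto intro!: ennreal_leI powr_mono2\<close>)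
    qed
    thus ?thesis using HB by (rule order_trans)
  qed
  have "Lq_int 2 F.G \<le> (\<integral>\<^sup>+s. (\<integral>\<^sup>+s'. ennreal (disp_const r * (\<bar>s - s'\<bar> powr (- 2 / p) * h s' * h s)) \<partial>lborel) \<partial>lborel)"
    using F.G_L2(2)[OF pr(1)] by (simp only: gam[symmetric] h_def q_def minus_divide_left)
  also have "\<dots> = (\<integral>\<^sup>+s. (\<integral>\<^sup>+s'. ennreal (disp_const r) * ennreal (\<bar>s - s'\<bar> powr (- 2 / p) * h s' * h s) \<partial>lborel) \<partial>lborel)"
    using disp_const_pos[OF pr(1)] h0 by (intro nn_integral_cong) (auto simp: ennreal_mult)
  also have "\<dots> = ennreal (disp_const r) * (\<integral>\<^sup>+s. (\<integral>\<^sup>+s'. ennreal (\<bar>s - s'\<bar> powr (- 2 / p) * h s' * h s) \<partial>lborel) \<partial>lborel)"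
    using hm by (simp add: nn_integral_cmult)
  also have "\<dots> \<le> ennreal (disp_const r) * ennreal (young_const p r * (T powr ((p - r) / p) * B)^2)"
    by (intro mult_left_mono young_time_dual hm h0 hout pr T B hB) auto
  also have "\<dots> = ennreal (bound^2)"
    using disp_const_pos[OF pr(1)] young_const_pos[OF pr(2,1)]
    by (simp add: ennreal_mult[symmetric] key_const_def power_mult_distrib)
  finally show ?thesis .
qed

text \<open>Giving the truncated source the phase of \<open>S(s - t)\<phi>\<close> puts the absolute values inside the double
  integral, so this also supplies the integrability that the Duhamel integral requires at every \<open>t\<close>;
  \<open>H\<close> alone does not make \<open>|t - s| powr (- 2 / p) * H s\<close> integrable for every \<open>t\<close>.\<close>

lemma key_estimate:
  fixes \<phi> :: "real^'n \<Rightarrow> complex"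
  assumes \<phi>: "bdd_supp \<phi>" and t: "t \<le> T" and b: "b \<ge> 0" "Lq_int 2 \<phi> \<le> ennreal (b^2)"
  shows "(\<integral>\<^sup>+s. (\<integral>\<^sup>+x. indicator {0<..<t} s * ennreal (cmod (f s x) * cmod (schr (s - t) \<phi> x)) \<partial>lborel) \<partial>lborel)
    \<le> ennreal (bound * b)"
proof -
  note bdd_supp_measurable[OF \<phi>, measurable]
  have Sm: "(\<lambda>(s, x). schr (s - t) \<phi> x) \<in> borel_measurable (borel \<Otimes>\<^sub>M borel)"
    unfolding case_prod_beta by (rule borel_measurable_schr_param) measurable
  have Sm' [measurable]: "(\<lambda>z. schr (fst z - t) \<phi> (snd z)) \<in> borel_measurable (borel \<Otimes>\<^sub>M borel)"
    using Sm by (simp add: case_prod_beta)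
  have fm' [measurable]: "(\<lambda>z. f (fst z) (snd z)) \<in> borel_measurable (borel \<Otimes>\<^sub>M borel)"
    using fm by (simp add: case_prod_beta)
  \<comment> \<open>Stopping at distance \<open>1/(n + 1)\<close> before \<open>t\<close> places the
    truncated source within \<open>bdd_supp_time_flow\<close>.\<close>
  define c where "c n = t - 1 / real (Suc n)" for n
  define D where "D n z \<longleftrightarrow> 0 < fst z \<and> fst z < c n \<and> cmod (f (fst z) (snd z)) \<le> real n \<and> norm (snd z) \<le> real n" for n z
  define F where "F n s x = (if D n (s, x) then complex_of_real (cmod (f s x)) * sgn (schr (s - t) \<phi> x) else 0)" for n s x
  define v where "v n z = (if D n z then ennreal (cmod (f (fst z) (snd z)) * cmod (schr (fst z - t) \<phi> (snd z))) else 0)" for n z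
  have Dm [measurable]: "Measurable.pred (borel \<Otimes>\<^sub>M borel) (D n)" for n unfolding D_def[abs_def] by measurable
  have Fm [measurable]: "case_prod (F n) \<in> borel_measurable (borel \<Otimes>\<^sub>M borel)" for n
    unfolding F_def case_prod_beta prod.collapse sgn_div_norm by measurable
  have Ff: "cmod (F n s x) \<le> cmod (f s x)" for n s x
    by (simp add: F_def norm_mult norm_sgn)
  have tf: "bdd_supp_time (c n) (F n)" for n
    unfolding bdd_supp_time_def
  proof (intro conjI Fm exI allI)
    fix s x
    show "cmod (F n s x) \<le> real n"
      by (cases "D n (s, x)") (auto simp: F_def D_def norm_mult norm_sgn)
    show "F n s x \<noteq> 0 \<longrightarrow> norm x \<le> real n \<and> s \<in> {0<..<c n}" by (auto simp: F_def D_def)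
  qed
  have ct: "c n < t" for n by (simp add: c_def)
  have vn: "(\<integral>\<^sup>+z. v n z \<partial>(lborel \<Otimes>\<^sub>M lborel)) \<le> ennreal (bound * b)" for n
  proof -
    interpret F: bdd_supp_time_flow "F n" "c n" t by unfold_locales (fact tf, fact ct)
    define P where "P s x = F n s x * cnj (schr (s - t) \<phi> x)" for s x
    have Pi: "integrable (lborel \<Otimes>\<^sub>M lborel) (case_prod P)"
      unfolding P_def using F.pairing_integrable[OF \<phi>] by simp
    \<comment> \<open>By the choice of phase the integrand equals its own modulus. The integral of
      the modulus is thus the modulus of the pairing of \<open>F.G\<close> with
      \<open>\<phi>\<close>, to which the \<open>L^2\<close> bound applies.\<close>
    have Pr: "case_prod P z = complex_of_real (cmod (case_prod P z))" for z
    proof -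
      have "sgn w * cnj w = complex_of_real (cmod w)" for w :: complex
        by (cases "w = 0") (simp_all add: sgn_div_norm scaleR_conv_of_real mult.assoc complex_norm_square[symmetric] power2_eq_square)
      hence "P s x = (if D n (s, x) then complex_of_real (cmod (f s x) * cmod (schr (s - t) \<phi> x)) else 0)" for s x
        by (simp add: P_def F_def mult.assoc)
      thus ?thesis by (cases z) (auto simp: norm_mult)
    qed
    have vP: "v n z = ennreal (cmod (case_prod P z))" for z
      by (cases z) (auto simp: v_def P_def F_def norm_mult norm_sgn)
    have "(\<integral>\<^sup>+z. v n z \<partial>(lborel \<Otimes>\<^sub>M lborel)) = ennreal (\<integral>z. cmod (case_prod P z) \<partial>(lborel \<Otimes>\<^sub>M lborel))"
      unfolding vP by (intro nn_integral_eq_integral integrable_norm Pi) auto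
    also have "(\<integral>z. cmod (case_prod P z) \<partial>(lborel \<Otimes>\<^sub>M lborel)) = cmod (\<integral>z. complex_of_real (cmod (case_prod P z)) \<partial>(lborel \<Otimes>\<^sub>M lborel))"
      by (subst integral_complex_of_real) (simp add: integral_nonneg_AE)
    also have "(\<integral>z. complex_of_real (cmod (case_prod P z)) \<partial>(lborel \<Otimes>\<^sub>M lborel)) = (\<integral>z. case_prod P z \<partial>(lborel \<Otimes>\<^sub>M lborel))"
      by (intro Bochner_Integration.integral_cong refl Pr[symmetric])
    also have "\<dots> = (\<integral>s. (\<integral>x. P s x \<partial>lborel) \<partial>lborel)"
      using lborel_pair.integral_fst[OF Pi] by simp
    also have "\<dots> = (\<integral>x. F.G x * cnj (\<phi> x) \<partial>lborel)"
      unfolding P_def F.pairing_eq[OF \<phi>] ..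
    also have "ennreal (cmod \<dots>) \<le> (\<integral>\<^sup>+x. ennreal (cmod (F.G x) * cmod (\<phi> x)) \<partial>lborel)"
    proof (cases "integrable lborel (\<lambda>x. F.G x * cnj (\<phi> x))")
      case True
      from integral_norm_bound_ennreal[OF True] show ?thesis by (simp add: norm_mult)
    qed (simp add: not_integrable_integral_eq)
    also have "\<dots> \<le> ennreal (bound * b)"
      using bdd_supp_time_flow_L2[OF tf[of n] ct[of n] t Ff] b bound_nonneg unfolding Lq_int_def
      by (intro nn_Holder[where s = 2 and t = 2]) auto
    finally show ?thesis .
  qed
  have "(\<integral>\<^sup>+s. (\<integral>\<^sup>+x. indicator {0<..<t} s * ennreal (cmod (f s x) * cmod (schr (s - t) \<phi> x)) \<partial>lborel) \<partial>lborel)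
    = (\<integral>\<^sup>+z. (case z of (s, x) \<Rightarrow> indicator {0<..<t} s * ennreal (cmod (f s x) * cmod (schr (s - t) \<phi> x))) \<partial>(lborel \<Otimes>\<^sub>M lborel))"
    by (subst lborel.nn_integral_fst[symmetric]) (auto simp: case_prod_beta measurable_lborel_pair)
  \<comment> \<open>The sets \<open>D n\<close> increase to all of space over the times in
    \<open>(0, t)\<close>, so monotone convergence transfers the uniform bound.\<close>
  also have "\<dots> = (\<integral>\<^sup>+z. (SUP n. v n z) \<partial>(lborel \<Otimes>\<^sub>M lborel))"
  proof (intro nn_integral_cong antisym)
    fix z
    show "(case z of (s, x) \<Rightarrow> indicator {0<..<t} s * ennreal (cmod (f s x) * cmod (schr (s - t) \<phi> x))) \<le> (SUP n. v n z)"
    proof (cases "fst z \<in> {0<..<t}")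
      case True
      obtain n1 where n1: "max (cmod (f (fst z) (snd z))) (norm (snd z)) \<le> real n1" using real_arch_simple by blast
      obtain n2 where n2: "1 / real (Suc n2) < t - fst z" using True nat_approx_posE[of "t - fst z"] by auto
      define n where "n = max n1 n2"
      have "1 / real (Suc n) \<le> 1 / real (Suc n2)" by (simp add: n_def frac_le)
      hence "fst z < c n" using n2 by (simp add: c_def)
      moreover have "real n1 \<le> real n" by (simp add: n_def)
      ultimately have "D n z" using True n1 by (simp add: D_def)
      thus ?thesis using True by (intro SUP_upper2[of n]) (auto simp: v_def case_prod_beta)
    qed (simp add: case_prod_beta)
    show "(SUP n. v n z) \<le> (case z of (s, x) \<Rightarrow> indicator {0<..<t} s * ennreal (cmod (f s x) * cmod (schr (s - t) \<phi> x)))"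
    proof (rule SUP_least)
      fix n
      show "v n z \<le> (case z of (s, x) \<Rightarrow> indicator {0<..<t} s * ennreal (cmod (f s x) * cmod (schr (s - t) \<phi> x)))"
        using ct[of n] by (auto simp: v_def D_def case_prod_beta indicator_def)
    qed
  qed
  also have "\<dots> = (SUP n. (\<integral>\<^sup>+z. v n z \<partial>(lborel \<Otimes>\<^sub>M lborel)))"
  proof (rule nn_integral_monotone_convergence_SUP)
    show "incseq v"
    proof (intro incseq_SucI le_funI)
      fix n z
      have "c n \<le> c (Suc n)" by (simp add: c_def frac_le)
      hence "D n z \<Longrightarrow> D (Suc n) z" by (auto simp: D_def)
      thus "v n z \<le> v (Suc n) z" by (auto simp: v_def)
    qed
    show "v n \<in> borel_measurable (lborel \<Otimes>\<^sub>M lborel)" for n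
      unfolding v_def[abs_def] measurable_lborel_pair by measurable
  qed
  also have "\<dots> \<le> ennreal (bound * b)" by (intro SUP_least vn)
  finally show ?thesis .
qed

lemma lin_duhamel_le:
  fixes \<phi> :: "real^'n \<Rightarrow> complex"
  assumes g: "lin_duhamel f t g" and \<phi>: "test_fun \<phi>"
  shows "ennreal (cmod (\<integral>x. g x * cnj (\<phi> x) \<partial>lborel)) \<le>
    (\<integral>\<^sup>+s. (\<integral>\<^sup>+x. indicator {0<..<t} s * ennreal (cmod (f s x) * cmod (schr (s - t) \<phi> x)) \<partial>lborel) \<partial>lborel)"
proof -
  let ?I = "\<lambda>s. \<integral>x. f s x * cnj (schr (s - t) \<phi> x) \<partial>lborel"
  have i: "set_integrable lborel {0<..<t} ?I"
    and e: "(\<integral>x. g x * cnj (\<phi> x) \<partial>lborel) = (LINT s:{0<..<t}|lborel. ?I s)"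
    using g \<phi> unfolding lin_duhamel_def by blast+
  have "ennreal (cmod (\<integral>x. g x * cnj (\<phi> x) \<partial>lborel)) \<le> (\<integral>\<^sup>+s. ennreal (cmod (indicator {0<..<t} s *\<^sub>R ?I s)) \<partial>lborel)"
    unfolding e set_lebesgue_integral_def using i unfolding set_integrable_def by (rule integral_norm_bound_ennreal)
  also have "\<dots> \<le> (\<integral>\<^sup>+s. (\<integral>\<^sup>+x. indicator {0<..<t} s * ennreal (cmod (f s x) * cmod (schr (s - t) \<phi> x)) \<partial>lborel) \<partial>lborel)"
  proof (rule nn_integral_mono)
    fix s
    show "ennreal (cmod (indicator {0<..<t} s *\<^sub>R ?I s)) \<le> (\<integral>\<^sup>+x. indicator {0<..<t} s * ennreal (cmod (f s x) * cmod (schr (s - t) \<phi> x)) \<partial>lborel)"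
    proof (cases "s \<in> {0<..<t} \<and> integrable lborel (\<lambda>x. f s x * cnj (schr (s - t) \<phi> x))")
      case True
      with integral_norm_bound_ennreal[of lborel "\<lambda>x. f s x * cnj (schr (s - t) \<phi> x)"] show ?thesis
        by (simp add: norm_mult)
    next
      case False thus ?thesis by (auto simp: not_integrable_integral_eq indicator_def)
    qed
  qed
  finally show ?thesis .
qed

text \<open>The dual form of \<open>key_estimate\<close>. It holds for every \<open>g\<close>
  satisfying the weak identity, however obtained, with one constant for all
  \<open>t \<le> T\<close>; the finite norm contained in \<open>lin_duhamel\<close> provides the
  local integrability that \<open>dual_bound\<close> asks for.\<close>

lemma lin_duhamel_L2:
  assumes g: "lin_duhamel f t g" and t: "t \<le> T"
  shows "Lq_int 2 g \<le> ennreal (bound powr 2)"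
proof (rule dual_bound)
  have g': "g \<in> borel_measurable borel" "Lq_int 2 g < \<infinity>" using g by (auto simp: lin_duhamel_def)
  show "g \<in> borel_measurable borel" by fact
  show "integrable lborel (\<lambda>x. indicator (cball 0 N) x *\<^sub>R g x)" for N
    by (rule L2_locally_integrable[OF g'])
  fix \<phi> :: "real^'n \<Rightarrow> complex" and b assume \<phi>: "test_fun \<phi>" and b: "b \<ge> 0" "Lq_int (2 / (2 - 1)) \<phi> \<le> ennreal (b powr (2 / (2 - 1)))"
  have "ennreal (cmod (\<integral>x. g x * cnj (\<phi> x) \<partial>lborel)) \<le> ennreal (bound * b)"
    using b by (intro order_trans[OF lin_duhamel_le[OF g \<phi>]] key_estimate test_fun_bdd_supp \<phi> t) auto
  thus "cmod (\<integral>x. g x * cnj (\<phi> x) \<partial>lborel) \<le> bound * b"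
    using bound_nonneg b by (subst (asm) ennreal_le_iff) auto
qed (use bound_nonneg in auto)

text \<open>Here the dispersive estimate acts on the test function inside the time integral, so the
  singular integral of \<open>H\<close> must be finite at this \<open>t\<close>. In
  \<open>LL_bounds\<close>, \<open>young_time\<close> provides that for almost every
  \<open>t\<close>.\<close>

lemma lin_duhamel_Lr:
  assumes g: "lin_duhamel f t g" and t: "t \<le> T" and Y: "Y \<ge> 0"
    and HY: "(\<integral>\<^sup>+s. ennreal (\<bar>t - s\<bar> powr (- 2 / p) * H s) \<partial>lborel) \<le> ennreal Y"
  shows "Lq_int r g \<le> ennreal ((disp_const r * Y) powr r)"
proof (rule dual_bound)
  have g': "g \<in> borel_measurable borel" "Lq_int 2 g < \<infinity>" using g by (auto simp: lin_duhamel_def)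
  show "g \<in> borel_measurable borel" by fact
  show "integrable lborel (\<lambda>x. indicator (cball 0 N) x *\<^sub>R g x)" for N
    by (rule L2_locally_integrable[OF g'])
  let ?q = "r / (r - 1)"
  fix \<phi> :: "real^'n \<Rightarrow> complex" and b assume \<phi>: "test_fun \<phi>" and b: "b \<ge> 0" "Lq_int ?q \<phi> \<le> ennreal (b powr ?q)"
  note \<phi>b = test_fun_bdd_supp[OF \<phi>]
  note bdd_supp_measurable[OF \<phi>b, measurable]
  have "(\<integral>\<^sup>+s. (\<integral>\<^sup>+x. indicator {0<..<t} s * ennreal (cmod (f s x) * cmod (schr (s - t) \<phi> x)) \<partial>lborel) \<partial>lborel)
    \<le> (\<integral>\<^sup>+s. ennreal (disp_const r * b) * ennreal (\<bar>t - s\<bar> powr (- 2 / p) * H s) \<partial>lborel)"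
  proof (rule nn_integral_mono_AE)
    show "AE s in lborel. (\<integral>\<^sup>+x. indicator {0<..<t} s * ennreal (cmod (f s x) * cmod (schr (s - t) \<phi> x)) \<partial>lborel)
      \<le> ennreal (disp_const r * b) * ennreal (\<bar>t - s\<bar> powr (- 2 / p) * H s)"
      using Hf
    proof eventually_elim
      case (elim s)
      show ?case
      proof (cases "s \<in> {0<..<t}")
        case True
        have [measurable]: "f s \<in> borel_measurable borel" by (rule measurable_slice[OF fm])
        have "Lq_int r (schr (s - t) \<phi>) \<le> ennreal ((disp_const r * \<bar>s - t\<bar> powr (- (real CARD('n) / 2 - real CARD('n) / r)) * b) powr r)"
          using True by (intro schr_dispersive \<phi>b pr b) auto
        hence S: "Lq_int r (schr (s - t) \<phi>) \<le> ennreal ((disp_const r * \<bar>t - s\<bar> powr (- 2 / p) * b) powr r)"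
          by (simp only: gam[symmetric] minus_divide_left abs_minus_commute)
        have "(\<integral>\<^sup>+x. ennreal (cmod (f s x) * cmod (schr (s - t) \<phi> x)) \<partial>lborel)
          \<le> ennreal (H s * (disp_const r * \<bar>t - s\<bar> powr (- 2 / p) * b))"
        proof (rule nn_Holder[where s = ?q and t = r])
          show "1 / ?q + 1 / r = 1" using pr by (simp add: field_simps)
          show "(\<integral>\<^sup>+x. ennreal (cmod (f s x) powr ?q) \<partial>lborel) \<le> ennreal (H s powr ?q)"
            using elim True t by (simp add: Lq_int_def)
          show "(\<integral>\<^sup>+x. ennreal (cmod (schr (s - t) \<phi> x) powr r) \<partial>lborel) \<le> ennreal ((disp_const r * \<bar>t - s\<bar> powr (- 2 / p) * b) powr r)"
            using S by (simp add: Lq_int_def)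
        qed (use pr H0 disp_const_pos[OF pr(1)] b in auto)
        also have "\<dots> = ennreal (disp_const r * b) * ennreal (\<bar>t - s\<bar> powr (- 2 / p) * H s)"
          using disp_const_pos[OF pr(1)] b H0[of s] by (simp add: ennreal_mult[symmetric] mult_ac)
        finally show ?thesis using True by simp
      qed simp
    qed
  qed
  also have "\<dots> = ennreal (disp_const r * b) * (\<integral>\<^sup>+s. ennreal (\<bar>t - s\<bar> powr (- 2 / p) * H s) \<partial>lborel)"
    by (rule nn_integral_cmult) measurable
  also have "\<dots> \<le> ennreal (disp_const r * b) * ennreal Y" by (intro mult_left_mono HY) auto
  also have "\<dots> = ennreal (disp_const r * Y * b)"
    using disp_const_pos[OF pr(1)] b Y by (simp add: ennreal_mult[symmetric] mult_ac)
  finally have "ennreal (cmod (\<integral>x. g x * cnj (\<phi> x) \<partial>lborel)) \<le> ennreal (disp_const r * Y * b)"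
    by (rule order_trans[OF lin_duhamel_le[OF g \<phi>]])
  thus "cmod (\<integral>x. g x * cnj (\<phi> x) \<partial>lborel) \<le> disp_const r * Y * b"
    using disp_const_pos[OF pr(1)] b Y by (subst (asm) ennreal_le_iff) auto
qed (use pr Y disp_const_pos[OF pr(1)] in auto)

end

section \<open>Existence of the Duhamel integral\<close>

lemma (in bdd_supp_time_flow) lin_duhamel_G:
  assumes "r > (2::real)"
  shows "lin_duhamel F t G"
  unfolding lin_duhamel_def
proof (intro conjI allI impI)
  show "G \<in> borel_measurable borel" by (rule Gm)
  show "Lq_int 2 G < \<infinity>" by (rule G_L2(1)[OF assms])
  fix \<phi> :: "real^'n \<Rightarrow> complex" assume "test_fun \<phi>"
  hence \<phi>: "bdd_supp \<phi>" by (rule test_fun_bdd_supp)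
  note i = pairing_integrable[OF \<phi>]
  have ind: "indicator {0<..<t} s *\<^sub>R (\<integral>x. F s x * cnj (schr (s - t) \<phi> x) \<partial>lborel) = (\<integral>x. F s x * cnj (schr (s - t) \<phi> x) \<partial>lborel)" for s
    using F_out[of s] at by (cases "s \<in> {0<..<t}") auto
  show "AE s in lborel. s \<in> {0<..<t} \<longrightarrow> integrable lborel (\<lambda>x. F s x * cnj (schr (s - t) \<phi> x))"
    using lborel_pair.AE_integrable_fst[OF i] by eventually_elim simp
  show "set_integrable lborel {0<..<t} (\<lambda>s. \<integral>x. F s x * cnj (schr (s - t) \<phi> x) \<partial>lborel)"
    unfolding set_integrable_def ind by (rule lborel_pair.integrable_fst[OF i])
  show "(\<integral>x. G x * cnj (\<phi> x) \<partial>lborel) = (LINT s:{0<..<t}|lborel. (\<integral>x. F s x * cnj (schr (s - t) \<phi> x) \<partial>lborel))"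
    unfolding set_lebesgue_integral_def ind by (rule pairing_eq[OF \<phi>])
qed

text \<open>Weighting the squared differences by \<open>4^k\<close> still leaves a convergent series
  of integrals, so the weighted sum is finite almost everywhere. There the differences are at most a
  constant times \<open>(1/2)^k\<close>, and the sequence converges.\<close>

lemma L2_fast_convergent:
  fixes v :: "nat \<Rightarrow> real^'n \<Rightarrow> complex"
  assumes [measurable]: "\<And>k. v k \<in> borel_measurable borel"
    and d: "\<And>k. Lq_int 2 (\<lambda>x. v k x - v (Suc k) x) \<le> ennreal ((1/16)^k)"
  shows "AE x in lborel. convergent (\<lambda>k. v k x)"
proof -
  let ?a = "\<lambda>k x. ennreal (4^k * (cmod (v k x - v (Suc k) x))^2)"
  have "(\<integral>\<^sup>+x. (\<Sum>k. ?a k x) \<partial>lborel) = (\<Sum>k. (\<integral>\<^sup>+x. ?a k x \<partial>lborel))"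
    by (rule nn_integral_suminf) measurable
  also have "\<dots> \<le> (\<Sum>k. ennreal ((1/4)^k))"
  proof (intro suminf_le summableI)
    fix k
    have "(\<integral>\<^sup>+x. ?a k x \<partial>lborel) = ennreal (4^k) * Lq_int 2 (\<lambda>x. v k x - v (Suc k) x)"
      unfolding Lq_int_def by (simp add: ennreal_mult nn_integral_cmult)
    also have "\<dots> \<le> ennreal (4^k) * ennreal ((1/16)^k)" by (intro mult_left_mono d) auto
    also have "\<dots> = ennreal ((4 * (1/16))^k)" by (simp only: power_mult_distrib) (simp add: ennreal_mult)
    finally show "(\<integral>\<^sup>+x. ?a k x \<partial>lborel) \<le> ennreal ((1/4)^k)" by simp
  qed
  also have "\<dots> = ennreal (\<Sum>k. (1/4)^k)"
    by (rule suminf_ennreal2) (auto intro: summable_geometric)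
  finally have "(\<integral>\<^sup>+x. (\<Sum>k. ?a k x) \<partial>lborel) \<noteq> \<infinity>" by (auto simp: top_unique)
  hence "AE x in lborel. (\<Sum>k. ?a k x) \<noteq> \<infinity>" by (intro nn_integral_PInf_AE) auto
  thus ?thesis
  proof eventually_elim
    case (elim x)
    define C where "C = enn2real (\<Sum>k. ?a k x)"
    have C: "(\<Sum>k. ?a k x) = ennreal C" using elim by (simp add: C_def less_top)
    have C0: "C \<ge> 0" by (simp add: C_def)
    have bd: "cmod (v k x - v (Suc k) x) \<le> sqrt C * (1/2)^k" for k
    proof -
      have gen: "a k \<le> suminf a" for a :: "nat \<Rightarrow> ennreal" using sum_le_suminf[of a "{k}"] by simp
      have "?a k x \<le> (\<Sum>k. ?a k x)" by (rule gen)
      hence "4^k * (cmod (v k x - v (Suc k) x))^2 \<le> C" unfolding C using C0 by (simp add: ennreal_le_iff)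
      moreover have "((2::real)^k)^2 = 4^k" by (simp add: power2_eq_square power_mult_distrib[symmetric])
      ultimately have "(2^k * cmod (v k x - v (Suc k) x))^2 \<le> C"
        by (simp only: power_mult_distrib)
      hence "2^k * cmod (v k x - v (Suc k) x) \<le> sqrt C" by (rule real_le_rsqrt)
      hence "cmod (v k x - v (Suc k) x) \<le> sqrt C / 2^k" by (subst pos_le_divide_eq) (auto simp: mult.commute)
      thus ?thesis by (simp only: power_one_over) simp
    qed
    have "summable (\<lambda>k. v k x - v (Suc k) x)"
      by (rule summable_comparison_test'[where g = "\<lambda>k. sqrt C * (1/2)^k" and N = 0])
         (use bd in \<open>auto intro!: summable_mult summable_geometric\<close>)
    hence "convergent (\<lambda>n. \<Sum>k<n. v k x - v (Suc k) x)" by (simp add: summable_iff_convergent)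
    hence "convergent (\<lambda>n. v 0 x - (\<Sum>k<n. v k x - v (Suc k) x))" by (intro convergent_diff convergent_const)
    moreover have "v 0 x - (\<Sum>k<n. v k x - v (Suc k) x) = v n x" for n
      using sum_lessThan_telescope'[of "\<lambda>k. v k x" n] by simp
    ultimately show ?case by simp
  qed
qed

context duhamel_data
begin

text \<open>The cut in time keeps \<open>s\<close> away from the singularity of the kernel at
  \<open>s = t\<close> and therefore moves with \<open>t\<close>; the other cuts make the source
  bounded with bounded support.\<close>

definition cutoff :: "nat \<Rightarrow> real \<Rightarrow> real \<Rightarrow> real^'n \<Rightarrow> complex" where
  "cutoff n t s x = (if 0 < s \<and> s < t - 1 / real (Suc n) \<and> cmod (f s x) \<le> real n \<and> norm x \<le> real n then f s x else 0)"

definition approx :: "nat \<Rightarrow> real \<Rightarrow> real^'n \<Rightarrow> complex" where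
  "approx n t = bdd_supp_time_flow.G (cutoff n t) t"

lemma fm' [measurable]: "(\<lambda>z. f (fst z) (snd z)) \<in> borel_measurable (borel \<Otimes>\<^sub>M borel)"
  using fm by (simp add: case_prod_beta)

lemma f_meas_comp: "g \<in> borel_measurable N \<Longrightarrow> h \<in> borel_measurable N \<Longrightarrow> (\<lambda>w. f (g w) (h w)) \<in> borel_measurable N"
  by (rule measurable_uncurry[OF fm])

lemma cutoff_meas_comp:
  assumes [measurable]: "\<tau> \<in> borel_measurable N" "g \<in> borel_measurable N" "h \<in> borel_measurable N"
  shows "(\<lambda>w. cutoff n (\<tau> w) (g w) (h w)) \<in> borel_measurable N"
proof -
  note f_meas_comp[OF assms(2,3), measurable]
  show ?thesis unfolding cutoff_def by measurable
qed

lemma cutoff_bdd_supp_time: "bdd_supp_time (t - 1 / real (Suc n)) (cutoff n t)"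
  unfolding bdd_supp_time_def
proof (intro conjI exI[of _ "real n"] allI)
  show "case_prod (cutoff n t) \<in> borel_measurable (borel \<Otimes>\<^sub>M borel)"
    unfolding case_prod_beta by (intro cutoff_meas_comp) measurable
qed (auto simp: cutoff_def)

lemma cutoff_flow: "bdd_supp_time_flow (cutoff n t) (t - 1 / real (Suc n)) t"
  by unfold_locales (rule cutoff_bdd_supp_time, simp)

lemma approx_lin_duhamel: "lin_duhamel (cutoff n t) t (approx n t)"
  unfolding approx_def by (rule bdd_supp_time_flow.lin_duhamel_G[OF cutoff_flow pr(1)])

lemma approx_measurable: "(\<lambda>(t, x). approx n t x) \<in> borel_measurable (borel \<Otimes>\<^sub>M borel)"
proof -
  have "(\<lambda>z. \<integral>s. schr (fst z - s) (cutoff n (fst z) s) (snd z) \<partial>lborel) \<in> borel_measurable (borel \<Otimes>\<^sub>M borel)"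
  proof (rule lborel.borel_measurable_lebesgue_integral)
    have "(\<lambda>w. schr (fst (fst w) - snd w) (cutoff n (fst (fst w)) (snd w)) (snd (fst w)))
       \<in> borel_measurable ((borel \<Otimes>\<^sub>M (borel :: (real^'n) measure)) \<Otimes>\<^sub>M borel)"
      by (rule borel_measurable_schr_param; (unfold case_prod_beta, rule cutoff_meas_comp)?; measurable)
    thus "(\<lambda>(z, s). schr (fst z - s) (cutoff n (fst z) s) (snd z)) \<in> borel_measurable ((borel \<Otimes>\<^sub>M borel) \<Otimes>\<^sub>M lborel)"
      by (simp add: case_prod_beta cong: measurable_cong_sets sets_pair_measure_cong)
  qed
  moreover have "approx n t x = (\<integral>s. schr (t - s) (cutoff n t s) x \<partial>lborel)" for t x
    unfolding approx_def bdd_supp_time_flow.G_def[OF cutoff_flow] bdd_supp_time_flow.W_def[OF cutoff_flow] ..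
  ultimately show ?thesis by (simp add: case_prod_beta)
qed

text \<open>The part lost through the cuts in size and space. It does not involve \<open>t\<close>;
  the loss through the cut in time is treated separately, by means of \<open>H\<close> on a short
  interval.\<close>

definition tail :: "nat \<Rightarrow> real \<Rightarrow> real^'n \<Rightarrow> complex" where
  "tail n s x = (if cmod (f s x) \<le> real n \<and> norm x \<le> real n then 0 else f s x)"

text \<open>The minimum makes \<open>H\<close> a majorant at every \<open>s\<close>, also on the
  null set where \<open>H\<close> fails to bound the norm of the source.\<close>

definition tail_norm :: "nat \<Rightarrow> real \<Rightarrow> real" where
  "tail_norm n s = min (H s) (Lq_norm (r / (r - 1)) (tail n s))"

lemma tail_meas [measurable]: "(\<lambda>z. tail n (fst z) (snd z)) \<in> borel_measurable (borel \<Otimes>\<^sub>M borel)"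
  unfolding tail_def by measurable

lemma tail_slice [measurable]: "tail n s \<in> borel_measurable borel"
proof -
  have [measurable]: "f s \<in> borel_measurable borel" by (rule measurable_slice[OF fm])
  show ?thesis unfolding tail_def[abs_def] by measurable
qed

lemma tail_norm_meas [measurable]: "tail_norm n \<in> borel_measurable borel"
proof -
  have [measurable]: "(\<lambda>s. Lq_int (r / (r - 1)) (tail n s)) \<in> borel_measurable borel"
    unfolding Lq_int_def
    by (intro lborel.borel_measurable_nn_integral) (simp add: case_prod_beta cong: measurable_cong_sets sets_pair_measure_cong)
  show ?thesis unfolding tail_norm_def[abs_def] Lq_norm_def by measurable
qed

lemma tail_norm_nonneg: "0 \<le> tail_norm n s" "tail_norm n s \<le> H s"
  using H0[of s] by (auto simp: tail_norm_def Lq_norm_def)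

lemma tail_norm_bound:
  "AE s in lborel. s \<in> {0<..<T} \<longrightarrow> Lq_int (r / (r - 1)) (tail n s) \<le> ennreal (tail_norm n s powr (r / (r - 1)))"
  using Hf
proof eventually_elim
  case (elim s)
  define q where "q = r / (r - 1)"
  have q: "q > 0" using pr by (simp add: q_def)
  show ?case
  proof
    assume s: "s \<in> {0<..<T}"
    have "Lq_int q (tail n s) \<le> Lq_int q (f s)"
      unfolding Lq_int_def using q by (intro nn_integral_mono ennreal_leI powr_mono2) (auto simp: tail_def)
    hence le: "Lq_int q (tail n s) \<le> ennreal (H s powr q)" using elim s by (auto simp: q_def)
    define E where "E = enn2real (Lq_int q (tail n s))"
    have E: "Lq_int q (tail n s) = ennreal E" using le by (simp add: E_def less_top[symmetric] top_unique) (metis ennreal_enn2real_if ennreal_neq_top neq_top_trans)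
    have "Lq_norm q (tail n s) powr q = E" using q by (simp add: Lq_norm_def E_def powr_powr)
    hence "tail_norm n s = H s \<or> tail_norm n s powr q = E" by (auto simp: tail_norm_def q_def min_def)
    thus "Lq_int (r / (r - 1)) (tail n s) \<le> ennreal (tail_norm n s powr (r / (r - 1)))"
      using le E by (auto simp: q_def)
  qed
qed

lemma tail_norm_tendsto: "AE s in lborel. (\<lambda>n. tail_norm n s) \<longlonglongrightarrow> 0"
  using Hf
proof eventually_elim
  case (elim s)
  define q where "q = r / (r - 1)"
  have q: "q > 0" using pr by (simp add: q_def)
  show ?case
  proof (cases "s \<in> {0<..<T}")
    case False
    hence "tail_norm n s = 0" for n using tail_norm_nonneg[of n s] Hout[OF False] by simp
    thus ?thesis by simp
  next
    case True
    have [measurable]: "f s \<in> borel_measurable borel" by (rule measurable_slice[OF fm])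
    have "(\<lambda>n. (\<integral>\<^sup>+x. ennreal (cmod (tail n s x) powr q) \<partial>lborel)) \<longlonglongrightarrow> (\<integral>\<^sup>+x. 0 \<partial>(lborel :: (real^'n) measure))"
    proof (rule nn_integral_dominated_convergence[where w = "\<lambda>x. ennreal (cmod (f s x) powr q)"])
      show "(\<integral>\<^sup>+x. ennreal (cmod (f s x) powr q) \<partial>lborel) < \<infinity>"
        using elim True by (auto simp: Lq_int_def q_def intro: order_le_less_trans)
      show "AE x in lborel. ennreal (cmod (tail n s x) powr q) \<le> ennreal (cmod (f s x) powr q)" for n
        using q by (intro AE_I2) (auto simp: tail_def)
      show "AE x in lborel. (\<lambda>n. ennreal (cmod (tail n s x) powr q)) \<longlonglongrightarrow> 0"
      proof (intro AE_I2 tendsto_eventually)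
        fix x
        obtain N where N: "max (cmod (f s x)) (norm x) \<le> real N" using real_arch_simple by blast
        show "\<forall>\<^sub>F n in sequentially. ennreal (cmod (tail n s x) powr q) = 0"
          using eventually_ge_at_top[of N] by eventually_elim (use N in \<open>auto simp: tail_def\<close>)
      qed
    qed measurable
    hence "(\<lambda>n. Lq_int q (tail n s)) \<longlonglongrightarrow> ennreal 0" by (simp add: Lq_int_def)
    hence "(\<lambda>n. enn2real (Lq_int q (tail n s))) \<longlonglongrightarrow> 0" by (rule tendsto_enn2real) simp
    hence "(\<lambda>n. Lq_norm q (tail n s)) \<longlonglongrightarrow> 0 powr (1 / q)"
      unfolding Lq_norm_def using q by (intro tendsto_powr') (auto intro!: always_eventually)
    hence lim: "(\<lambda>n. Lq_norm q (tail n s)) \<longlonglongrightarrow> 0" by simp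
    show ?thesis
      by (rule tendsto_sandwich[OF _ _ tendsto_const lim])
         (use tail_norm_nonneg in \<open>auto simp: tail_norm_def q_def\<close>)
  qed
qed

text \<open>Truncating \<open>H\<close> at height \<open>sqrt (n + 1)\<close> controls its mass on the last interval of length
  \<open>1 / (n + 1)\<close> uniformly in \<open>t\<close>. Uniformity lets one subsequence serve all \<open>t\<close>, which keeps the limit
  jointly measurable.\<close>

definition tail_mass :: "nat \<Rightarrow> real" where
  "tail_mass n = (\<integral>s. tail_norm n s powr (p / (r - 1)) \<partial>lborel)
    + (\<integral>s. (if H s powr (p / (r - 1)) > sqrt (real (Suc n)) then H s powr (p / (r - 1)) else 0) \<partial>lborel)
    + 1 / sqrt (real (Suc n))"

lemma H_powr_integrable: "integrable lborel (\<lambda>s. H s powr (p / (r - 1)))"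
  using HB by (intro integrableI_bounded) (auto intro: order_le_less_trans)

lemma tail_norm_integrable: "integrable lborel (\<lambda>s. tail_norm n s powr (p / (r - 1)))"
  using tail_norm_nonneg pr
  by (intro Bochner_Integration.integrable_bound[OF H_powr_integrable]) (auto intro!: AE_I2 powr_mono2)

lemma H_large_integrable: "integrable lborel (\<lambda>s. if H s powr (p / (r - 1)) > c then H s powr (p / (r - 1)) else 0)"
  by (intro Bochner_Integration.integrable_bound[OF H_powr_integrable]) auto

lemma tail_mass_nonneg: "tail_mass n \<ge> 0"
  unfolding tail_mass_def by (intro add_nonneg_nonneg integral_nonneg_AE) auto

lemma tail_mass_tendsto: "tail_mass \<longlonglongrightarrow> 0"
proof -
  define m where "m = p / (r - 1)"
  have m: "m > 0" using pr by (simp add: m_def)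
  have sq: "filterlim (\<lambda>n. sqrt (real (Suc n))) at_top sequentially"
    by (intro filterlim_compose[OF sqrt_at_top] filterlim_compose[OF filterlim_real_sequentially] filterlim_Suc)
  have 1: "(\<lambda>n. \<integral>s. tail_norm n s powr m \<partial>lborel) \<longlonglongrightarrow> (\<integral>s. 0 \<partial>(lborel :: real measure))"
  proof (rule integral_dominated_convergence[where w = "\<lambda>s. H s powr m"])
    show "integrable lborel (\<lambda>s. H s powr m)" unfolding m_def by (rule H_powr_integrable)
    show "AE s in lborel. (\<lambda>n. tail_norm n s powr m) \<longlonglongrightarrow> 0"
      using tail_norm_tendsto
    proof eventually_elim
      case (elim s)
      hence "(\<lambda>n. tail_norm n s powr m) \<longlonglongrightarrow> 0 powr m"
        using m tail_norm_nonneg by (intro tendsto_powr') (auto intro!: always_eventually)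
      thus ?case by simp
    qed
    show "AE s in lborel. norm (tail_norm n s powr m) \<le> H s powr m" for n
      using tail_norm_nonneg m by (auto intro!: AE_I2 powr_mono2)
  qed measurable
  have 2: "(\<lambda>n. \<integral>s. (if H s powr m > sqrt (real (Suc n)) then H s powr m else 0) \<partial>lborel) \<longlonglongrightarrow> (\<integral>s. 0 \<partial>(lborel :: real measure))"
  proof (rule integral_dominated_convergence[where w = "\<lambda>s. H s powr m"])
    show "integrable lborel (\<lambda>s. H s powr m)" unfolding m_def by (rule H_powr_integrable)
    show "AE s in lborel. (\<lambda>n. if H s powr m > sqrt (real (Suc n)) then H s powr m else 0) \<longlonglongrightarrow> 0"
    proof (intro AE_I2 tendsto_eventually)
      fix s
      show "\<forall>\<^sub>F n in sequentially. (if H s powr m > sqrt (real (Suc n)) then H s powr m else 0) = 0"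
        using filterlim_at_top[THEN iffD1, OF sq, rule_format, of "H s powr m"] by eventually_elim auto
    qed
  qed auto
  have 3: "(\<lambda>n. 1 / sqrt (real (Suc n))) \<longlonglongrightarrow> 0"
    by (intro tendsto_divide_0[OF tendsto_const] filterlim_at_top_imp_at_infinity sq)
  from tendsto_add[OF tendsto_add[OF 1 2] 3] show ?thesis
    unfolding tail_mass_def[abs_def] m_def by simp
qed

text \<open>The difference of two approximations solves the weak problem for the difference of their
  sources. Instantiating the locale with this source and a small majorant turns the
  \<open>L^2\<close> estimate into a Cauchy estimate that is uniform in \<open>t\<close>.\<close>

lemma approx_diff_L2:
  assumes t: "t \<le> T" and nm: "n \<le> m"
  shows "Lq_int 2 (\<lambda>x. approx n t x - approx m t x)
    \<le> ennreal ((key_const p r * T powr ((p - r) / p) * (2 * tail_mass n powr ((r - 1) / p))) powr 2)"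
proof -
  define M where "M = p / (r - 1)"
  have M: "M > 0" using pr by (simp add: M_def)
  \<comment> \<open>As \<open>n \<le> m\<close>, before \<open>I\<close> neither cut in time is
    active and the sources differ by at most \<open>tail n\<close>; on \<open>I\<close> the
    difference is bounded by the source itself, and after \<open>I\<close> both vanish.\<close>
  define I where "I = {t - 1 / real (Suc n)..t}"
  have I [measurable]: "I \<in> sets borel" by (simp add: I_def)
  define H' where "H' s = tail_norm n s + indicator I s * H s" for s
  have H'm [measurable]: "H' \<in> borel_measurable borel" unfolding H'_def[abs_def] by measurable
  have H'0: "H' s \<ge> 0" for s using tail_norm_nonneg[of n s] H0[of s] by (simp add: H'_def)
  have cm: "case_prod (cutoff k t) \<in> borel_measurable (borel \<Otimes>\<^sub>M borel)" for k
    by (rule bdd_supp_time_measurable[OF cutoff_bdd_supp_time])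
  \<comment> \<open>The power of \<open>H\<close> is split at height \<open>sqrt (n + 1)\<close>:
    the large part is the second term of \<open>tail_mass\<close>, and the rest contributes at most
    \<open>sqrt (n + 1)\<close> times the length \<open>1/(n + 1)\<close> of
    \<open>I\<close>.\<close>
  have int_I: "(\<integral>\<^sup>+s. ennreal ((indicator I s * H s) powr M) \<partial>lborel)
    \<le> ennreal ((\<integral>s. (if H s powr M > sqrt (real (Suc n)) then H s powr M else 0) \<partial>lborel) + 1 / sqrt (real (Suc n)))"
  proof -
    have "(\<integral>\<^sup>+s. ennreal ((indicator I s * H s) powr M) \<partial>lborel)
      \<le> (\<integral>\<^sup>+s. ennreal (if H s powr M > sqrt (real (Suc n)) then H s powr M else 0) + ennreal (sqrt (real (Suc n))) * indicator I s \<partial>lborel)"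
      using M by (intro nn_integral_mono) (auto simp: indicator_def ennreal_leI)
    also have "\<dots> = (\<integral>\<^sup>+s. ennreal (if H s powr M > sqrt (real (Suc n)) then H s powr M else 0) \<partial>lborel)
       + ennreal (sqrt (real (Suc n))) * emeasure lborel I"
      by (subst nn_integral_add) (auto simp: nn_integral_cmult_indicator)
    also have "(\<integral>\<^sup>+s. ennreal (if H s powr M > sqrt (real (Suc n)) then H s powr M else 0) \<partial>lborel)
       = ennreal (\<integral>s. (if H s powr M > sqrt (real (Suc n)) then H s powr M else 0) \<partial>lborel)"
      using H_large_integrable[of "sqrt (real (Suc n))"] unfolding M_def by (intro nn_integral_eq_integral) auto
    also have "emeasure lborel I = ennreal (1 / real (Suc n))" by (simp add: I_def)
    also have "ennreal (sqrt (real (Suc n))) * ennreal (1 / real (Suc n)) = ennreal (1 / sqrt (real (Suc n)))"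
    proof -
      have "sqrt (real (Suc n)) * (1 / real (Suc n)) = 1 / sqrt (real (Suc n))"
        using real_sqrt_mult_self[of "real (Suc n)"] by (simp add: field_simps)
      thus ?thesis by (simp add: ennreal_mult[symmetric] del: of_nat_Suc)
    qed
    also have "ennreal (\<integral>s. (if H s powr M > sqrt (real (Suc n)) then H s powr M else 0) \<partial>lborel) + ennreal (1 / sqrt (real (Suc n)))
      = ennreal ((\<integral>s. (if H s powr M > sqrt (real (Suc n)) then H s powr M else 0) \<partial>lborel) + 1 / sqrt (real (Suc n)))"
      by (intro ennreal_plus[symmetric] integral_nonneg_AE) auto
    finally show ?thesis .
  qed
  \<comment> \<open>With \<open>M = p/(r - 1)\<close>, the inequality
    \<open>(a + b) powr M \<le> 2 powr M * (a powr M + b powr M)\<close> bounds the integral of the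
    majorant by \<open>2 powr M * tail_mass n\<close>; the bound given here is its
    \<open>M\<close>-th root.\<close>
  interpret D: duhamel_data p r T "2 * tail_mass n powr ((r - 1) / p)" "\<lambda>s x. cutoff n t s x - cutoff m t s x" H'
  proof unfold_locales
    show "(\<lambda>(s, x). cutoff n t s x - cutoff m t s x) \<in> borel_measurable (borel \<Otimes>\<^sub>M borel)"
      using cm[of n] cm[of m] by (simp add: case_prod_beta)
    show "H' s = 0" if "s \<notin> {0<..<T}" for s
      using Hout[OF that] tail_norm_nonneg[of n s] by (simp add: H'_def)
    show "AE s in lborel. s \<in> {0<..<T} \<longrightarrow> Lq_int (r / (r - 1)) (\<lambda>x. cutoff n t s x - cutoff m t s x) \<le> ennreal (H' s powr (r / (r - 1)))"
      using Hf tail_norm_bound[of n]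
    proof eventually_elim
      case (elim s)
      define q where "q = r / (r - 1)"
      have q: "q > 0" using pr by (simp add: q_def)
      show ?case unfolding q_def[symmetric]
      proof
        assume s: "s \<in> {0<..<T}"
        have inv: "1 / real (Suc m) \<le> 1 / real (Suc n)" using nm by (simp add: frac_le)
        have rn: "real n \<le> real m" using nm by simp
        consider "s \<in> I" | "s < t - 1 / real (Suc n)" | "s > t" unfolding I_def by fastforce
        thus "Lq_int q (\<lambda>x. cutoff n t s x - cutoff m t s x) \<le> ennreal (H' s powr q)"
        proof cases
          case 1
          have "Lq_int q (\<lambda>x. cutoff n t s x - cutoff m t s x) \<le> Lq_int q (f s)"
            unfolding Lq_int_def using q by (intro nn_integral_mono ennreal_leI powr_mono2) (auto simp: cutoff_def)
          also have "\<dots> \<le> ennreal (H s powr q)" using elim s by (simp add: q_def)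
          also have "\<dots> \<le> ennreal (H' s powr q)"
            using 1 q H0[of s] tail_norm_nonneg[of n s] by (intro ennreal_leI powr_mono2) (auto simp: H'_def)
          finally show ?thesis .
        next
          case 2
          have "Lq_int q (\<lambda>x. cutoff n t s x - cutoff m t s x) \<le> Lq_int q (tail n s)"
            unfolding Lq_int_def using q 2 s inv rn
            by (intro nn_integral_mono ennreal_leI powr_mono2) (auto simp: cutoff_def tail_def)
          also have "\<dots> \<le> ennreal (tail_norm n s powr q)" using elim s by (simp add: q_def)
          also have "\<dots> \<le> ennreal (H' s powr q)"
            using q H0[of s] tail_norm_nonneg[of n s] by (intro ennreal_leI powr_mono2) (auto simp: H'_def)
          finally show ?thesis .
        next
          case 3
          have "\<not> s < t - 1 / real (Suc k)" for k
          proof -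
            have "1 / real (Suc k) > 0" by simp
            thus ?thesis using 3 by linarith
          qed
          thus ?thesis using q by (simp add: cutoff_def Lq_int_def)
        qed
      qed
    qed
    have "(\<integral>\<^sup>+s. ennreal (H' s powr M) \<partial>lborel) \<le> (\<integral>\<^sup>+s. ennreal (2 powr M) * (ennreal (tail_norm n s powr M) + ennreal ((indicator I s * H s) powr M)) \<partial>lborel)"
    proof (rule nn_integral_mono)
      fix s
      let ?a = "tail_norm n s" and ?b = "indicator I s * H s"
      have ab: "?a \<ge> 0" "?b \<ge> 0" using tail_norm_nonneg[of n s] H0[of s] by auto
      have "(?a + ?b) powr M \<le> (2 * max ?a ?b) powr M" using M ab by (intro powr_mono2) auto
      also have "\<dots> = 2 powr M * max ?a ?b powr M" by (simp add: powr_mult)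
      also have "max ?a ?b powr M \<le> ?a powr M + ?b powr M" by (simp add: max_def)
      finally have "H' s powr M \<le> 2 powr M * (?a powr M + ?b powr M)" by (simp add: H'_def mult_left_mono)
      hence "ennreal (H' s powr M) \<le> ennreal (2 powr M * (?a powr M + ?b powr M))" by (rule ennreal_leI)
      thus "ennreal (H' s powr M) \<le> ennreal (2 powr M) * (ennreal (?a powr M) + ennreal (?b powr M))"
        by (simp add: ennreal_mult)
    qed
    also have "\<dots> = ennreal (2 powr M) * ((\<integral>\<^sup>+s. ennreal (tail_norm n s powr M) \<partial>lborel) + (\<integral>\<^sup>+s. ennreal ((indicator I s * H s) powr M) \<partial>lborel))"
      by (subst nn_integral_cmult, simp, subst nn_integral_add) auto
    also have "(\<integral>\<^sup>+s. ennreal (tail_norm n s powr M) \<partial>lborel) = ennreal (\<integral>s. tail_norm n s powr M \<partial>lborel)"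
      using tail_norm_integrable by (intro nn_integral_eq_integral) (auto simp: M_def)
    also have "ennreal (2 powr M) * (ennreal (\<integral>s. tail_norm n s powr M \<partial>lborel) + (\<integral>\<^sup>+s. ennreal ((indicator I s * H s) powr M) \<partial>lborel))
      \<le> ennreal (2 powr M) * (ennreal (\<integral>s. tail_norm n s powr M \<partial>lborel) + ennreal ((\<integral>s. (if H s powr M > sqrt (real (Suc n)) then H s powr M else 0) \<partial>lborel) + 1 / sqrt (real (Suc n))))"
      by (intro mult_left_mono add_left_mono int_I) auto
    also have "\<dots> = ennreal (2 powr M * tail_mass n)"
    proof -
      have i0: "0 \<le> (\<integral>s. (if H s powr M > sqrt (real (Suc n)) then H s powr M else 0) \<partial>lborel)"
        by (intro integral_nonneg_AE) auto
      have "ennreal (\<integral>s. tail_norm n s powr M \<partial>lborel) + ennreal ((\<integral>s. (if H s powr M > sqrt (real (Suc n)) then H s powr M else 0) \<partial>lborel) + 1 / sqrt (real (Suc n)))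
         = ennreal (tail_mass n)"
        unfolding tail_mass_def M_def[symmetric] using i0
        by (subst ennreal_plus[symmetric]) (auto intro!: integral_nonneg_AE add_nonneg_nonneg simp: add.assoc)
      thus ?thesis using tail_mass_nonneg by (simp add: ennreal_mult)
    qed
    also have "2 powr M * tail_mass n = (2 * tail_mass n powr ((r - 1) / p)) powr M"
      using pr tail_mass_nonneg[of n] by (simp add: powr_mult powr_powr M_def)
    finally show "(\<integral>\<^sup>+s. ennreal (H' s powr (p / (r - 1))) \<partial>lborel) \<le> ennreal ((2 * tail_mass n powr ((r - 1) / p)) powr (p / (r - 1)))"
      by (simp add: M_def)
  qed (use pr gam T H'0 in auto)
  show ?thesis
    by (rule D.lin_duhamel_L2[OF lin_duhamel_diff[OF cm cm approx_lin_duhamel approx_lin_duhamel] t])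
qed

text \<open>One subsequence converges in \<open>L^2\<close> at every \<open>t\<close>. In the weak
  identity the left sides converge by Cauchy-Schwarz, and the right sides by dominated convergence,
  with the full integrand as dominating function.\<close>

lemma exists_solution:
  "\<exists>g. (\<lambda>(t, x). g t x) \<in> borel_measurable (borel \<Otimes>\<^sub>M borel) \<and> (\<forall>t\<in>{0..T}. lin_duhamel f t (g t))"
proof -
  define \<beta> where "\<beta> n = key_const p r * T powr ((p - r) / p) * (2 * tail_mass n powr ((r - 1) / p))" for n
  have \<beta>0: "\<beta> n \<ge> 0" for n using key_const_pos[OF pr] by (simp add: \<beta>_def)
  have "(\<lambda>n. tail_mass n powr ((r - 1) / p)) \<longlonglongrightarrow> 0 powr ((r - 1) / p)"
    using pr tail_mass_nonneg by (intro tendsto_powr' tail_mass_tendsto tendsto_const) (auto intro!: always_eventually)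
  hence "\<beta> \<longlonglongrightarrow> key_const p r * T powr ((p - r) / p) * (2 * 0)"
    unfolding \<beta>_def[abs_def] by (intro tendsto_intros) simp
  hence "\<forall>k. \<exists>N. \<forall>n\<ge>N. \<beta> n < (1/4)^k"
    using \<beta>0 by (auto simp: LIMSEQ_iff)
  \<comment> \<open>A rate of \<open>(1/4)^k\<close> for the norms is \<open>(1/16)^k\<close> for
    their squares, as \<open>L2_fast_convergent\<close> demands.\<close>
  then obtain N where N: "\<And>k n. n \<ge> N k \<Longrightarrow> \<beta> n < (1/4)^k" by metis
  \<comment> \<open>Partial sums make the indices monotone while keeping them above
    \<open>N k\<close>; the summand \<open>k\<close> added in \<open>M\<close> makes them
    unbounded.\<close>
  define \<sigma> where "\<sigma> k = (\<Sum>i\<le>k. N i)" for k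
  have \<sigma>N: "\<sigma> k \<ge> N k" for k unfolding \<sigma>_def by (intro member_le_sum) auto
  have \<sigma>mono: "j \<le> k \<Longrightarrow> \<sigma> j \<le> \<sigma> k" for j k unfolding \<sigma>_def by (intro sum_mono2) auto
  define M where "M k = \<sigma> k + k" for k
  have Mmono: "j \<le> k \<Longrightarrow> M j \<le> M k" for j k using \<sigma>mono by (simp add: M_def add_mono)
  have Mk: "M k \<ge> k" for k by (simp add: M_def)
  define v where "v k t x = approx (M k) t x" for k t x
  have vm: "(\<lambda>z. v k (fst z) (snd z)) \<in> borel_measurable (borel \<Otimes>\<^sub>M borel)" for k
    using approx_measurable[of "M k"] by (simp add: v_def case_prod_beta)
  have vs [measurable]: "v k t \<in> borel_measurable borel" for k t
    using approx_lin_duhamel[of "M k" t] unfolding v_def[abs_def] lin_duhamel_def by simp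
  have vL: "Lq_int 2 (v k t) < \<infinity>" for k t
    using approx_lin_duhamel[of "M k" t] unfolding v_def[abs_def] lin_duhamel_def by simp
  have vd: "Lq_int 2 (\<lambda>x. v j t x - v k t x) \<le> ennreal ((1/16)^j)" if "t \<le> T" "j \<le> k" for j k t
  proof -
    have "Lq_int 2 (\<lambda>x. v j t x - v k t x) \<le> ennreal (\<beta> (M j) powr 2)"
      unfolding v_def \<beta>_def by (intro approx_diff_L2 that Mmono)
    also have "\<beta> (M j) powr 2 \<le> ((1/4)^j)^2"
      using \<beta>0[of "M j"] N[of j "M j"] \<sigma>N[of j] by (auto simp: M_def intro!: power_mono)
    also have "((1/4::real)^j)^2 = ((1/4)^2)^j" by (simp only: power_mult[symmetric] mult.commute)
    also have "\<dots> = (1/16)^j" by (simp add: power2_eq_square)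
    finally show ?thesis by (simp add: ennreal_leI)
  qed
  \<comment> \<open>The pointwise \<open>lim\<close> is jointly measurable; where the sequence
    diverges, for each \<open>t \<le> T\<close> a null set of points, its value is
    arbitrary.\<close>
  define g where "g t x = lim (\<lambda>k. v k t x)" for t x
  have gm: "(\<lambda>z. g (fst z) (snd z)) \<in> borel_measurable (borel \<Otimes>\<^sub>M borel)"
    unfolding g_def by (intro borel_measurable_lim_metric vm)
  have gs [measurable]: "g t \<in> borel_measurable borel" for t
    unfolding g_def[abs_def] by measurable
  have conv: "AE x in lborel. (\<lambda>k. v k t x) \<longlonglongrightarrow> g t x" if t: "t \<le> T" for t
  proof -
    have "AE x in lborel. convergent (\<lambda>k. v k t x)"
      by (intro L2_fast_convergent vs vd t) simp
    thus ?thesis by eventually_elim (simp add: g_def convergent_LIMSEQ_iff)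
  qed
  \<comment> \<open>Fatou's lemma passes to the limit in the later index of the Cauchy
    estimate.\<close>
  have gd: "Lq_int 2 (\<lambda>x. g t x - v k t x) \<le> ennreal ((1/16)^k)" if t: "t \<le> T" for t k
  proof -
    have "Lq_int 2 (\<lambda>x. g t x - v k t x) = (\<integral>\<^sup>+x. liminf (\<lambda>j. ennreal ((cmod (v j t x - v k t x))^2)) \<partial>lborel)"
      unfolding Lq_int_def
    proof (rule nn_integral_cong_AE)
      show "AE x in lborel. ennreal (cmod (g t x - v k t x) powr 2) = liminf (\<lambda>j. ennreal ((cmod (v j t x - v k t x))^2))"
        using conv[OF t]
      proof eventually_elim
        case (elim x)
        have "(\<lambda>j. ennreal ((cmod (v j t x - v k t x))^2)) \<longlonglongrightarrow> ennreal ((cmod (g t x - v k t x))^2)"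
          by (intro tendsto_intros tendsto_ennrealI elim)
        from lim_imp_Liminf[OF _ this] show ?case by simp
      qed
    qed
    also have "\<dots> \<le> liminf (\<lambda>j. (\<integral>\<^sup>+x. ennreal ((cmod (v j t x - v k t x))^2) \<partial>lborel))"
      by (rule nn_integral_liminf) measurable
    also have "\<dots> \<le> ennreal ((1/16)^k)"
    proof (rule Liminf_le)
      show "\<forall>\<^sub>F j in sequentially. (\<integral>\<^sup>+x. ennreal ((cmod (v j t x - v k t x))^2) \<partial>lborel) \<le> ennreal ((1/16)^k)"
        using eventually_ge_at_top[of k]
      proof eventually_elim
        case (elim j)
        from vd[OF t elim] show ?case by (simp add: Lq_int_def norm_minus_commute)
      qed
    qed simp
    finally show ?thesis .
  qed
  have "lin_duhamel f t (g t)" if t: "t \<in> {0..T}" for t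
    unfolding lin_duhamel_def
  proof (intro conjI allI impI)
    have tT: "t \<le> T" using t by simp
    show "g t \<in> borel_measurable borel" by (rule gs)
    have "Lq_int 2 (\<lambda>x. - v 0 t x) < \<infinity>" using vL[of 0 t] by (simp add: Lq_int_def)
    moreover have "Lq_int 2 (\<lambda>x. g t x - v 0 t x) < \<infinity>"
      using gd[OF tT, of 0] by (auto intro: order_le_less_trans)
    ultimately have "Lq_int 2 (\<lambda>x. (g t x - v 0 t x) - (- v 0 t x)) < \<infinity>"
      by (intro L2_diff[of "\<lambda>x. g t x - v 0 t x" "\<lambda>x. - v 0 t x"]; measurable)
    thus gL: "Lq_int 2 (g t) < \<infinity>" by simp
    fix \<phi> :: "real^'n \<Rightarrow> complex" assume tf: "test_fun \<phi>"
    note \<phi> = test_fun_bdd_supp[OF tf]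
    note [measurable] = bdd_supp_measurable[OF \<phi>]
    define b where "b = sqrt (enn2real (Lq_int 2 \<phi>))"
    have b: "b \<ge> 0" "Lq_int 2 \<phi> \<le> ennreal (b^2)"
      using Lq_int_finite_2[OF \<phi>] by (auto simp: b_def less_top[symmetric])
    define S where "S z = cnj (schr (fst z - t) \<phi> (snd z))" for z
    have Sm [measurable]: "S \<in> borel_measurable (borel \<Otimes>\<^sub>M borel)"
      unfolding S_def[abs_def] by (intro borel_measurable_cnj borel_measurable_schr_param) measurable
    define P where "P z = indicator {0<..<t} (fst z) *\<^sub>R (f (fst z) (snd z) * S z)" for z
    have Pm: "P \<in> borel_measurable (lborel \<Otimes>\<^sub>M lborel)"
      unfolding P_def[abs_def] measurable_lborel_pair by measurable
    \<comment> \<open>Here \<open>key_estimate\<close> yields absolute integrability at the given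
      \<open>t\<close>, without any exceptional set of times.\<close>
    have Pi: "integrable (lborel \<Otimes>\<^sub>M lborel) (\<lambda>(s, x). P (s, x))"
    proof (rule integrable_pairI)
      show "(\<lambda>(s, x). P (s, x)) \<in> borel_measurable (lborel \<Otimes>\<^sub>M lborel)" using Pm by (simp add: case_prod_beta)
      have "(\<integral>\<^sup>+s. (\<integral>\<^sup>+x. ennreal (cmod (P (s, x))) \<partial>lborel) \<partial>lborel) =
        (\<integral>\<^sup>+s. (\<integral>\<^sup>+x. indicator {0<..<t} s * ennreal (cmod (f s x) * cmod (schr (s - t) \<phi> x)) \<partial>lborel) \<partial>lborel)"
        by (intro nn_integral_cong) (auto simp: P_def S_def norm_mult indicator_def)
      also have "\<dots> \<le> ennreal (bound * b)" by (rule key_estimate[OF \<phi> tT b])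
      finally show "(\<integral>\<^sup>+s. (\<integral>\<^sup>+x. ennreal (cmod (P (s, x))) \<partial>lborel) \<partial>lborel) < \<infinity>"
        by (rule order_le_less_trans) simp
    qed
    have P1: "P (s, x) = f s x * cnj (schr (s - t) \<phi> x)" if "s \<in> {0<..<t}" for s x
      using that by (simp add: P_def S_def)
    have P2: "(\<integral>x. P (s, x) \<partial>lborel) = indicator {0<..<t} s *\<^sub>R (\<integral>x. f s x * cnj (schr (s - t) \<phi> x) \<partial>lborel)" for s
      by (cases "s \<in> {0<..<t}") (auto simp: P_def S_def)
    show "AE s in lborel. s \<in> {0<..<t} \<longrightarrow> integrable lborel (\<lambda>x. f s x * cnj (schr (s - t) \<phi> x))"
      using lborel_pair.AE_integrable_fst[OF Pi] by eventually_elim (auto simp: P1)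
    show "set_integrable lborel {0<..<t} (\<lambda>s. \<integral>x. f s x * cnj (schr (s - t) \<phi> x) \<partial>lborel)"
      unfolding set_integrable_def P2[symmetric] by (rule lborel_pair.integrable_fst[OF Pi])
    define Q where "Q k z = cutoff (M k) t (fst z) (snd z) * S z" for k z
    have Qi: "integrable (lborel \<Otimes>\<^sub>M lborel) (\<lambda>(s, x). Q k (s, x))" for k
      using bdd_supp_time_flow.pairing_integrable[OF cutoff_flow \<phi>, of "M k"] by (simp add: Q_def S_def)
    have Qeq: "(\<integral>x. v k t x * cnj (\<phi> x) \<partial>lborel) = (\<integral>z. Q k z \<partial>(lborel \<Otimes>\<^sub>M lborel))" for k
    proof -
      have "(\<integral>x. v k t x * cnj (\<phi> x) \<partial>lborel) = (\<integral>s. (\<integral>x. cutoff (M k) t s x * cnj (schr (s - t) \<phi> x) \<partial>lborel) \<partial>lborel)"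
        unfolding v_def approx_def by (rule bdd_supp_time_flow.pairing_eq[OF cutoff_flow \<phi>])
      also have "\<dots> = (\<integral>z. Q k z \<partial>(lborel \<Otimes>\<^sub>M lborel))"
        using lborel_pair.integral_fst[OF Qi[of k]] by (simp add: Q_def S_def case_prod_unfold)
      finally show ?thesis .
    qed
    have "(\<lambda>k. \<integral>z. Q k z \<partial>(lborel \<Otimes>\<^sub>M lborel)) \<longlonglongrightarrow> (\<integral>z. P z \<partial>(lborel \<Otimes>\<^sub>M lborel))"
    proof (rule integral_dominated_convergence[where w = "\<lambda>z. cmod (P z)"])
      show "P \<in> borel_measurable (lborel \<Otimes>\<^sub>M lborel)" by (rule Pm)
      show "Q k \<in> borel_measurable (lborel \<Otimes>\<^sub>M lborel)" for k
        using borel_measurable_integrable[OF Qi[of k]] by (simp add: case_prod_beta)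
      show "integrable (lborel \<Otimes>\<^sub>M lborel) (\<lambda>z. cmod (P z))"
        using integrable_norm[OF Pi] by (simp add: case_prod_beta)
      show "AE z in lborel \<Otimes>\<^sub>M lborel. (\<lambda>k. Q k z) \<longlonglongrightarrow> P z"
      proof (intro AE_I2 tendsto_eventually)
        fix z :: "real \<times> (real^'n)"
        show "\<forall>\<^sub>F k in sequentially. Q k z = P z"
        proof (cases "fst z \<in> {0<..<t}")
          case True
          obtain n1 where n1: "max (cmod (f (fst z) (snd z))) (norm (snd z)) \<le> real n1" using real_arch_simple by blast
          obtain n2 where n2: "1 / real (Suc n2) < t - fst z" using True nat_approx_posE[of "t - fst z"] by auto
          show ?thesis
            using eventually_ge_at_top[of "max n1 n2"]
          proof eventually_elim
            case (elim k)
            have "real n1 \<le> real (M k)" "n2 \<le> M k" using elim Mk[of k] by auto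
            moreover from this(2) have "1 / real (Suc (M k)) \<le> 1 / real (Suc n2)" by (simp add: frac_le)
            ultimately have "cutoff (M k) t (fst z) (snd z) = f (fst z) (snd z)"
              using n1 n2 True by (simp add: cutoff_def)
            thus ?case using True by (simp add: Q_def P_def)
          qed
        next
          case False
          have "\<not> (0 < fst z \<and> fst z < t - 1 / real (Suc n))" for n
          proof -
            have "1 / real (Suc n) > 0" by simp
            thus ?thesis using False unfolding greaterThanLessThan_iff by linarith
          qed
          hence "cutoff n t (fst z) (snd z) = 0" for n by (auto simp: cutoff_def)
          thus ?thesis using False by (simp add: Q_def P_def)
        qed
      qed
      show "AE z in lborel \<Otimes>\<^sub>M lborel. norm (Q k z) \<le> cmod (P z)" for k
      proof (intro AE_I2)
        fix z :: "real \<times> (real^'n)"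
        have "1 / real (Suc (M k)) > 0" by simp
        hence "cutoff (M k) t (fst z) (snd z) = 0 \<or> (fst z \<in> {0<..<t} \<and> cutoff (M k) t (fst z) (snd z) = f (fst z) (snd z))"
          unfolding cutoff_def greaterThanLessThan_iff by (smt (verit))
        thus "norm (Q k z) \<le> cmod (P z)" by (auto simp: Q_def P_def)
      qed
    qed
    hence L1: "(\<lambda>k. \<integral>x. v k t x * cnj (\<phi> x) \<partial>lborel) \<longlonglongrightarrow> (\<integral>z. P z \<partial>(lborel \<Otimes>\<^sub>M lborel))"
      unfolding Qeq .
    have L2: "(\<lambda>k. \<integral>x. v k t x * cnj (\<phi> x) \<partial>lborel) \<longlonglongrightarrow> (\<integral>x. g t x * cnj (\<phi> x) \<partial>lborel)"
    proof -
      have "cmod ((\<integral>x. v k t x * cnj (\<phi> x) \<partial>lborel) - (\<integral>x. g t x * cnj (\<phi> x) \<partial>lborel)) \<le> (1/4)^k * b" for k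
      proof -
        have gvL: "Lq_int 2 (\<lambda>x. g t x - v k t x) < \<infinity>" using gd[OF tT, of k] by (auto intro: order_le_less_trans)
        have "(\<integral>x. g t x * cnj (\<phi> x) \<partial>lborel) - (\<integral>x. v k t x * cnj (\<phi> x) \<partial>lborel) = (\<integral>x. (g t x - v k t x) * cnj (\<phi> x) \<partial>lborel)"
          using integrable_L2_mult[OF gs bdd_supp_measurable[OF \<phi>] gL Lq_int_finite_2[OF \<phi>]]
            integrable_L2_mult[OF vs bdd_supp_measurable[OF \<phi>] vL Lq_int_finite_2[OF \<phi>]]
          by (simp add: left_diff_distrib)
        hence "cmod ((\<integral>x. v k t x * cnj (\<phi> x) \<partial>lborel) - (\<integral>x. g t x * cnj (\<phi> x) \<partial>lborel)) = cmod (\<integral>x. (g t x - v k t x) * cnj (\<phi> x) \<partial>lborel)"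
          by (simp add: norm_minus_commute)
        also have "ennreal \<dots> \<le> (\<integral>\<^sup>+x. ennreal (cmod (g t x - v k t x) * cmod (\<phi> x)) \<partial>lborel)"
          using integral_norm_bound_ennreal[OF integrable_L2_mult[OF _ bdd_supp_measurable[OF \<phi>] gvL Lq_int_finite_2[OF \<phi>]]]
          by (simp add: norm_mult)
        also have "\<dots> \<le> ennreal ((1/4)^k * b)"
        proof (rule nn_Holder[where s = 2 and t = 2])
          have "(1/16::real)^k = ((1/4)^k) powr 2" by (simp add: power_mult[symmetric] mult.commute[of k]) (simp add: power_mult power2_eq_square)
          thus "(\<integral>\<^sup>+x. ennreal (cmod (g t x - v k t x) powr 2) \<partial>lborel) \<le> ennreal (((1/4)^k) powr 2)"
            using gd[OF tT, of k] by (simp add: Lq_int_def)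
          show "(\<integral>\<^sup>+x. ennreal (cmod (\<phi> x) powr 2) \<partial>lborel) \<le> ennreal (b powr 2)"
            using b by (simp add: Lq_int_def)
        qed (use b in auto)
        finally show ?thesis using b by (subst (asm) ennreal_le_iff) auto
      qed
      note le = this
      have "(\<lambda>k. (1/4)^k * b) \<longlonglongrightarrow> 0 * b"
        by (intro tendsto_mult LIMSEQ_power_zero tendsto_const) simp
      hence "(\<lambda>k. (1/4)^k * b) \<longlonglongrightarrow> 0" by simp
      hence "(\<lambda>k. (\<integral>x. v k t x * cnj (\<phi> x) \<partial>lborel) - (\<integral>x. g t x * cnj (\<phi> x) \<partial>lborel)) \<longlonglongrightarrow> 0"
        by (rule Lim_null_comparison[OF always_eventually[OF allI[OF le]]])
      thus ?thesis by (rule LIM_zero_cancel)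
    qed
    have "(\<integral>x. g t x * cnj (\<phi> x) \<partial>lborel) = (\<integral>z. P z \<partial>(lborel \<Otimes>\<^sub>M lborel))"
      by (rule LIMSEQ_unique[OF L2 L1])
    also have "\<dots> = (\<integral>s. (\<integral>x. P (s, x) \<partial>lborel) \<partial>lborel)"
      using lborel_pair.integral_fst[OF Pi] by simp
    finally show "(\<integral>x. g t x * cnj (\<phi> x) \<partial>lborel) = (LINT s:{0<..<t}|lborel. (\<integral>x. f s x * cnj (schr (s - t) \<phi> x) \<partial>lborel))"
      unfolding set_lebesgue_integral_def P2 .
  qed
  thus ?thesis using gm by (intro exI[of _ g]) (auto simp: case_prod_beta)
qed

end

section \<open>Mixed norms and the truncated nonlinearity\<close>

text \<open>Having \<open>L^q\<close> norm at most \<open>a\<close>, as a predicate. It composes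
  under sums, powers and products without roots or finiteness conditions, and serves both the space
  and the time variable.\<close>

definition Lnorm_le :: "'a measure \<Rightarrow> real \<Rightarrow> ('a \<Rightarrow> real) \<Rightarrow> real \<Rightarrow> bool" where
  "Lnorm_le M q F a \<longleftrightarrow> F \<in> borel_measurable M \<and> (\<forall>x. 0 \<le> F x) \<and> 0 \<le> a \<and> (\<integral>\<^sup>+x. ennreal (F x powr q) \<partial>M) \<le> ennreal (a powr q)"

lemma Lnorm_le_add:
  assumes "Lnorm_le M q F a" "Lnorm_le M q G b" "q \<ge> 1"
  shows "Lnorm_le M q (\<lambda>x. F x + G x) (a + b)"
  using assms nn_Minkowski[of F M G q a b] by (auto simp: Lnorm_le_def)

lemma Lnorm_le_indicator:
  assumes "Lnorm_le M q F a"
  shows "(\<integral>\<^sup>+x. indicator S x * ennreal (F x powr q) \<partial>M) \<le> ennreal (a powr q)"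
proof -
  have "(\<integral>\<^sup>+x. indicator S x * ennreal (F x powr q) \<partial>M) \<le> (\<integral>\<^sup>+x. ennreal (F x powr q) \<partial>M)"
    by (rule nn_integral_mono) (simp add: indicator_def)
  thus ?thesis using assms unfolding Lnorm_le_def by (meson order_trans)
qed

lemma Lnorm_le_cmult:
  assumes "Lnorm_le M q F a" "c \<ge> 0"
  shows "Lnorm_le M q (\<lambda>x. c * F x) (c * a)"
proof -
  have "(\<integral>\<^sup>+x. ennreal ((c * F x) powr q) \<partial>M) = ennreal (c powr q) * (\<integral>\<^sup>+x. ennreal (F x powr q) \<partial>M)"
    using assms by (subst nn_integral_cmult[symmetric]) (auto simp: Lnorm_le_def powr_mult ennreal_mult)
  also have "\<dots> \<le> ennreal (c powr q) * ennreal (a powr q)"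
    using assms by (intro mult_left_mono) (auto simp: Lnorm_le_def)
  finally show ?thesis using assms by (auto simp: Lnorm_le_def powr_mult ennreal_mult)
qed

lemma Lnorm_le_powr:
  assumes "Lnorm_le M P F a" "b > 0"
  shows "Lnorm_le M (P / b) (\<lambda>x. F x powr b) (a powr b)"
  using assms by (auto simp: Lnorm_le_def powr_powr)

lemma Lnorm_le_mult:
  assumes F: "Lnorm_le M q1 F a" and G: "Lnorm_le M q2 G b" and q: "q > 0" "q1 > q" "q2 > q" "q / q1 + q / q2 = 1"
  shows "Lnorm_le M q (\<lambda>x. F x * G x) (a * b)"
proof -
  have "(\<integral>\<^sup>+x. ennreal (F x powr q * G x powr q) \<partial>M) \<le> ennreal (a powr q * b powr q)"
    by (rule nn_Holder[where s = "q1 / q" and t = "q2 / q"])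
       (use F G q in \<open>auto simp: Lnorm_le_def powr_powr\<close>)
  thus ?thesis using F G by (auto simp: Lnorm_le_def powr_mult)
qed

text \<open>Applied twice in the difference estimate: in space with exponent \<open>r\<close>, and
  to the resulting norms in time with exponent \<open>p\<close>. The Hoelder exponents are
  \<open>P/(\<alpha> - 1)\<close> and \<open>P\<close>, which combine to
  \<open>P/\<alpha>\<close>.\<close>

lemma Lnorm_le_nonlin:
  assumes U: "Lnorm_le M P U1 a1" "Lnorm_le M P U2 a2" and W: "Lnorm_le M P W b" and \<alpha>: "1 < \<alpha>" "\<alpha> \<le> P" and c: "c \<ge> 0"
  shows "Lnorm_le M (P / \<alpha>) (\<lambda>x. c * (U1 x powr \<alpha> + U2 x powr \<alpha>) + \<alpha> * ((U1 x powr (\<alpha> - 1) + U2 x powr (\<alpha> - 1)) * W x))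
     (c * (a1 powr \<alpha> + a2 powr \<alpha>) + \<alpha> * ((a1 powr (\<alpha> - 1) + a2 powr (\<alpha> - 1)) * b))"
proof -
  have q: "P / \<alpha> \<ge> 1" using \<alpha> by simp
  have 1: "Lnorm_le M (P / \<alpha>) (\<lambda>x. U x powr (\<alpha> - 1) * W x) (a powr (\<alpha> - 1) * b)" if "Lnorm_le M P U a" for U a
  proof (rule Lnorm_le_mult[OF Lnorm_le_powr[OF that] W])
    show "P / \<alpha> / (P / (\<alpha> - 1)) + P / \<alpha> / P = 1" using \<alpha> by (simp add: field_simps)
    show "P / \<alpha> < P / (\<alpha> - 1)" "P / \<alpha> < P" using \<alpha> by (auto simp: field_simps)
  qed (use \<alpha> in auto)
  show ?thesis
    unfolding distrib_right
    using \<alpha> by (intro Lnorm_le_add Lnorm_le_cmult 1 Lnorm_le_powr U W q c) auto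
qed

lemma Lnorm_le_cmod:
  fixes f :: "real^'n \<Rightarrow> complex"
  assumes "f \<in> borel_measurable borel" "Lq_int q f < \<infinity>" "q > 0"
  shows "Lnorm_le lborel q (\<lambda>x. cmod (f x)) (Lq_norm q f)"
  using assms unfolding Lnorm_le_def Lq_norm_def
  by (auto simp: powr_powr less_top[symmetric] Lq_int_def[symmetric])

lemma Lnorm_le_Lq:
  fixes f :: "real^'n \<Rightarrow> complex"
  assumes L: "Lnorm_le lborel q F a" and le: "\<And>x. cmod (f x) \<le> F x" and q: "q > 0"
  shows "Lq_int q f \<le> ennreal (a powr q)" "Lq_norm q f \<le> a"
proof -
  have "Lq_int q f \<le> (\<integral>\<^sup>+x. ennreal (F x powr q) \<partial>lborel)"
    unfolding Lq_int_def using le q by (intro nn_integral_mono ennreal_leI powr_mono2) auto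
  also have "\<dots> \<le> ennreal (a powr q)" using L by (simp add: Lnorm_le_def)
  finally show 1: "Lq_int q f \<le> ennreal (a powr q)" .
  have "enn2real (Lq_int q f) \<le> a powr q" using 1 by (intro enn2real_leI) auto
  hence "Lq_norm q f \<le> (a powr q) powr (1 / q)" unfolding Lq_norm_def using q by (intro powr_mono2) auto
  thus "Lq_norm q f \<le> a" using q L by (simp add: powr_powr Lnorm_le_def)
qed

lemma Lq_norm_nonneg: "Lq_norm q f \<ge> 0"
  by (simp add: Lq_norm_def)

lemma Lq_diff:
  fixes f g :: "real^'n \<Rightarrow> complex"
  assumes "f \<in> borel_measurable borel" "g \<in> borel_measurable borel" "Lq_int q f < \<infinity>" "Lq_int q g < \<infinity>" "q \<ge> 1"
  shows "Lq_int q (\<lambda>x. f x - g x) < \<infinity>" "Lq_norm q (\<lambda>x. f x - g x) \<le> Lq_norm q f + Lq_norm q g"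
    "Lq_norm q f \<le> Lq_norm q g + Lq_norm q (\<lambda>x. f x - g x)"
proof -
  have q: "q > 0" using assms by simp
  have S: "Lnorm_le lborel q (\<lambda>x. cmod (f x) + cmod (g x)) (Lq_norm q f + Lq_norm q g)"
    by (intro Lnorm_le_add Lnorm_le_cmod assms q)
  have le: "cmod (f x - g x) \<le> cmod (f x) + cmod (g x)" for x by (rule norm_triangle_ineq4)
  show 1: "Lq_int q (\<lambda>x. f x - g x) < \<infinity>"
    using Lnorm_le_Lq(1)[OF S le q] by (rule order_le_less_trans) simp
  show "Lq_norm q (\<lambda>x. f x - g x) \<le> Lq_norm q f + Lq_norm q g" by (rule Lnorm_le_Lq(2)[OF S le q])
  have "Lnorm_le lborel q (\<lambda>x. cmod (g x) + cmod (f x - g x)) (Lq_norm q g + Lq_norm q (\<lambda>x. f x - g x))"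
    using assms(1,2) by (intro Lnorm_le_add Lnorm_le_cmod assms q 1) auto
  moreover have "cmod (f x) \<le> cmod (g x) + cmod (f x - g x)" for x
    using norm_triangle_ineq[of "g x" "f x - g x"] by simp
  ultimately show "Lq_norm q f \<le> Lq_norm q g + Lq_norm q (\<lambda>x. f x - g x)" by (rule Lnorm_le_Lq(2)[OF _ _ q])
qed

section \<open>Mixed norms on growing time intervals\<close>

definition Linf2_set :: "real \<Rightarrow> (real \<Rightarrow> real^'n \<Rightarrow> complex) \<Rightarrow> real set" where
  "Linf2_set T u = {C. 0 \<le> C \<and> (AE t in lborel. t \<in> {0<..<T} \<longrightarrow> Lq_norm 2 (u t) \<le> C)}"

lemma Linf2_norm_eq: "Linf2_norm T u = Inf (Linf2_set T u)"
  by (simp add: Linf2_norm_def Linf2_set_def)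

lemma Linf2_bdd: "bdd_below (Linf2_set T u)"
  by (rule bdd_belowI[of _ 0]) (auto simp: Linf2_set_def)

lemma Linf2_norm_le: "C \<in> Linf2_set T u \<Longrightarrow> Linf2_norm T u \<le> C"
  unfolding Linf2_norm_eq by (intro cInf_lower Linf2_bdd)

lemma in_LL_measurable: "in_LL p r T u \<Longrightarrow> case_prod u \<in> borel_measurable (borel \<Otimes>\<^sub>M borel)"
  by (simp add: in_LL_def measurable_lborel_pair)

lemma in_LL_mono: "in_LL p r T u \<Longrightarrow> t \<le> T \<Longrightarrow> in_LL p r t u"
proof -
  assume u: "in_LL p r T u" and t: "t \<le> T"
  have "(\<integral>\<^sup>+s\<in>{0<..<t}. ennreal (Lq_norm r (u s) powr p) \<partial>lborel) \<le> (\<integral>\<^sup>+s\<in>{0<..<T}. ennreal (Lq_norm r (u s) powr p) \<partial>lborel)"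
    using t by (intro nn_integral_mono) (auto simp: indicator_def)
  also have "\<dots> < \<infinity>" using u by (simp add: in_LL_def)
  finally have i: "(\<integral>\<^sup>+s\<in>{0<..<t}. ennreal (Lq_norm r (u s) powr p) \<partial>lborel) < \<infinity>" .
  obtain C where "AE s in lborel. s \<in> {0<..<T} \<longrightarrow> Lq_int 2 (u s) \<le> ennreal C" using u by (auto simp: in_LL_def)
  hence "AE s in lborel. s \<in> {0<..<t} \<longrightarrow> Lq_int 2 (u s) \<le> ennreal C" by eventually_elim (use t in auto)
  moreover have "AE s in lborel. s \<in> {0<..<T} \<longrightarrow> Lq_int r (u s) < \<infinity>" using u by (simp add: in_LL_def)
  hence "AE s in lborel. s \<in> {0<..<t} \<longrightarrow> Lq_int r (u s) < \<infinity>" by eventually_elim (use t in auto)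
  ultimately show "in_LL p r t u" using u i unfolding in_LL_def by blast
qed

text \<open>Makes the \<open>Inf\<close> in \<open>Linf2_norm\<close> a genuine infimum, since that
  of the empty set would carry no information.\<close>

lemma in_LL_Linf2_set:
  assumes "in_LL p r T u" shows "Linf2_set T u \<noteq> {}"
proof -
  obtain C where C: "AE s in lborel. s \<in> {0<..<T} \<longrightarrow> Lq_int 2 (u s) \<le> ennreal C" using assms by (auto simp: in_LL_def)
  have "AE s in lborel. s \<in> {0<..<T} \<longrightarrow> Lq_norm 2 (u s) \<le> (max C 0) powr (1 / 2)"
    using C
  proof eventually_elim
    case (elim s)
    show ?case
    proof
      assume "s \<in> {0<..<T}"
      hence "Lq_int 2 (u s) \<le> ennreal (max C 0)" using elim by (auto intro: order_trans ennreal_leI)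
      hence "enn2real (Lq_int 2 (u s)) \<le> max C 0" by (intro enn2real_leI) auto
      thus "Lq_norm 2 (u s) \<le> (max C 0) powr (1 / 2)" unfolding Lq_norm_def by (intro powr_mono2) auto
    qed
  qed
  hence "(max C 0) powr (1 / 2) \<in> Linf2_set T u" by (simp add: Linf2_set_def)
  thus ?thesis by blast
qed

lemma Linf2_norm_nonneg: "in_LL p r T u \<Longrightarrow> Linf2_norm T u \<ge> 0"
  unfolding Linf2_norm_eq by (intro cInf_greatest in_LL_Linf2_set) (auto simp: Linf2_set_def)

lemma Lpr_norm_nonneg: "Lpr_norm p r T u \<ge> 0"
  by (simp add: Lpr_norm_def)

lemma LL_norm_nonneg: "in_LL p r T u \<Longrightarrow> LL_norm p r T u \<ge> 0"
  by (simp add: LL_norm_def Linf2_norm_nonneg Lpr_norm_nonneg)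

text \<open>Monotonicity in time makes the argument of the cut-off function measurable, and it makes
  the times with norm at most \<open>K\<close> an initial interval.\<close>

lemma LL_norm_mono:
  assumes u: "in_LL p r T u" and st: "s \<le> t" "t \<le> T" and p: "p > 0"
  shows "LL_norm p r s u \<le> LL_norm p r t u"
proof -
  have ut: "in_LL p r t u" by (rule in_LL_mono[OF u st(2)])
  have "Linf2_norm s u \<le> Linf2_norm t u"
    unfolding Linf2_norm_eq
  proof (rule cInf_superset_mono[OF in_LL_Linf2_set[OF ut] Linf2_bdd])
    show "Linf2_set t u \<subseteq> Linf2_set s u"
      unfolding Linf2_set_def using st(1) by (auto elim!: eventually_mono)
  qed
  moreover have "Lpr_norm p r s u \<le> Lpr_norm p r t u"
    unfolding Lpr_norm_def
  proof (intro powr_mono2 enn2real_mono)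
    show "(\<integral>\<^sup>+s\<in>{0<..<s}. ennreal (Lq_norm r (u s) powr p) \<partial>lborel) \<le> (\<integral>\<^sup>+s\<in>{0<..<t}. ennreal (Lq_norm r (u s) powr p) \<partial>lborel)"
      using st by (intro nn_integral_mono) (auto simp: indicator_def)
    show "(\<integral>\<^sup>+s\<in>{0<..<t}. ennreal (Lq_norm r (u s) powr p) \<partial>lborel) < \<top>" using ut by (simp add: in_LL_def)
  qed (use p in auto)
  ultimately show ?thesis by (simp add: LL_norm_def)
qed

lemma Lq_norm_measurable:
  fixes u :: "real \<Rightarrow> real^'n \<Rightarrow> complex"
  assumes "case_prod u \<in> borel_measurable (borel \<Otimes>\<^sub>M borel)"
  shows "(\<lambda>s. Lq_norm q (u s)) \<in> borel_measurable borel"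
proof -
  have [measurable]: "(\<lambda>z. u (fst z) (snd z)) \<in> borel_measurable (borel \<Otimes>\<^sub>M borel)"
    using assms by (simp add: case_prod_beta)
  have "(\<lambda>s. Lq_int q (u s)) \<in> borel_measurable borel"
    unfolding Lq_int_def
    by (intro lborel.borel_measurable_nn_integral) (simp add: case_prod_beta cong: measurable_cong_sets sets_pair_measure_cong)
  thus ?thesis unfolding Lq_norm_def by measurable
qed

lemma Lnorm_le_Lpr:
  fixes u :: "real \<Rightarrow> real^'n \<Rightarrow> complex"
  assumes u: "in_LL p r T u" and p: "p > 0"
  shows "Lnorm_le lborel p (\<lambda>s. indicator {0<..<T} s * Lq_norm r (u s)) (Lpr_norm p r T u)"
  unfolding Lnorm_le_def
proof (intro conjI allI)
  have [measurable]: "(\<lambda>s. Lq_norm r (u s)) \<in> borel_measurable borel"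
    by (rule Lq_norm_measurable[OF in_LL_measurable[OF u]])
  show "(\<lambda>s. indicator {0<..<T} s * Lq_norm r (u s)) \<in> borel_measurable lborel" by measurable
  have "(\<integral>\<^sup>+s. ennreal ((indicator {0<..<T} s * Lq_norm r (u s)) powr p) \<partial>lborel) = (\<integral>\<^sup>+s\<in>{0<..<T}. ennreal (Lq_norm r (u s) powr p) \<partial>lborel)"
    by (intro nn_integral_cong) (auto simp: indicator_def)
  also have "\<dots> = ennreal (Lpr_norm p r T u powr p)"
    using u p by (simp add: Lpr_norm_def powr_powr in_LL_def less_top[symmetric])
  finally show "(\<integral>\<^sup>+s. ennreal ((indicator {0<..<T} s * Lq_norm r (u s)) powr p) \<partial>lborel) \<le> ennreal (Lpr_norm p r T u powr p)" by simp
qed (auto simp: Lq_norm_nonneg Lpr_norm_nonneg)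

lemma Lpr_norm_le:
  assumes Y: "AE s in lborel. s \<in> {0<..<T} \<longrightarrow> Lq_norm r (u s) \<le> Y s" and p: "p > 0" and B: "B \<ge> 0"
    and YB: "(\<integral>\<^sup>+s. indicator {0<..<T} s * ennreal (Y s powr p) \<partial>lborel) \<le> ennreal (B powr p)"
  shows "(\<integral>\<^sup>+s\<in>{0<..<T}. ennreal (Lq_norm r (u s) powr p) \<partial>lborel) < \<infinity>" "Lpr_norm p r T u \<le> B"
proof -
  have "(\<integral>\<^sup>+s\<in>{0<..<T}. ennreal (Lq_norm r (u s) powr p) \<partial>lborel) \<le> (\<integral>\<^sup>+s. indicator {0<..<T} s * ennreal (Y s powr p) \<partial>lborel)"
  proof (rule nn_integral_mono_AE)
    show "AE s in lborel. ennreal (Lq_norm r (u s) powr p) * indicator {0<..<T} s \<le> indicator {0<..<T} s * ennreal (Y s powr p)"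
      using Y by eventually_elim (use p in \<open>auto simp: indicator_def Lq_norm_nonneg intro!: ennreal_leI powr_mono2\<close>)
  qed
  also note YB
  finally have le: "(\<integral>\<^sup>+s\<in>{0<..<T}. ennreal (Lq_norm r (u s) powr p) \<partial>lborel) \<le> ennreal (B powr p)" .
  thus "(\<integral>\<^sup>+s\<in>{0<..<T}. ennreal (Lq_norm r (u s) powr p) \<partial>lborel) < \<infinity>" by (rule order_le_less_trans) simp
  have "Lpr_norm p r T u \<le> (B powr p) powr (1 / p)"
    unfolding Lpr_norm_def using le p by (intro powr_mono2 enn2real_leI) auto
  thus "Lpr_norm p r T u \<le> B" using p B by (simp add: powr_powr)
qed

lemma in_LL_AE_finite:
  assumes "in_LL p r T u"
  shows "AE s in lborel. s \<in> {0<..<T} \<longrightarrow> Lq_int 2 (u s) < \<infinity> \<and> Lq_int r (u s) < \<infinity>"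
proof -
  obtain C where "AE s in lborel. s \<in> {0<..<T} \<longrightarrow> Lq_int 2 (u s) \<le> ennreal C" using assms by (auto simp: in_LL_def)
  moreover have "AE s in lborel. s \<in> {0<..<T} \<longrightarrow> Lq_int r (u s) < \<infinity>" using assms by (simp add: in_LL_def)
  ultimately show ?thesis by eventually_elim (auto intro: order_le_less_trans)
qed

lemma in_LL_diff:
  fixes u1 u2 :: "real \<Rightarrow> real^'n \<Rightarrow> complex"
  assumes u1: "in_LL p r T u1" and u2: "in_LL p r T u2" and pr: "p \<ge> 1" "r \<ge> 1"
  shows "in_LL p r T (\<lambda>s x. u1 s x - u2 s x)"
    "LL_norm p r T u1 \<le> LL_norm p r T u2 + LL_norm p r T (\<lambda>s x. u1 s x - u2 s x)"
proof -
  let ?d = "\<lambda>s x. u1 s x - u2 s x"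
  have p: "p > 0" using pr by simp
  note m1 = in_LL_measurable[OF u1] and m2 = in_LL_measurable[OF u2]
  note s1 = measurable_slice[OF m1] and s2 = measurable_slice[OF m2]
  have md: "case_prod ?d \<in> borel_measurable (borel \<Otimes>\<^sub>M borel)" using m1 m2 by (simp add: case_prod_beta)
  have fin: "AE s in lborel. s \<in> {0<..<T} \<longrightarrow> Lq_int 2 (u1 s) < \<infinity> \<and> Lq_int r (u1 s) < \<infinity> \<and> Lq_int 2 (u2 s) < \<infinity> \<and> Lq_int r (u2 s) < \<infinity>"
    using in_LL_AE_finite[OF u1] in_LL_AE_finite[OF u2] by eventually_elim auto
  obtain C1 where C1: "C1 \<in> Linf2_set T u1" using in_LL_Linf2_set[OF u1] by blast
  obtain C2 where C2: "C2 \<in> Linf2_set T u2" using in_LL_Linf2_set[OF u2] by blast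
  have "AE s in lborel. s \<in> {0<..<T} \<longrightarrow> Lq_int 2 (?d s) \<le> ennreal ((C1 + C2) powr 2)"
    using fin C1[unfolded Linf2_set_def, simplified, THEN conjunct2] C2[unfolded Linf2_set_def, simplified, THEN conjunct2]
  proof eventually_elim
    case (elim s)
    show ?case
    proof
      assume s: "s \<in> {0<..<T}"
      have d: "Lq_int 2 (?d s) < \<infinity>" "Lq_norm 2 (?d s) \<le> Lq_norm 2 (u1 s) + Lq_norm 2 (u2 s)"
        using Lq_diff[OF s1[of s] s2[of s], of 2] elim s by auto
      have "Lnorm_le lborel 2 (\<lambda>x. cmod (?d s x)) (Lq_norm 2 (?d s))"
        using s1 s2 d(1) by (intro Lnorm_le_cmod) auto
      hence "Lq_int 2 (?d s) \<le> ennreal (Lq_norm 2 (?d s) powr 2)" unfolding Lnorm_le_def Lq_int_def by blast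
      also have "\<dots> \<le> ennreal ((C1 + C2) powr 2)"
      proof (intro ennreal_leI powr_mono2)
        show "Lq_norm 2 (?d s) \<le> C1 + C2" using d(2) elim s by auto
      qed (auto simp: Lq_norm_nonneg)
      finally show "Lq_int 2 (?d s) \<le> ennreal ((C1 + C2) powr 2)" .
    qed
  qed
  hence A: "\<exists>C. AE s in lborel. s \<in> {0<..<T} \<longrightarrow> Lq_int 2 (?d s) \<le> ennreal C" by blast
  have B: "AE s in lborel. s \<in> {0<..<T} \<longrightarrow> Lq_int r (?d s) < \<infinity>"
    using fin by eventually_elim (use Lq_diff(1)[OF s1 s2, of r] pr in auto)
  have "AE s in lborel. s \<in> {0<..<T} \<longrightarrow> Lq_norm r (?d s) \<le> indicator {0<..<T} s * Lq_norm r (u1 s) + indicator {0<..<T} s * Lq_norm r (u2 s)"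
    using fin by eventually_elim (use Lq_diff(2)[OF s1 s2, of r] pr in auto)
  moreover have L: "Lnorm_le lborel p (\<lambda>s. indicator {0<..<T} s * Lq_norm r (u1 s) + indicator {0<..<T} s * Lq_norm r (u2 s)) (Lpr_norm p r T u1 + Lpr_norm p r T u2)"
    by (intro Lnorm_le_add Lnorm_le_Lpr u1 u2 pr p)
  have "(\<integral>\<^sup>+s. indicator {0<..<T} s * ennreal ((indicator {0<..<T} s * Lq_norm r (u1 s) + indicator {0<..<T} s * Lq_norm r (u2 s)) powr p) \<partial>lborel)
     \<le> ennreal ((Lpr_norm p r T u1 + Lpr_norm p r T u2) powr p)"
    by (rule Lnorm_le_indicator[OF L])
  ultimately have D: "(\<integral>\<^sup>+s\<in>{0<..<T}. ennreal (Lq_norm r (?d s) powr p) \<partial>lborel) < \<infinity>"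
    by (intro Lpr_norm_le(1)[OF _ p, where B = "Lpr_norm p r T u1 + Lpr_norm p r T u2"] add_nonneg_nonneg Lpr_norm_nonneg)
  show d: "in_LL p r T ?d"
    unfolding in_LL_def measurable_lborel_pair using md A B D by blast
  have "Lpr_norm p r T u1 \<le> Lpr_norm p r T u2 + Lpr_norm p r T ?d"
  proof (rule Lpr_norm_le(2)[OF _ p])
    show "AE s in lborel. s \<in> {0<..<T} \<longrightarrow> Lq_norm r (u1 s) \<le> indicator {0<..<T} s * Lq_norm r (u2 s) + indicator {0<..<T} s * Lq_norm r (?d s)"
      using fin by eventually_elim (use Lq_diff(3)[OF s1 s2, of r] pr in auto)
    have L: "Lnorm_le lborel p (\<lambda>s. indicator {0<..<T} s * Lq_norm r (u2 s) + indicator {0<..<T} s * Lq_norm r (?d s)) (Lpr_norm p r T u2 + Lpr_norm p r T ?d)"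
      by (intro Lnorm_le_add Lnorm_le_Lpr u2 d pr p)
    show "(\<integral>\<^sup>+s. indicator {0<..<T} s * ennreal ((indicator {0<..<T} s * Lq_norm r (u2 s) + indicator {0<..<T} s * Lq_norm r (?d s)) powr p) \<partial>lborel)
     \<le> ennreal ((Lpr_norm p r T u2 + Lpr_norm p r T ?d) powr p)"
      by (rule Lnorm_le_indicator[OF L])
  qed (simp add: Lpr_norm_nonneg)
  moreover have "Linf2_norm T u1 \<le> Linf2_norm T u2 + Linf2_norm T ?d"
  proof -
    have le: "Linf2_norm T u1 \<le> D2 + Dd" if D2: "D2 \<in> Linf2_set T u2" and Dd: "Dd \<in> Linf2_set T ?d" for D2 Dd
    proof (rule Linf2_norm_le)
      have "AE s in lborel. s \<in> {0<..<T} \<longrightarrow> Lq_norm 2 (u1 s) \<le> D2 + Dd"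
        using fin D2[unfolded Linf2_set_def, simplified, THEN conjunct2] Dd[unfolded Linf2_set_def, simplified, THEN conjunct2]
      proof eventually_elim
        case (elim s)
        show ?case
        proof
          assume s: "s \<in> {0<..<T}"
          have "Lq_norm 2 (u1 s) \<le> Lq_norm 2 (u2 s) + Lq_norm 2 (?d s)" using Lq_diff(3)[OF s1[of s] s2[of s], of 2] elim s by auto
          thus "Lq_norm 2 (u1 s) \<le> D2 + Dd" using elim s by auto
        qed
      qed
      thus "D2 + Dd \<in> Linf2_set T u1" using D2 Dd by (auto simp: Linf2_set_def)
    qed
    have "Linf2_norm T u1 - Linf2_norm T ?d \<le> D2" if D2: "D2 \<in> Linf2_set T u2" for D2
    proof -
      have "Linf2_norm T u1 - D2 \<le> Linf2_norm T ?d"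
        unfolding Linf2_norm_eq[of T ?d]
        by (rule cInf_greatest[OF in_LL_Linf2_set[OF d]]) (use le[OF D2] in \<open>simp add: algebra_simps\<close>)
      thus ?thesis by simp
    qed
    hence "Linf2_norm T u1 - Linf2_norm T ?d \<le> Linf2_norm T u2"
      unfolding Linf2_norm_eq[of T u2] by (rule cInf_greatest[OF in_LL_Linf2_set[OF u2]])
    thus ?thesis by simp
  qed
  ultimately show "LL_norm p r T u1 \<le> LL_norm p r T u2 + LL_norm p r T ?d" by (simp add: LL_norm_def)
qed

lemma LL_norm_commute: "LL_norm p r T (\<lambda>s x. u1 s x - u2 s x) = LL_norm p r T (\<lambda>s x. u2 s x - u1 s x)"
  by (simp add: LL_norm_def Linf2_norm_def Lpr_norm_def Lq_norm_def Lq_int_def norm_minus_commute)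

text \<open>Controls the arguments of the cut-off function at all times at once by the full norm of
  the difference; together with the Lipschitz bound this produces the factor for
  \<open>u1 - u2\<close>.\<close>

lemma LL_norm_diff_le:
  fixes u1 u2 :: "real \<Rightarrow> real^'n \<Rightarrow> complex"
  assumes u1: "in_LL p r T u1" and u2: "in_LL p r T u2" and pr: "p \<ge> 1" "r \<ge> 1" and s: "s \<le> T"
  shows "\<bar>LL_norm p r s u1 - LL_norm p r s u2\<bar> \<le> LL_norm p r T (\<lambda>s x. u1 s x - u2 s x)"
proof -
  note v1 = in_LL_mono[OF u1 s] and v2 = in_LL_mono[OF u2 s]
  have "\<bar>LL_norm p r s u1 - LL_norm p r s u2\<bar> \<le> LL_norm p r s (\<lambda>s x. u1 s x - u2 s x)"
    using in_LL_diff(2)[OF v1 v2 pr] in_LL_diff(2)[OF v2 v1 pr] LL_norm_commute[of p r s u1 u2] by linarith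
  also have "\<dots> \<le> LL_norm p r T (\<lambda>s x. u1 s x - u2 s x)"
    by (rule LL_norm_mono[OF in_LL_diff(1)[OF u1 u2 pr] s]) (use pr in auto)
  finally show ?thesis .
qed

lemma cutoff_Lpr_bound:
  fixes u :: "real \<Rightarrow> real^'n \<Rightarrow> complex"
  assumes u: "in_LL p r T u" and p: "p > 0" and K: "K \<ge> 0"
  shows "Lnorm_le lborel p (\<lambda>s. if s \<in> {0<..<T} \<and> LL_norm p r s u \<le> K then Lq_norm r (u s) else 0) K"
proof -
  \<comment> \<open>Capped at \<open>T\<close>, because the norm is known to be monotone only where
    \<open>u\<close> is controlled.\<close>
  define N where "N s = LL_norm p r (min s T) u" for s
  have "mono N" unfolding N_def by (intro monoI LL_norm_mono[OF u _ _ p]) auto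
  hence Nm [measurable]: "N \<in> borel_measurable borel" by (rule borel_measurable_mono)
  have [measurable]: "(\<lambda>s. Lq_norm r (u s)) \<in> borel_measurable borel"
    by (rule Lq_norm_measurable[OF in_LL_measurable[OF u]])
  define D where "D = {s\<in>{0<..<T}. LL_norm p r s u \<le> K}"
  have Deq: "D = {s\<in>{0<..<T}. N s \<le> K}" by (auto simp: D_def N_def min_def)
  have [measurable]: "D \<in> sets borel" unfolding Deq by measurable
  have up: "(\<integral>\<^sup>+s. indicator {0<..<t} s * ennreal (Lq_norm r (u s) powr p) \<partial>lborel) \<le> ennreal (K powr p)" if t: "t \<in> D" for t
  proof -
    have ut: "in_LL p r t u" using t by (intro in_LL_mono[OF u]) (auto simp: D_def)
    have "(\<integral>\<^sup>+s. indicator {0<..<t} s * ennreal (Lq_norm r (u s) powr p) \<partial>lborel)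
      = (\<integral>\<^sup>+s. ennreal ((indicator {0<..<t} s * Lq_norm r (u s)) powr p) \<partial>lborel)"
      by (intro nn_integral_cong) (auto simp: indicator_def)
    also have "\<dots> \<le> ennreal (Lpr_norm p r t u powr p)" using Lnorm_le_Lpr[OF ut p] by (simp add: Lnorm_le_def)
    also have "\<dots> \<le> ennreal (K powr p)"
      using t p Linf2_norm_nonneg[OF ut] by (intro ennreal_leI powr_mono2) (auto simp: Lpr_norm_nonneg D_def LL_norm_def)
    finally show ?thesis .
  qed
  have "(\<integral>\<^sup>+s. indicator D s * ennreal (Lq_norm r (u s) powr p) \<partial>lborel) \<le> ennreal (K powr p)"
  proof (cases "D = {}")
    case False
    \<comment> \<open>The supremum need not belong to \<open>D\<close>, so the interval is exhausted
      from below by times that lie under some element of \<open>D\<close>.\<close>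
    define S where "S = Sup D"
    have bdd: "bdd_above D" by (rule bdd_aboveI[of _ T]) (auto simp: D_def)
    have "(\<integral>\<^sup>+s. indicator D s * ennreal (Lq_norm r (u s) powr p) \<partial>lborel) \<le> (\<integral>\<^sup>+s. (SUP k. indicator {0<..<S - 1 / real (Suc k)} s * ennreal (Lq_norm r (u s) powr p)) \<partial>lborel)"
    proof (rule nn_integral_mono_AE)
      show "AE s in lborel. indicator D s * ennreal (Lq_norm r (u s) powr p) \<le> (SUP k. indicator {0<..<S - 1 / real (Suc k)} s * ennreal (Lq_norm r (u s) powr p))"
        using AE_lborel_singleton[of S]
      proof eventually_elim
        case (elim s)
        show ?case
        proof (cases "s \<in> D")
          case True
          hence "s < S" using cSup_upper[OF True bdd] elim by (simp add: S_def)
          then obtain k where "1 / real (Suc k) < S - s" using nat_approx_posE[of "S - s"] by auto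
          hence "s \<in> {0<..<S - 1 / real (Suc k)}" using True by (auto simp: D_def)
          thus ?thesis using True by (intro SUP_upper2[of k]) auto
        qed simp
      qed
    qed
    also have "\<dots> = (SUP k. (\<integral>\<^sup>+s. indicator {0<..<S - 1 / real (Suc k)} s * ennreal (Lq_norm r (u s) powr p) \<partial>lborel))"
    proof (rule nn_integral_monotone_convergence_SUP)
      show "incseq (\<lambda>k s. indicator {0<..<S - 1 / real (Suc k)} s * ennreal (Lq_norm r (u s) powr p))"
      proof (intro incseq_SucI le_funI mult_right_mono)
        fix k s
        have "1 / real (Suc (Suc k)) \<le> 1 / real (Suc k)" by (simp add: frac_le)
        thus "indicator {0<..<S - 1 / real (Suc k)} s \<le> (indicator {0<..<S - 1 / real (Suc (Suc k))} s :: ennreal)"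
          unfolding indicator_def by auto
      qed simp
    qed measurable
    also have "\<dots> \<le> ennreal (K powr p)"
    proof (rule SUP_least)
      fix k
      have "S - 1 / real (Suc k) < S" by simp
      then obtain t where t: "t \<in> D" "S - 1 / real (Suc k) < t" using less_cSup_iff[OF False bdd] unfolding S_def by blast
      have "(\<integral>\<^sup>+s. indicator {0<..<S - 1 / real (Suc k)} s * ennreal (Lq_norm r (u s) powr p) \<partial>lborel)
        \<le> (\<integral>\<^sup>+s. indicator {0<..<t} s * ennreal (Lq_norm r (u s) powr p) \<partial>lborel)"
        using t(2) by (intro nn_integral_mono mult_right_mono) (auto simp: indicator_def)
      also have "\<dots> \<le> ennreal (K powr p)" by (rule up[OF t(1)])
      finally show "(\<integral>\<^sup>+s. indicator {0<..<S - 1 / real (Suc k)} s * ennreal (Lq_norm r (u s) powr p) \<partial>lborel) \<le> ennreal (K powr p)" .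
    qed
    finally show ?thesis .
  qed simp
  moreover have "(\<integral>\<^sup>+s. ennreal ((if s \<in> {0<..<T} \<and> LL_norm p r s u \<le> K then Lq_norm r (u s) else 0) powr p) \<partial>lborel)
    = (\<integral>\<^sup>+s. indicator D s * ennreal (Lq_norm r (u s) powr p) \<partial>lborel)"
    by (intro nn_integral_cong) (auto simp: D_def indicator_def)
  moreover have "(\<lambda>s. if s \<in> {0<..<T} \<and> LL_norm p r s u \<le> K then Lq_norm r (u s) else 0) = (\<lambda>s. if s \<in> D then Lq_norm r (u s) else 0)"
    by (auto simp: D_def)
  moreover have "(\<lambda>s. if s \<in> D then Lq_norm r (u s) else 0) \<in> borel_measurable borel" by measurable
  ultimately show ?thesis using K unfolding Lnorm_le_def by (auto simp: Lq_norm_nonneg)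
qed

text \<open>Writing the difference as \<open>|a| powr (\<alpha> - 1)\<close> times
  \<open>a - b\<close> plus a multiple of the smaller number \<open>b\<close> leaves a
  one-dimensional mean value estimate for the moduli.\<close>

lemma nonlin_diff_le_aux:
  assumes ab: "cmod b \<le> cmod a" and \<alpha>: "\<alpha> > 1"
  shows "cmod (nonlin \<alpha> a - nonlin \<alpha> b) \<le> \<alpha> * (cmod a powr (\<alpha> - 1) * cmod (a - b))"
proof -
  let ?x = "cmod a" and ?y = "cmod b"
  have key: "(?x powr (\<alpha> - 1) - ?y powr (\<alpha> - 1)) * ?y \<le> (\<alpha> - 1) * ?x powr (\<alpha> - 1) * (?x - ?y)"
  proof (cases "?y = 0 \<or> ?y = ?x")
    case True thus ?thesis using \<alpha> ab by auto
  next
    case False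
    hence y: "0 < ?y" "?y < ?x" using ab by auto
    obtain z where z: "?y < z" "z < ?x" and e: "?x powr (\<alpha> - 1) - ?y powr (\<alpha> - 1) = (?x - ?y) * ((\<alpha> - 1) * z powr (\<alpha> - 1 - 1))"
    proof -
      have "((\<lambda>t. t powr (\<alpha> - 1)) has_real_derivative (\<alpha> - 1) * z powr (\<alpha> - 1 - 1)) (at z)"
        if "?y \<le> z" "z \<le> ?x" for z
        using that y(1) by (intro has_real_derivative_powr) linarith
      with MVT2[OF y(2), of "\<lambda>t. t powr (\<alpha> - 1)" "\<lambda>z. (\<alpha> - 1) * z powr (\<alpha> - 1 - 1)"] that
      show ?thesis by blast
    qed
    \<comment> \<open>The derivative involves the exponent \<open>\<alpha> - 2\<close>, which may be
      negative. The factor \<open>|b|\<close>, being at most \<open>z\<close>, lifts it to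
      \<open>\<alpha> - 1\<close>, after which the power is increasing.\<close>
    have "z powr (\<alpha> - 1 - 1) * ?y \<le> z powr (\<alpha> - 1 - 1) * z" using z by (intro mult_left_mono) auto
    also have "\<dots> = z powr (\<alpha> - 1)" using order_less_trans[OF y(1) z(1)] powr_add[of z "\<alpha> - 1 - 1" 1] by simp
    also have "\<dots> \<le> ?x powr (\<alpha> - 1)" using order_less_trans[OF y(1) z(1)] z \<alpha> by (intro powr_mono2) auto
    finally have "(\<alpha> - 1) * (?x - ?y) * (z powr (\<alpha> - 1 - 1) * ?y) \<le> (\<alpha> - 1) * (?x - ?y) * ?x powr (\<alpha> - 1)"
      using \<alpha> y by (intro mult_left_mono) auto
    thus ?thesis unfolding e by (simp add: mult_ac)
  qed
  have "nonlin \<alpha> a - nonlin \<alpha> b = complex_of_real (?x powr (\<alpha> - 1)) * (a - b) + complex_of_real (?x powr (\<alpha> - 1) - ?y powr (\<alpha> - 1)) * b"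
    by (simp add: nonlin_def algebra_simps)
  hence "cmod (nonlin \<alpha> a - nonlin \<alpha> b) \<le> cmod (complex_of_real (?x powr (\<alpha> - 1)) * (a - b)) + cmod (complex_of_real (?x powr (\<alpha> - 1) - ?y powr (\<alpha> - 1)) * b)"
    by (simp only: norm_triangle_ineq)
  also have "\<dots> = ?x powr (\<alpha> - 1) * cmod (a - b) + (?x powr (\<alpha> - 1) - ?y powr (\<alpha> - 1)) * ?y"
    using powr_mono2[of "\<alpha> - 1" ?y ?x] ab \<alpha> unfolding norm_mult norm_of_real by simp
  also have "\<dots> \<le> ?x powr (\<alpha> - 1) * cmod (a - b) + (\<alpha> - 1) * ?x powr (\<alpha> - 1) * (?x - ?y)"
    by (intro add_left_mono key)
  also have "\<dots> \<le> ?x powr (\<alpha> - 1) * cmod (a - b) + (\<alpha> - 1) * ?x powr (\<alpha> - 1) * cmod (a - b)"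
    using \<alpha> norm_triangle_ineq2[of a b] by (intro add_left_mono mult_left_mono) auto
  finally show ?thesis by (simp add: algebra_simps)
qed

lemma nonlin_diff_le:
  assumes \<alpha>: "\<alpha> > 1"
  shows "cmod (nonlin \<alpha> a - nonlin \<alpha> b) \<le> \<alpha> * ((cmod a powr (\<alpha> - 1) + cmod b powr (\<alpha> - 1)) * cmod (a - b))"
proof -
  have 1: "\<alpha> * (x * d) \<le> \<alpha> * ((x + y) * d)" "\<alpha> * (y * d) \<le> \<alpha> * ((x + y) * d)" if "x \<ge> 0" "y \<ge> 0" "d \<ge> 0" for x y d
    using that \<alpha> by (auto intro!: mult_left_mono mult_right_mono)
  show ?thesis
  proof (cases "cmod b \<le> cmod a")
    case True
    from nonlin_diff_le_aux[OF True \<alpha>] show ?thesis by (rule order_trans) (intro 1; simp)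
  next
    case False
    hence "cmod a \<le> cmod b" by simp
    from nonlin_diff_le_aux[OF this \<alpha>] show ?thesis
      unfolding norm_minus_commute[of "nonlin \<alpha> b"] norm_minus_commute[of b] by (rule order_trans) (intro 1; simp)
  qed
qed

lemma cmod_nonlin: "cmod (nonlin \<alpha> a) = cmod a powr \<alpha>"
  using powr_add[of "cmod a" "\<alpha> - 1" 1] by (cases "a = 0") (auto simp: nonlin_def norm_mult)

text \<open>The derivative is continuous, hence bounded on \<open>[-2, 2]\<close>, and vanishes
  elsewhere. The maximum with 1 makes the constant positive.\<close>

lemma smooth_cutoff_lipschitz:
  assumes sm: "smooth_real \<theta>" and supp: "closure {x. \<theta> x \<noteq> 0} \<subseteq> {-2<..<2}"
  obtains L where "L > 0" "\<And>x y. \<bar>\<theta> x - \<theta> y\<bar> \<le> L * \<bar>x - y\<bar>"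
proof -
  have d: "\<theta> differentiable (at x)" "deriv \<theta> differentiable (at x)" for x
    using sm[unfolded smooth_real_def, rule_format, of 0 x] sm[unfolded smooth_real_def, rule_format, of 1 x] by auto
  have D: "(\<theta> has_real_derivative deriv \<theta> x) (at x)" for x
    using d(1)[of x] by (simp add: DERIV_deriv_iff_real_differentiable)
  have "continuous_on {-2..2} (deriv \<theta>)"
    using d(2) by (auto intro!: continuous_at_imp_continuous_on differentiable_imp_continuous_within)
  hence "compact (deriv \<theta> ` {-2..2})" by (intro compact_continuous_image) auto
  then obtain L where L: "\<And>x. x \<in> {-2..2} \<Longrightarrow> \<bar>deriv \<theta> x\<bar> \<le> L"
    using compact_imp_bounded[of "deriv \<theta> ` {-2..2}"] unfolding bounded_iff by (metis imageI real_norm_def)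
  have out: "deriv \<theta> x = 0" if "x \<notin> {-2..2}" for x
  proof -
    have "\<forall>\<^sub>F y in nhds x. y \<in> - closure {x. \<theta> x \<noteq> 0}"
      using that supp by (intro eventually_nhds_in_open) auto
    hence "\<forall>\<^sub>F y in nhds x. \<theta> y = 0"
      by eventually_elim (use closure_subset[of "{x. \<theta> x \<noteq> 0}"] in blast)
    hence "(\<theta> has_real_derivative 0) (at x) \<longleftrightarrow> ((\<lambda>_. 0) has_real_derivative 0) (at x)"
      by (intro DERIV_cong_ev) auto
    thus ?thesis by (intro DERIV_imp_deriv) auto
  qed
  have b: "\<bar>deriv \<theta> x\<bar> \<le> max L 1" for x
    using L[of x] out[of x] by (cases "x \<in> {-2..2}") auto
  show ?thesis
  proof (rule that[of "max L 1"])
    show "\<bar>\<theta> x - \<theta> y\<bar> \<le> max L 1 * \<bar>x - y\<bar>" for x y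
      using field_differentiable_bound[of UNIV \<theta> "deriv \<theta>" "max L 1" x y] D b by simp
  qed simp
qed

section \<open>The contraction estimate\<close>

lemma Lq_norm_le:
  assumes "Lq_int q f \<le> ennreal (a powr q)" "a \<ge> 0" "q > 0"
  shows "Lq_norm q f \<le> a"
proof -
  have "enn2real (Lq_int q f) \<le> a powr q" using assms by (intro enn2real_leI) auto
  hence "Lq_norm q f \<le> (a powr q) powr (1 / q)" unfolding Lq_norm_def using assms by (intro powr_mono2) auto
  thus ?thesis using assms by (simp add: powr_powr)
qed

context duhamel_data
begin

text \<open>The first two bounds need no joint measurability of \<open>g\<close>, so they apply to
  any solutions related by \<open>duhamel_rel\<close>, which controls the single slices only. The
  first holds through every \<open>t\<close>, the second through almost every
  \<open>t\<close>.\<close>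

lemma LL_bounds:
  assumes g: "\<And>t. t \<in> {0..T} \<Longrightarrow> lin_duhamel f t (g t)"
  shows "Linf2_norm T g \<le> bound"
    "Lpr_norm p r T g \<le> disp_const r * (young_const p r * T powr ((p - r) / p) * B)"
    "case_prod g \<in> borel_measurable (borel \<Otimes>\<^sub>M borel) \<Longrightarrow> in_LL p r T g"
proof -
  have L2: "Lq_int 2 (g t) \<le> ennreal (bound powr 2)" if "t \<in> {0<..<T}" for t
    by (rule lin_duhamel_L2[OF g]) (use that in auto)
  show "Linf2_norm T g \<le> bound"
  proof (rule Linf2_norm_le)
    have "Lq_norm 2 (g t) \<le> bound" if "t \<in> {0<..<T}" for t
      by (rule Lq_norm_le[OF L2[OF that] bound_nonneg]) simp
    thus "bound \<in> Linf2_set T g" using bound_nonneg by (simp add: Linf2_set_def)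
  qed
  have disp: "disp_const r > 0" by (rule disp_const_pos[OF pr(1)])
  obtain Y where Y [measurable]: "Y \<in> borel_measurable borel" and Y0: "\<And>t. Y t \<ge> 0"
    and Y1: "AE t in lborel. t \<in> {0<..<T} \<longrightarrow> (\<integral>\<^sup>+s. ennreal (\<bar>t - s\<bar> powr (- 2 / p) * H s) \<partial>lborel) \<le> ennreal (Y t)"
    and Y2: "(\<integral>\<^sup>+t. indicator {0<..<T} t * ennreal (Y t powr p) \<partial>lborel) \<le> ennreal ((young_const p r * T powr ((p - r) / p) * B) powr p)"
    by (rule young_time[OF Hm H0 Hout pr T B HB]) (assumption | rule that)+
  have Lr: "AE t in lborel. t \<in> {0<..<T} \<longrightarrow> Lq_int r (g t) \<le> ennreal ((disp_const r * Y t) powr r)"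
    using Y1
  proof eventually_elim
    case (elim t)
    show ?case
    proof
      assume t: "t \<in> {0<..<T}"
      show "Lq_int r (g t) \<le> ennreal ((disp_const r * Y t) powr r)"
        by (rule lin_duhamel_Lr[OF g]) (use t elim Y0 in auto)
    qed
  qed
  have Lr': "AE t in lborel. t \<in> {0<..<T} \<longrightarrow> Lq_norm r (g t) \<le> disp_const r * Y t"
    using Lr by eventually_elim (use disp Y0 pr in \<open>auto intro!: Lq_norm_le\<close>)
  have b: "0 \<le> disp_const r * (young_const p r * T powr ((p - r) / p) * B)"
    using disp young_const_pos[OF pr(2,1)] B by simp
  have int: "(\<integral>\<^sup>+t. indicator {0<..<T} t * ennreal ((disp_const r * Y t) powr p) \<partial>lborel)
     \<le> ennreal ((disp_const r * (young_const p r * T powr ((p - r) / p) * B)) powr p)"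
  proof -
    have "(\<integral>\<^sup>+t. indicator {0<..<T} t * ennreal ((disp_const r * Y t) powr p) \<partial>lborel)
      = (\<integral>\<^sup>+t. ennreal (disp_const r powr p) * (indicator {0<..<T} t * ennreal (Y t powr p)) \<partial>lborel)"
      by (intro nn_integral_cong) (auto simp: powr_mult ennreal_mult mult_ac)
    also have "\<dots> = ennreal (disp_const r powr p) * (\<integral>\<^sup>+t. indicator {0<..<T} t * ennreal (Y t powr p) \<partial>lborel)"
      by (rule nn_integral_cmult) measurable
    also have "\<dots> \<le> ennreal (disp_const r powr p) * ennreal ((young_const p r * T powr ((p - r) / p) * B) powr p)"
      by (intro mult_left_mono Y2) auto
    finally show ?thesis by (simp add: ennreal_mult powr_mult)
  qed
  have p: "p > 0" using pr by simp
  show "Lpr_norm p r T g \<le> disp_const r * (young_const p r * T powr ((p - r) / p) * B)"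
    by (rule Lpr_norm_le(2)[OF Lr' p b int])
  assume gm: "case_prod g \<in> borel_measurable (borel \<Otimes>\<^sub>M borel)"
  show "in_LL p r T g"
    unfolding in_LL_def measurable_lborel_pair
  proof (intro conjI gm exI)
    show "AE t in lborel. t \<in> {0<..<T} \<longrightarrow> Lq_int 2 (g t) \<le> ennreal (bound powr 2)"
      using L2 by auto
    show "AE t in lborel. t \<in> {0<..<T} \<longrightarrow> Lq_int r (g t) < \<infinity>"
      using Lr by eventually_elim (auto intro: order_le_less_trans)
    show "(\<integral>\<^sup>+t\<in>{0<..<T}. ennreal (Lq_norm r (g t) powr p) \<partial>lborel) < \<infinity>"
      by (rule Lpr_norm_le(1)[OF Lr' p b int])
  qed
qed

end

text \<open>Zero outside \<open>(0, T)\<close>, where nothing is known about \<open>u\<close>; on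
  \<open>(0, t)\<close> with \<open>t \<le> T\<close> it is the source occurring in
  \<open>duhamel_rel\<close>.\<close>

definition force :: "(real \<Rightarrow> real) \<Rightarrow> real \<Rightarrow> real \<Rightarrow> real \<Rightarrow> real \<Rightarrow> real
    \<Rightarrow> (real \<Rightarrow> real^'n \<Rightarrow> complex) \<Rightarrow> real \<Rightarrow> real^'n \<Rightarrow> complex" where
  "force \<theta> R \<alpha> p r T u s x =
     (if s \<in> {0<..<T} then complex_of_real (\<theta> (LL_norm p r s u / R)) * nonlin \<alpha> (u s x) else 0)"

lemma force_measurable:
  fixes u :: "real \<Rightarrow> real^'n \<Rightarrow> complex"
  assumes u: "in_LL p r T u" and p: "p > 0" and th [measurable]: "\<theta> \<in> borel_measurable borel"
  shows "case_prod (force \<theta> R \<alpha> p r T u) \<in> borel_measurable (borel \<Otimes>\<^sub>M borel)"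
proof -
  define N where "N s = LL_norm p r (min s T) u" for s
  have "mono N" unfolding N_def by (intro monoI LL_norm_mono[OF u _ _ p]) auto
  hence [measurable]: "N \<in> borel_measurable borel" by (rule borel_measurable_mono)
  have [measurable]: "(\<lambda>z. u (fst z) (snd z)) \<in> borel_measurable (borel \<Otimes>\<^sub>M borel)"
    using in_LL_measurable[OF u] by (simp add: case_prod_beta)
  have "case_prod (force \<theta> R \<alpha> p r T u) = (\<lambda>z. if fst z \<in> {0<..<T} then
      complex_of_real (\<theta> (N (fst z) / R)) * (complex_of_real (cmod (u (fst z) (snd z)) powr (\<alpha> - 1)) * u (fst z) (snd z)) else 0)"
    by (auto simp: force_def N_def nonlin_def fun_eq_iff)
  thus ?thesis by simp
qed

lemma duhamel_rel_iff:
  "duhamel_rel \<theta> R \<alpha> p r T u g \<longleftrightarrow> (\<forall>t\<in>{0..T}. lin_duhamel (force \<theta> R \<alpha> p r T u) t (g t))"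
proof -
  have "(g t \<in> borel_measurable lborel \<and> Lq_int 2 (g t) < \<infinity> \<and>
       (\<forall>\<phi>. test_fun \<phi> \<longrightarrow>
          (let F = (\<lambda>s x. complex_of_real (\<theta> (LL_norm p r s u / R)) * nonlin \<alpha> (u s x)
                               * cnj (schr (s - t) \<phi> x))
           in (AE s in lborel. s \<in> {0<..<t} \<longrightarrow> integrable lborel (F s))
            \<and> set_integrable lborel {0<..<t} (\<lambda>s. \<integral> x. F s x \<partial>lborel)
            \<and> (\<integral> x. g t x * cnj (\<phi> x) \<partial>lborel)
                = (LINT s:{0<..<t}|lborel. (\<integral> x. F s x \<partial>lborel)))))
     \<longleftrightarrow> lin_duhamel (force \<theta> R \<alpha> p r T u) t (g t)" if t: "t \<in> {0..T}" for t
  proof -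
    have 1: "complex_of_real (\<theta> (LL_norm p r s u / R)) * nonlin \<alpha> (u s x) = force \<theta> R \<alpha> p r T u s x" if "s \<in> {0<..<t}" for s x
      using t that by (simp add: force_def)
    have 2: "(AE s in lborel. s \<in> {0<..<t} \<longrightarrow> integrable lborel (\<lambda>x. complex_of_real (\<theta> (LL_norm p r s u / R)) * nonlin \<alpha> (u s x) * cnj (schr (s - t) \<phi> x)))
       \<longleftrightarrow> (AE s in lborel. s \<in> {0<..<t} \<longrightarrow> integrable lborel (\<lambda>x. force \<theta> R \<alpha> p r T u s x * cnj (schr (s - t) \<phi> x)))" for \<phi>
      by (intro AE_cong) (auto simp: 1)
    have 3: "indicator {0<..<t} s *\<^sub>R (\<integral>x. complex_of_real (\<theta> (LL_norm p r s u / R)) * nonlin \<alpha> (u s x) * cnj (schr (s - t) \<phi> x) \<partial>lborel)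
       = indicator {0<..<t} s *\<^sub>R (\<integral>x. force \<theta> R \<alpha> p r T u s x * cnj (schr (s - t) \<phi> x) \<partial>lborel)" for \<phi> s
      by (cases "s \<in> {0<..<t}") (auto simp: 1)
    show ?thesis
      unfolding lin_duhamel_def Let_def set_integrable_def set_lebesgue_integral_def 2 3 by simp
  qed
  thus ?thesis unfolding duhamel_rel_def by blast
qed

text \<open>If only one argument is at most \<open>2 * R\<close>, the other cut-off value is 0, so
  the surviving one equals the difference of the two and the Lipschitz bound applies to it. Hence
  every power of \<open>a\<close> or \<open>b\<close> on the right carries its own indicator, which
  later removes the dependence on the size of the data.\<close>

lemma force_diff_le:
  assumes \<theta>: "\<And>x. 0 \<le> \<theta> x \<and> \<theta> x \<le> 1" and supp: "closure {x. \<theta> x \<noteq> 0} \<subseteq> {-2<..<2}"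
    and lip: "\<And>x y. \<bar>\<theta> x - \<theta> y\<bar> \<le> L * \<bar>x - y\<bar>" and R: "R > 0" and \<alpha>: "\<alpha> > 1" and L: "L \<ge> 0"
    and N: "\<bar>A1 - A2\<bar> \<le> N"
  defines "\<chi>1 \<equiv> (if A1 \<le> 2 * R then 1 else 0)" and "\<chi>2 \<equiv> (if A2 \<le> 2 * R then 1 else 0 :: real)"
  shows "cmod (complex_of_real (\<theta> (A1 / R)) * nonlin \<alpha> a - complex_of_real (\<theta> (A2 / R)) * nonlin \<alpha> b)
    \<le> L / R * N * ((\<chi>1 * cmod a) powr \<alpha> + (\<chi>2 * cmod b) powr \<alpha>)
      + \<alpha> * (((\<chi>1 * cmod a) powr (\<alpha> - 1) + (\<chi>2 * cmod b) powr (\<alpha> - 1)) * cmod (a - b))"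
proof -
  define t1 t2 where "t1 = \<theta> (A1 / R)" and "t2 = \<theta> (A2 / R)"
  have N0: "N \<ge> 0" using N by linarith
  have z: "\<theta> (A / R) = 0" if "A > 2 * R" for A
  proof -
    have "A / R > 2" using that R by (simp add: field_simps)
    thus ?thesis using supp closure_subset[of "{x. \<theta> x \<noteq> 0}"] by (metis (mono_tags, lifting) greaterThanLessThan_iff mem_Collect_eq not_less_iff_gr_or_eq subset_iff)
  qed
  have d: "\<bar>t1 - t2\<bar> \<le> L / R * N"
  proof -
    have "\<bar>t1 - t2\<bar> \<le> L * \<bar>A1 / R - A2 / R\<bar>" unfolding t1_def t2_def by (rule lip)
    also have "\<bar>A1 / R - A2 / R\<bar> = \<bar>A1 - A2\<bar> / R" using R by (simp add: diff_divide_distrib[symmetric] abs_divide)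
    also have "L * (\<bar>A1 - A2\<bar> / R) \<le> L * (N / R)" using L N R by (intro mult_left_mono divide_right_mono) auto
    finally show ?thesis by simp
  qed
  have c0: "0 \<le> L / R * N" using L R N0 by simp
  have t01: "0 \<le> t1" "t1 \<le> 1" "0 \<le> t2" "t2 \<le> 1" using \<theta> by (auto simp: t1_def t2_def)
  consider "A1 \<le> 2 * R" "A2 \<le> 2 * R" | "A1 \<le> 2 * R" "A2 > 2 * R" | "A1 > 2 * R" "A2 \<le> 2 * R" | "A1 > 2 * R" "A2 > 2 * R"
    by linarith
  thus ?thesis
  proof cases
    case 1
    have "complex_of_real t1 * nonlin \<alpha> a - complex_of_real t2 * nonlin \<alpha> b
      = complex_of_real (t1 - t2) * nonlin \<alpha> a + complex_of_real t2 * (nonlin \<alpha> a - nonlin \<alpha> b)"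
      by (simp add: algebra_simps)
    hence "cmod (complex_of_real t1 * nonlin \<alpha> a - complex_of_real t2 * nonlin \<alpha> b)
      \<le> cmod (complex_of_real (t1 - t2) * nonlin \<alpha> a) + cmod (complex_of_real t2 * (nonlin \<alpha> a - nonlin \<alpha> b))"
      by (simp only: norm_triangle_ineq)
    also have "\<dots> = \<bar>t1 - t2\<bar> * cmod a powr \<alpha> + t2 * cmod (nonlin \<alpha> a - nonlin \<alpha> b)"
      unfolding norm_mult norm_of_real cmod_nonlin using t01 by simp
    also have "\<dots> \<le> L / R * N * (cmod a powr \<alpha> + cmod b powr \<alpha>) + 1 * (\<alpha> * ((cmod a powr (\<alpha> - 1) + cmod b powr (\<alpha> - 1)) * cmod (a - b)))"
      using d c0 t01 \<alpha> by (intro add_mono mult_mono nonlin_diff_le) auto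
    finally show ?thesis using 1 by (simp add: t1_def t2_def \<chi>1_def \<chi>2_def)
  next
    case 2
    hence "t2 = 0" by (simp add: t2_def z)
    hence "cmod (complex_of_real t1 * nonlin \<alpha> a - complex_of_real t2 * nonlin \<alpha> b) = \<bar>t1 - t2\<bar> * cmod a powr \<alpha>"
      by (simp add: norm_mult cmod_nonlin)
    also have "\<dots> \<le> L / R * N * cmod a powr \<alpha>" by (intro mult_right_mono d) auto
    finally show ?thesis using 2 \<alpha> by (simp add: t1_def t2_def \<chi>1_def \<chi>2_def add_increasing2)
  next
    case 3
    hence "t1 = 0" by (simp add: t1_def z)
    hence "cmod (complex_of_real t1 * nonlin \<alpha> a - complex_of_real t2 * nonlin \<alpha> b) = \<bar>t1 - t2\<bar> * cmod b powr \<alpha>"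
      by (simp add: norm_mult cmod_nonlin)
    also have "\<dots> \<le> L / R * N * cmod b powr \<alpha>" by (intro mult_right_mono d) auto
    finally show ?thesis using 3 \<alpha> by (simp add: t1_def t2_def \<chi>1_def \<chi>2_def add_increasing2)
  next
    case 4
    hence "t1 = 0" "t2 = 0" by (simp_all add: t1_def t2_def z)
    thus ?thesis using 4 \<alpha> by (simp add: t1_def t2_def \<chi>1_def \<chi>2_def)
  qed
qed

text \<open>Admissibility gives \<open>2/p = (r - 2) * d / (2 * r)\<close>, and subcriticality is
  \<open>(r - 2) * d < 4\<close>; together they say \<open>2/p < 2/r\<close>.\<close>

lemma admissible_exponents:
  fixes \<alpha> p r d :: real
  assumes "1 < \<alpha>" "\<alpha> < 4 / d + 1" "r = \<alpha> + 1" "2 \<le> p" "2 / p = d / 2 - d / r" "d > 0"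
  shows "r > 2" "p > r"
proof -
  show r: "r > 2" using assms by simp
  have "(\<alpha> - 1) * d < 4" using assms(2,6) by (simp add: field_simps)
  hence d4: "(r - 2) * d < 4" using assms(3) by simp
  have "2 / p = (r - 2) * d / (2 * r)" using assms(5) r by (simp add: field_simps)
  also have "\<dots> < 4 / (2 * r)" using d4 r by (intro divide_strict_right_mono) auto
  finally have "2 / p < 2 / r" by simp
  thus "p > r" using r assms(4) by (simp add: field_simps)
qed

theorem theorem4p3:
  fixes \<theta> :: "real \<Rightarrow> real" and \<alpha> p r R :: real
  assumes theta_smooth: "smooth_real \<theta>"
    and theta_supp: "closure {x. \<theta> x \<noteq> 0} \<subseteq> {-2<..<2}"
    and theta_range: "\<forall>x. 0 \<le> \<theta> x \<and> \<theta> x \<le> 1"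
    and theta_one: "\<forall>x \<in> {-1..1}. \<theta> x = 1"
    and alpha: "1 < \<alpha>" "\<alpha> < 4 / real CARD('n) + 1"
    and r_def: "r = \<alpha> + 1"
    and adm: "2 \<le> p" "2 \<le> r" "2 / p = real CARD('n) / 2 - real CARD('n) / r"
    and R: "0 < R"
  shows "\<exists>C>0. \<forall>T>0.
     (\<forall>u :: real \<Rightarrow> real^'n \<Rightarrow> complex. in_LL p r T u \<longrightarrow>
        (\<exists>g. in_LL p r T g \<and> duhamel_rel \<theta> R \<alpha> p r T u g))
   \<and> (\<forall>(u1 :: real \<Rightarrow> real^'n \<Rightarrow> complex) u2 g1 g2.
        in_LL p r T u1 \<longrightarrow> in_LL p r T u2 \<longrightarrow>
        duhamel_rel \<theta> R \<alpha> p r T u1 g1 \<longrightarrow> duhamel_rel \<theta> R \<alpha> p r T u2 g2 \<longrightarrow>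
        LL_norm p r T (\<lambda>t x. g1 t x - g2 t x)
          \<le> C * T powr ((p - r) / p) * LL_norm p r T (\<lambda>t x. u1 t x - u2 t x))"
proof -
  have pr: "r > 2" "p > r" using admissible_exponents[OF alpha r_def adm(1,3)] by auto
  have p0: "p > 0" "p \<ge> 1" and r1: "r \<ge> 1" "r > 0" using pr by auto
  have \<alpha>r: "r - 1 = \<alpha>" using r_def by simp
  have \<theta>: "0 \<le> \<theta> x \<and> \<theta> x \<le> 1" for x using theta_range by blast
  obtain L where L: "L > 0" and lip: "\<And>x y. \<bar>\<theta> x - \<theta> y\<bar> \<le> L * \<bar>x - y\<bar>"
    by (rule smooth_cutoff_lipschitz[OF theta_smooth theta_supp]) (rule that)
  have "\<theta> differentiable (at x)" for x
    using theta_smooth[unfolded smooth_real_def, rule_format, of 0 x] by simp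
  hence "continuous_on UNIV \<theta>"
    by (auto intro!: continuous_at_imp_continuous_on differentiable_imp_continuous_within)
  hence \<theta>m: "\<theta> \<in> borel_measurable borel" by (rule borel_measurable_continuous_onI)
  \<comment> \<open>The factor of \<open>N\<close> in the time norm of the majorant \<open>H\<close>
    below: truncated norms are replaced by \<open>2 * R\<close>, and the \<open>L^p\<close> in time,
    \<open>L^r\<close> in space norm of \<open>u1 - u2\<close> by \<open>N\<close>.\<close>
  define K where "K = L / R * ((2 * R) powr \<alpha> + (2 * R) powr \<alpha>) + \<alpha> * ((2 * R) powr (\<alpha> - 1) + (2 * R) powr (\<alpha> - 1))"
  have K: "K > 0" using L R alpha by (simp add: K_def add_pos_pos)
  \<comment> \<open>The term with \<open>key_const\<close> pays for the \<open>L^\<infinity>\<close>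
    in time, \<open>L^2\<close> in space part of the norm, the other one for the \<open>L^p\<close>
    in time, \<open>L^r\<close> in space part.\<close>
  define C where "C = (key_const p r + disp_const r * young_const p r) * K"
  have C: "C > 0" using key_const_pos[OF pr] disp_const_pos[OF pr(1)] young_const_pos[OF pr(2,1)] K
    by (simp add: C_def add_pos_pos)
  show ?thesis
  proof (intro exI[of _ C] conjI C allI impI)
    fix T :: real and u :: "real \<Rightarrow> real^'n \<Rightarrow> complex"
    assume T: "T > 0" and u: "in_LL p r T u"
    \<comment> \<open>For the mapping property \<open>\<theta> \<le> 1\<close> suffices and the
      bound may depend on \<open>u\<close>. As \<open>r/(r - 1) = r/\<alpha>\<close>, the dual norm
      of the nonlinearity is the \<open>\<alpha>\<close>-th power of the \<open>L^r\<close>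
      norm.\<close>
    define H where "H s = (indicator {0<..<T} s * Lq_norm r (u s)) powr \<alpha>" for s
    have LH: "Lnorm_le lborel (p / \<alpha>) H (Lpr_norm p r T u powr \<alpha>)"
      unfolding H_def using alpha by (intro Lnorm_le_powr Lnorm_le_Lpr u p0) auto
    interpret D: duhamel_data p r T "Lpr_norm p r T u powr \<alpha>" "force \<theta> R \<alpha> p r T u" H
    proof unfold_locales
      show "case_prod (force \<theta> R \<alpha> p r T u) \<in> borel_measurable (borel \<Otimes>\<^sub>M borel)"
        by (rule force_measurable[OF u p0(1) \<theta>m])
      show "AE s in lborel. s \<in> {0<..<T} \<longrightarrow> Lq_int (r / (r - 1)) (force \<theta> R \<alpha> p r T u s) \<le> ennreal (H s powr (r / (r - 1)))"
        using in_LL_AE_finite[OF u]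
      proof eventually_elim
        case (elim s)
        show ?case
        proof
          assume s: "s \<in> {0<..<T}"
          have "Lnorm_le lborel (r / \<alpha>) (\<lambda>x. cmod (u s x) powr \<alpha>) (Lq_norm r (u s) powr \<alpha>)"
            using elim s alpha by (intro Lnorm_le_powr Lnorm_le_cmod measurable_slice in_LL_measurable[OF u] r1) auto
          moreover have "cmod (force \<theta> R \<alpha> p r T u s x) \<le> cmod (u s x) powr \<alpha>" for x
            using \<theta>[of "LL_norm p r s u / R"] by (simp add: force_def norm_mult cmod_nonlin mult_left_le_one_le)
          ultimately have "Lq_int (r / \<alpha>) (force \<theta> R \<alpha> p r T u s) \<le> ennreal ((Lq_norm r (u s) powr \<alpha>) powr (r / \<alpha>))"
            using r1 alpha by (intro Lnorm_le_Lq(1)) auto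
          thus "Lq_int (r / (r - 1)) (force \<theta> R \<alpha> p r T u s) \<le> ennreal (H s powr (r / (r - 1)))"
            using s by (simp add: \<alpha>r H_def)
        qed
      qed
      show "H \<in> borel_measurable borel" using LH by (simp add: Lnorm_le_def)
      show "(\<integral>\<^sup>+s. ennreal (H s powr (p / (r - 1))) \<partial>lborel) \<le> ennreal ((Lpr_norm p r T u powr \<alpha>) powr (p / (r - 1)))"
        using LH by (simp add: Lnorm_le_def \<alpha>r)
    qed (use pr adm T in \<open>auto simp: H_def\<close>)
    obtain g where g: "case_prod g \<in> borel_measurable (borel \<Otimes>\<^sub>M borel)" "\<And>t. t \<in> {0..T} \<Longrightarrow> lin_duhamel (force \<theta> R \<alpha> p r T u) t (g t)"
      using D.exists_solution by auto
    show "\<exists>g. in_LL p r T g \<and> duhamel_rel \<theta> R \<alpha> p r T u g"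
      using D.LL_bounds(3)[OF g(2,1)] g(2) by (auto simp: duhamel_rel_iff)
  next
    fix T :: real and u1 u2 g1 g2 :: "real \<Rightarrow> real^'n \<Rightarrow> complex"
    assume T: "T > 0" and u1: "in_LL p r T u1" and u2: "in_LL p r T u2"
      and g1: "duhamel_rel \<theta> R \<alpha> p r T u1 g1" and g2: "duhamel_rel \<theta> R \<alpha> p r T u2 g2"
    let ?d = "\<lambda>s x. u1 s x - u2 s x"
    define N where "N = LL_norm p r T ?d"
    have d: "in_LL p r T ?d" by (rule in_LL_diff(1)[OF u1 u2 p0(2) r1(1)])
    have N0: "N \<ge> 0" unfolding N_def by (rule LL_norm_nonneg[OF d])
    have LN: "Lpr_norm p r T ?d \<le> N" using Linf2_norm_nonneg[OF d] by (simp add: N_def LL_norm_def)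
    \<comment> \<open>Beyond norm \<open>2 * R\<close> the cut-off function vanishes;
      \<open>cutoff_Lpr_bound\<close> then gives this truncation a time norm of at most
      \<open>2 * R\<close> for any \<open>u\<close>.\<close>
    define v where "v u s = (if s \<in> {0<..<T} \<and> LL_norm p r s u \<le> 2 * R then Lq_norm r (u s) else 0)" for u :: "real \<Rightarrow> real^'n \<Rightarrow> complex" and s
    define w where "w s = indicator {0<..<T} s * Lq_norm r (?d s)" for s
    have c0: "L / R * N \<ge> 0" using L R N0 by simp
    define H where "H s = L / R * N * (v u1 s powr \<alpha> + v u2 s powr \<alpha>) + \<alpha> * ((v u1 s powr (\<alpha> - 1) + v u2 s powr (\<alpha> - 1)) * w s)" for s
    define B0 where "B0 = L / R * N * ((2 * R) powr \<alpha> + (2 * R) powr \<alpha>) + \<alpha> * (((2 * R) powr (\<alpha> - 1) + (2 * R) powr (\<alpha> - 1)) * Lpr_norm p r T ?d)"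
    have LH: "Lnorm_le lborel (p / \<alpha>) H B0"
      unfolding H_def B0_def v_def w_def
      using pr \<alpha>r alpha R by (intro Lnorm_le_nonlin cutoff_Lpr_bound u1 u2 Lnorm_le_Lpr d p0 c0) auto
    have B0: "B0 \<le> K * N"
    proof -
      have "\<alpha> * (((2 * R) powr (\<alpha> - 1) + (2 * R) powr (\<alpha> - 1)) * Lpr_norm p r T ?d) \<le> \<alpha> * (((2 * R) powr (\<alpha> - 1) + (2 * R) powr (\<alpha> - 1)) * N)"
        using alpha LN by (intro mult_left_mono) auto
      thus ?thesis unfolding B0_def K_def by (simp add: algebra_simps)
    qed
    let ?f = "\<lambda>s x. force \<theta> R \<alpha> p r T u1 s x - force \<theta> R \<alpha> p r T u2 s x"
    note fm = force_measurable[OF u1 p0(1) \<theta>m] force_measurable[OF u2 p0(1) \<theta>m]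
    interpret D: duhamel_data p r T "K * N" ?f H
    proof unfold_locales
      show "case_prod ?f \<in> borel_measurable (borel \<Otimes>\<^sub>M borel)"
        using fm[of R \<alpha>] by (simp add: case_prod_beta)
      show "AE s in lborel. s \<in> {0<..<T} \<longrightarrow> Lq_int (r / (r - 1)) (?f s) \<le> ennreal (H s powr (r / (r - 1)))"
        using in_LL_AE_finite[OF u1] in_LL_AE_finite[OF u2] in_LL_AE_finite[OF d]
      proof eventually_elim
        case (elim s)
        show ?case unfolding \<alpha>r
        proof
          assume s: "s \<in> {0<..<T}"
          define U where "U u x = (if LL_norm p r s u \<le> 2 * R then 1 else 0) * cmod (u s x)" for u :: "real \<Rightarrow> real^'n \<Rightarrow> complex" and x
          have LU: "Lnorm_le lborel r (U u) (v u s)" if u: "in_LL p r T u" and fin: "Lq_int r (u s) < \<infinity>" for u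
          proof (cases "LL_norm p r s u \<le> 2 * R")
            case True
            thus ?thesis using s Lnorm_le_cmod[OF measurable_slice[OF in_LL_measurable[OF u]] fin r1(2)] by (simp add: U_def[abs_def] v_def)
          next
            case False
            thus ?thesis by (simp add: U_def[abs_def] v_def Lnorm_le_def)
          qed
          have LW: "Lnorm_le lborel r (\<lambda>x. cmod (?d s x)) (w s)"
            using s Lnorm_le_cmod[OF measurable_slice[OF in_LL_measurable[OF d]], of r s] elim r1 by (simp add: w_def)
          have "Lnorm_le lborel (r / \<alpha>) (\<lambda>x. L / R * N * (U u1 x powr \<alpha> + U u2 x powr \<alpha>) + \<alpha> * ((U u1 x powr (\<alpha> - 1) + U u2 x powr (\<alpha> - 1)) * cmod (?d s x))) (H s)"
            unfolding H_def using elim s r_def alpha by (intro Lnorm_le_nonlin LU u1 u2 LW c0) auto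
          moreover have "cmod (?f s x) \<le> L / R * N * (U u1 x powr \<alpha> + U u2 x powr \<alpha>) + \<alpha> * ((U u1 x powr (\<alpha> - 1) + U u2 x powr (\<alpha> - 1)) * cmod (?d s x))" for x
          proof -
            have "\<bar>LL_norm p r s u1 - LL_norm p r s u2\<bar> \<le> N"
              unfolding N_def by (rule LL_norm_diff_le[OF u1 u2 p0(2) r1(1)]) (use s in auto)
            from force_diff_le[OF \<theta> theta_supp lip R alpha(1) _ this, of "u1 s x" "u2 s x"] L s
            show ?thesis by (simp add: force_def U_def)
          qed
          ultimately show "Lq_int (r / \<alpha>) (?f s) \<le> ennreal (H s powr (r / \<alpha>))"
            using r1 alpha by (intro Lnorm_le_Lq(1)) auto
        qed
      qed
      show "H \<in> borel_measurable borel" "\<And>s. 0 \<le> H s" using LH by (auto simp: Lnorm_le_def)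
      have "(\<integral>\<^sup>+s. ennreal (H s powr (p / \<alpha>)) \<partial>lborel) \<le> ennreal (B0 powr (p / \<alpha>))" using LH by (simp add: Lnorm_le_def)
      also have "\<dots> \<le> ennreal ((K * N) powr (p / \<alpha>))"
        using B0 LH p0 alpha by (intro ennreal_leI powr_mono2) (auto simp: Lnorm_le_def)
      finally show "(\<integral>\<^sup>+s. ennreal (H s powr (p / (r - 1))) \<partial>lborel) \<le> ennreal ((K * N) powr (p / (r - 1)))" by (simp add: \<alpha>r)
    qed (use pr adm T K N0 in \<open>auto simp: H_def v_def w_def\<close>)
    have g: "lin_duhamel ?f t (\<lambda>x. g1 t x - g2 t x)" if "t \<in> {0..T}" for t
      using g1 g2 that by (intro lin_duhamel_diff fm) (auto simp: duhamel_rel_iff)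
    have "LL_norm p r T (\<lambda>t x. g1 t x - g2 t x) \<le> D.bound + disp_const r * (young_const p r * T powr ((p - r) / p) * (K * N))"
      unfolding LL_norm_def by (intro add_mono D.LL_bounds(1,2) g)
    also have "\<dots> = C * T powr ((p - r) / p) * N" by (simp add: C_def algebra_simps)
    finally show "LL_norm p r T (\<lambda>t x. g1 t x - g2 t x) \<le> C * T powr ((p - r) / p) * LL_norm p r T ?d"
      by (simp add: N_def)
  qed
qed

end
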